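(* Let $0<\alpha<1$ and $\theta>-\alpha$, and let $M_n$ be the maximum of an exchangeable sample $X_1,\dots,X_n$ of size $n$ from the $\mathsf{GEM}(\alpha,\theta)$ distribution. Then for each $x>0$ $$\mathbb{P}_{\alpha,\theta}\bigl[M_n\le x\,n^{\alpha/(1-\alpha)}\bigr]\to\mathbb{E}_{\alpha,\theta}\exp\bigl(-\alpha D_\alpha^{1/\alpha}x^{-(1-\alpha)/\alpha}\bigr)\quad\text{as } n\to\infty,$$ where $D_\alpha$ is the $\alpha$-diversity of the sample.
   Context: The $\mathsf{GEM}(\alpha,\theta)$ distribution is the law of the random probability distribution $P_\bullet=(P_1,P_2,\dots)$ on $\{1,2,\dots\}$ given by $P_j:=H_j\prod_{i=1}^{j-1}(1-H_i)$ with independent $H_i$, where $H_i$ has the beta$(1-\alpha,\theta+i\alpha)$ distribution. A sample from $P_\bullet$ means that, conditionally given $P_\bullet$, $X_1,X_2,\dots$ are i.i.d. with $\mathbb{P}(X_i=b\mid P_\bullet)=P_b$. The subscript in $\mathbb{P}_{\alpha,\theta},\mathbb{E}_{\alpha,\theta}$ indicates that $\mathsf{GEM}(\alpha,\theta)$ governs. Let $K_n$ be the number of distinct values among $X_1,\dots,X_n$. It is known that $D_\alpha:=\lim_{n\to\infty}K_n/n^\alpha$ exists and is strictly positive almost surely; $D_\alpha$ is called the $\alpha$-diversity. Its distribution (which depends on $\theta$) is determined by its moments, for $p>0$, $$\mathbb{E}_{\alpha,\theta}D_\alpha^p=\frac{\Gamma(\theta+1)}{\Gamma(\frac{\theta}{\alpha}+1)}\,\frac{\Gamma(p+\frac{\theta}{\alpha}+1)}{\Gamma(p\alpha+\theta+1)}.$$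 *)

theory Defs
  imports "HOL-Probability.Probability"
begin

definition beta_density :: "real \<Rightarrow> real \<Rightarrow> real \<Rightarrow> real" where
  "beta_density a b x =
    (if 0 < x \<and> x < 1 then x powr (a - 1) * (1 - x) powr (b - 1) / Beta a b else 0)"

definition beta_distribution :: "real \<Rightarrow> real \<Rightarrow> real measure" where
  "beta_distribution a b = density lborel (\<lambda>x. ennreal (beta_density a b x))"

text \<open>Sequences indexed by \<open>{1, 2, \<dots>}\<close> are elements of the product space over the index
  set \<open>{1..}\<close>; in particular they take the value \<open>undefined\<close> at \<open>0\<close>.\<close>

abbreviation seq_space :: "(nat \<Rightarrow> real) measure" where
  "seq_space \<equiv> \<Pi>\<^sub>M j\<in>{1..}. borel"

definition stick_breaking :: "(nat \<Rightarrow> real) \<Rightarrow> nat \<Rightarrow> real" where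
  "stick_breaking h = (\<lambda>j\<in>{1..}. h j * (\<Prod>i\<in>{1..<j}. 1 - h i))"

definition GEM :: "real \<Rightarrow> real \<Rightarrow> (nat \<Rightarrow> real) measure" where
  "GEM \<alpha> \<theta> =
    distr (\<Pi>\<^sub>M i\<in>{1..}. beta_distribution (1 - \<alpha>) (\<theta> + real i * \<alpha>)) seq_space stick_breaking"

text \<open>The sample \<open>X\<^sub>1, X\<^sub>2, \<dots>\<close> (\<open>X i\<close> is constrained for \<open>i \<ge> 1\<close> only) is conditionally i.i.d.
  given the \<open>\<sigma>\<close>-algebra generated by \<open>P\<close>, with conditional law \<open>P\<close>. Since the \<open>X i\<close> are
  discrete, this is expressed by the conditional joint probability mass functions.\<close>

definition sample_from :: "'a measure \<Rightarrow> ('a \<Rightarrow> nat \<Rightarrow> real) \<Rightarrow> (nat \<Rightarrow> 'a \<Rightarrow> nat) \<Rightarrow> bool" where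
  "sample_from M P X \<longleftrightarrow>
    P \<in> measurable M seq_space \<and>
    (\<forall>i\<ge>1. X i \<in> measurable M (count_space {1..})) \<and>
    (\<forall>n b. (\<forall>i\<in>{1..n}. b i \<ge> 1) \<longrightarrow>
      (AE \<omega> in M.
        real_cond_exp M (vimage_algebra (space M) P seq_space)
          (indicator {\<omega>\<in>space M. \<forall>i\<in>{1..n}. X i \<omega> = b i}) \<omega>
        = (\<Prod>i\<in>{1..n}. P \<omega> (b i))))"

definition num_distinct :: "(nat \<Rightarrow> 'a \<Rightarrow> nat) \<Rightarrow> nat \<Rightarrow> 'a \<Rightarrow> nat" where
  "num_distinct X n \<omega> = card ((\<lambda>i. X i \<omega>) ` {1..n})"

definition sample_max :: "(nat \<Rightarrow> 'a \<Rightarrow> nat) \<Rightarrow> nat \<Rightarrow> 'a \<Rightarrow> nat" where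
  "sample_max X n \<omega> = Max ((\<lambda>i. X i \<omega>) ` {1..n})"

text \<open>The limit exists and is positive almost surely for a sample from a \<open>GEM \<alpha> \<theta>\<close>
  distribution; where it does not exist the value is unspecified.\<close>

definition alpha_diversity :: "real \<Rightarrow> (nat \<Rightarrow> 'a \<Rightarrow> nat) \<Rightarrow> 'a \<Rightarrow> real" where
  "alpha_diversity \<alpha> X \<omega> = lim (\<lambda>n. real (num_distinct X n \<omega>) / real n powr \<alpha>)"

end

theory Submission
  imports Defs
begin

text \<open>
  Write \<open>H\<^sub>i\<close> for the independent beta sticks, \<open>W\<^sub>k = (1 - H\<^sub>1) \<cdots> (1 - H\<^sub>k)\<close> for the mass that
  the first \<open>k\<close> sticks leave over, and \<open>\<gamma> = (1 - \<alpha>) / \<alpha>\<close>. Given the frequencies, \<open>M\<^sub>n \<le> k\<close> has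
  probability \<open>(1 - W\<^sub>k)\<^sup>n\<close>. Almost surely \<open>W\<^sub>k\<close> behaves like \<open>C * k powr (- \<gamma>)\<close> with a
  random \<open>C > 0\<close>; for \<open>k\<close> close to \<open>x\<close> times the \<open>1 / \<gamma>\<close>-th power of \<open>n\<close> the conditional probability
  therefore tends to \<open>exp (- C x powr (- \<gamma>))\<close>, and bounded convergence gives the limit of the
  unconditional probability. It remains to see that \<open>C = \<alpha> D powr (1 / \<alpha>)\<close> almost surely, where \<open>D\<close>
  is the diversity. Up to null sets both sides are functions of the same frequencies, and the identity holds pathwise.

  The constant \<open>C\<close> exists because \<open>ln W\<^sub>k\<close> is \<open>- (H\<^sub>1 + \<cdots> + H\<^sub>k)\<close> up to an absolutely convergent
  series, the centred sums of the \<open>H\<^sub>i\<close> converge, their means add up to \<open>\<gamma> ln k\<close> plus a convergent sequence, and \<open>W\<close> is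
  monotone (\<open>stick_remainder_regular\<close>, \<open>AE_centred_sticks_converge\<close>).

  For the diversity, the number \<open>K\<^sub>n\<close> of distinct values is close to its conditional mean, the sum over
  \<open>j\<close> of \<open>1 - (1 - P\<^sub>j)\<^sup>n\<close>, and \<open>P\<^sub>j = H\<^sub>j W\<^sub>j\<^sub>-\<^sub>1\<close> is close to \<open>C j powr (- \<gamma>) H\<^sub>j\<close>. So one needs the
  growth in \<open>\<lambda>\<close> of the sum of \<open>1 - exp (- \<lambda> j powr (- \<gamma>) H\<^sub>j)\<close>. Let \<open>A\<^sub>j = 1 + \<theta> + (j - 1) \<alpha>\<close> be the
  sum of the two parameters of the law of \<open>H\<^sub>j\<close>. A beta variable \<open>H\<close> with parameters \<open>a, b\<close> satisfies the exact
  identity \<open>E (1 + v H) powr (- (a + b)) = (1 + v) powr (- a)\<close> (\<open>beta_power_expectation\<close>), so it pays to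
  replace the exponential by \<open>(1 + \<mu> j powr (- 1 / \<alpha>) H\<^sub>j) powr (- A\<^sub>j)\<close> with \<open>\<lambda> = \<alpha> \<mu>\<close>. The expectations
  \<open>1 - (1 + \<mu> j powr (- 1 / \<alpha>)) powr (- (1 - \<alpha>))\<close> of the resulting summands are the values at the integers
  of a decreasing function with the antiderivative \<open>t - (t powr (1 / \<alpha>) + \<mu>) powr \<alpha>\<close>, and their sum is
  \<open>\<mu> powr \<alpha> + O(1)\<close> (\<open>expected_occupancy_sum\<close>).
  Taking \<open>\<mu> = n C / \<alpha>\<close> gives \<open>K\<^sub>n / n powr \<alpha> \<longlonglongrightarrow> (C / \<alpha>) powr \<alpha>\<close>, which is the required identity
  (\<open>expected_count_asymp\<close>, \<open>AE_num_distinct_asymp\<close>).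

  Both replacements of a random sum by its mean, that of \<open>K\<^sub>n\<close> by its conditional mean and that of the sum of
  the powers by its expectation, are instances of the same strong law for sums of pairwise negatively
  correlated variables in the unit interval: the variance is at most the mean
  (\<open>chi_square_count_bound\<close>), and monotonicity in \<open>n\<close> reduces almost sure convergence to a sparse
  subsequence (\<open>LLN_along_powers\<close>).
\<close>

section \<open>Elementary limits and series\<close>

lemma summable_inverse_squares_Suc: "summable (\<lambda>j. C / (real (Suc j))\<^sup>2)"
proof -
  have "summable (\<lambda>j. inverse ((real (Suc j))\<^sup>2))"
    using inverse_power_summable[of 2, where 'a=real] summable_Suc_iff[of "\<lambda>j. inverse (real j ^ 2)"] by simp
  from summable_mult[OF this, of C] show ?thesis by (simp add: divide_inverse)
qed

text \<open>For a monotone sequence, growth of order \<open>\<rho>\<close> along the sparse sequence of \<open>m\<close>-th powers forces the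
  same growth everywhere, since consecutive \<open>m\<close>-th powers have ratio tending to \<open>1\<close>. This is what turns
  Borel-Cantelli type estimates along a subsequence into full limits.\<close>
lemma power_block_limit:
  fixes \<rho> D :: real and S :: "nat \<Rightarrow> real"
  assumes "mono S" and nonneg: "\<And>n. 0 \<le> S n" and \<rho>: "0 < \<rho>" and m: "0 < m"
    and lim: "(\<lambda>k. S (k ^ m) / real (k ^ m) powr \<rho>) \<longlonglongrightarrow> D"
  shows "(\<lambda>n. S n / real n powr \<rho>) \<longlonglongrightarrow> D"
proof -
  define k where "k n = (GREATEST j. j ^ m \<le> n)" for n :: nat
  have bd: "j \<le> n" if "j ^ m \<le> n" for j n :: nat
    by (rule order_trans[OF _ that], cases "j = 0") (use m in \<open>auto simp: power_0_left intro: self_le_power\<close>)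
  have k1: "k n ^ m \<le> n" for n
    unfolding k_def by (rule GreatestI_nat[where b = n and k = 0]) (use m bd in \<open>auto simp: power_0_left\<close>)
  have k2: "n < Suc (k n) ^ m" for n
  proof (rule ccontr)
    assume "\<not> ?thesis"
    then have "Suc (k n) \<le> k n"
      unfolding k_def by (intro Greatest_le_nat[where b = n]) (use bd in auto)
    then show False by simp
  qed
  have k_top: "filterlim k at_top sequentially"
    unfolding filterlim_at_top
  proof
    fix Z show "\<forall>\<^sub>F n in sequentially. Z \<le> k n"
      using eventually_ge_at_top[of "Z ^ m"]
    proof eventually_elim
      case (elim n) then show ?case
        unfolding k_def by (intro Greatest_le_nat[where b = n]) (use bd in auto)
    qed
  qed
  have ratio: "(\<lambda>j. (real (j ^ m) / real (Suc j ^ m)) powr \<rho>) \<longlonglongrightarrow> 1"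
  proof -
    have "(\<lambda>j. real j / real (Suc j)) \<longlonglongrightarrow> 1" by (rule LIMSEQ_n_over_Suc_n)
    then have "(\<lambda>j. ((real j / real (Suc j)) ^ m) powr \<rho>) \<longlonglongrightarrow> (1 ^ m) powr \<rho>"
      by (intro tendsto_intros) auto
    then show ?thesis by (simp add: power_divide)
  qed
  have lo: "(\<lambda>j. S (j ^ m) / real (j ^ m) powr \<rho> * (real (j ^ m) / real (Suc j ^ m)) powr \<rho>) \<longlonglongrightarrow> D"
    using tendsto_mult[OF lim ratio] by simp
  have hi: "(\<lambda>j. S (Suc j ^ m) / real (Suc j ^ m) powr \<rho> / (real (j ^ m) / real (Suc j ^ m)) powr \<rho>) \<longlonglongrightarrow> D"
    using tendsto_divide[OF LIMSEQ_Suc[OF lim] ratio] by simp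
  show ?thesis
  proof (rule tendsto_sandwich[OF _ _ filterlim_compose[OF lo k_top] filterlim_compose[OF hi k_top]])
    have ev: "\<forall>\<^sub>F n in sequentially. 1 \<le> k n"
      using k_top unfolding filterlim_at_top by blast
    show "\<forall>\<^sub>F n in sequentially. S (k n ^ m) / real (k n ^ m) powr \<rho> *
        (real (k n ^ m) / real (Suc (k n) ^ m)) powr \<rho> \<le> S n / real n powr \<rho>"
      using ev
    proof eventually_elim
      case (elim n)
      have pos: "0 < k n ^ m" using elim by simp
      then have n: "0 < n" using k1[of n] by linarith
      have "S (k n ^ m) / real (k n ^ m) powr \<rho> * (real (k n ^ m) / real (Suc (k n) ^ m)) powr \<rho>
          = S (k n ^ m) / real (Suc (k n) ^ m) powr \<rho>"
        using pos by (simp add: powr_divide)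
      also have "\<dots> \<le> S n / real n powr \<rho>"
        using n k1[of n] k2[of n] \<rho> nonneg
        by (intro frac_le monoD[OF \<open>mono S\<close>] powr_mono2) (auto simp del: of_nat_power power_Suc)
      finally show ?case .
    qed
    show "\<forall>\<^sub>F n in sequentially. S n / real n powr \<rho> \<le> S (Suc (k n) ^ m) /
        real (Suc (k n) ^ m) powr \<rho> / (real (k n ^ m) / real (Suc (k n) ^ m)) powr \<rho>"
      using ev
    proof eventually_elim
      case (elim n)
      have pos: "0 < k n ^ m" using elim by simp
      have "S n / real n powr \<rho> \<le> S (Suc (k n) ^ m) / real (k n ^ m) powr \<rho>"
        using pos k1[of n] k2[of n] \<rho> nonneg
        by (intro frac_le monoD[OF \<open>mono S\<close>] powr_mono2) (auto simp del: of_nat_power power_Suc)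
      also have "\<dots> = S (Suc (k n) ^ m) / real (Suc (k n) ^ m) powr \<rho> / (real (k n ^ m) / real (Suc (k n) ^ m)) powr \<rho>"
        using pos by (simp add: powr_divide del: of_nat_power power_Suc)
      finally show ?case .
    qed
  qed
qed

lemma nat_floor_ratio_tendsto_1:
  fixes y :: "nat \<Rightarrow> real"
  assumes y: "filterlim y at_top sequentially"
  shows "(\<lambda>n. real (nat \<lfloor>y n\<rfloor>) / y n) \<longlonglongrightarrow> 1"
proof (rule tendsto_sandwich[OF _ _ _ tendsto_const])
  have "(\<lambda>n. 1 - inverse (y n)) \<longlonglongrightarrow> 1 - 0" by (intro tendsto_intros tendsto_inverse_0_at_top y)
  then show "(\<lambda>n. 1 - inverse (y n)) \<longlonglongrightarrow> 1" by simp
  have pos: "\<forall>\<^sub>F n in sequentially. 0 < y n"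
    using y by (simp add: filterlim_at_top_dense)
  show "\<forall>\<^sub>F n in sequentially. 1 - inverse (y n) \<le> real (nat \<lfloor>y n\<rfloor>) / y n"
    using pos
  proof eventually_elim
    case (elim n)
    have "y n - 1 \<le> real (nat \<lfloor>y n\<rfloor>)" by linarith
    then have "(y n - 1) / y n \<le> real (nat \<lfloor>y n\<rfloor>) / y n" using elim by (intro divide_right_mono) auto
    then show ?case using elim by (simp add: diff_divide_distrib inverse_eq_divide)
  qed
  show "\<forall>\<^sub>F n in sequentially. real (nat \<lfloor>y n\<rfloor>) / y n \<le> 1"
    using pos by eventually_elim simp
qed

text \<open>The random constant \<open>C\<close> enters the comparison of the counts as a real factor in front of \<open>n\<close>, while
  the strong law is proved along the naturals; monotonicity bridges the two.\<close>
lemma regular_growth_rescale: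
  fixes f :: "real \<Rightarrow> real"
  assumes mono: "\<And>s t. 0 \<le> s \<Longrightarrow> s \<le> t \<Longrightarrow> f s \<le> f t"
    and lim: "(\<lambda>n. f (real n) / real n powr \<rho>) \<longlonglongrightarrow> D" and r: "0 < r"
  shows "(\<lambda>n. f (r * real n) / real n powr \<rho>) \<longlonglongrightarrow> D * r powr \<rho>"
proof -
  define k where "k n = nat \<lfloor>r * real n\<rfloor>" for n :: nat
  have top: "filterlim (\<lambda>n. r * real n) at_top sequentially"
    using r by (intro filterlim_tendsto_pos_mult_at_top[OF tendsto_const] filterlim_real_sequentially)
  have kr: "(\<lambda>n. real (k n) / real n) \<longlonglongrightarrow> r"
    using tendsto_mult_left[OF nat_floor_ratio_tendsto_1[OF top], of r] r by (simp add: k_def)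
  from top have k_top: "filterlim k at_top sequentially"
    unfolding k_def
    by (intro filterlim_compose[OF filterlim_nat_sequentially] filterlim_compose[OF filterlim_floor_sequentially])
  have kr': "(\<lambda>n. real (Suc (k n)) / real n) \<longlonglongrightarrow> r"
    using tendsto_add[OF kr lim_inverse_n] by (simp add: add_divide_distrib inverse_eq_divide add.commute)
  have lo: "(\<lambda>n. f (real (k n)) / real (k n) powr \<rho> * (real (k n) / real n) powr \<rho>) \<longlonglongrightarrow> D * r powr \<rho>"
    using r by (intro tendsto_mult filterlim_compose[OF lim k_top] tendsto_powr kr tendsto_const) auto
  have hi: "(\<lambda>n. f (real (Suc (k n))) / real (Suc (k n)) powr \<rho> * (real (Suc (k n)) / real n) powr \<rho>) \<longlonglongrightarrow> D * r powr \<rho>"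
    using r by (intro tendsto_mult filterlim_compose[OF lim] filterlim_compose[OF filterlim_Suc k_top] tendsto_powr kr' tendsto_const) auto
  have ev: "\<forall>\<^sub>F n in sequentially. 0 < n \<and> 0 < k n"
    using eventually_conj[OF eventually_gt_at_top[of 0] filterlim_at_top[THEN iffD1, OF k_top, rule_format, of 1]]
    by (simp add: Suc_le_eq)
  show ?thesis
  proof (rule tendsto_sandwich[OF _ _ lo hi])
    show "\<forall>\<^sub>F n in sequentially. f (real (k n)) / real (k n) powr \<rho> * (real (k n) / real n) powr \<rho> \<le> f (r * real n) / real n powr \<rho>"
      using ev
    proof eventually_elim
      case (elim n)
      have "real (k n) \<le> r * real n" using r by (simp add: k_def)
      then show ?case using elim by (simp add: powr_divide) (intro divide_right_mono mono; simp)
    qed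
    show "\<forall>\<^sub>F n in sequentially. f (r * real n) / real n powr \<rho> \<le> f (real (Suc (k n))) / real (Suc (k n)) powr \<rho> * (real (Suc (k n)) / real n) powr \<rho>"
      using ev
    proof eventually_elim
      case (elim n)
      have "r * real n \<le> real (Suc (k n))" using r by (simp add: k_def of_nat_nat) linarith
      then have "f (r * real n) / real n powr \<rho> \<le> f (real (Suc (k n))) / real n powr \<rho>"
        using r by (intro divide_right_mono mono) auto
      then show ?case using elim by (simp add: powr_divide del: of_nat_Suc)
    qed
  qed
qed

lemma suminf_le_suminf_plus_exceptions:
  fixes f g :: "nat \<Rightarrow> real"
  assumes "summable f" "summable g" and "\<And>j. f j \<le> g j + 1" and "\<And>j. B \<le> j \<Longrightarrow> f j \<le> g j"
  shows "suminf f \<le> suminf g + real B"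
proof -
  have s: "(\<lambda>j. if j < B then 1 else 0 :: real) sums real B"
    using sums_If_finite[of "\<lambda>j. j < B" "\<lambda>_. 1::real"] by simp
  have "suminf f \<le> (\<Sum>j. g j + (if j < B then 1 else 0))"
    using assms by (intro suminf_le summable_add sums_summable[OF s]) (auto simp: not_less)
  also have "\<dots> = suminf g + real B"
    using assms by (subst suminf_add[symmetric]) (auto simp: sums_unique[OF s, symmetric] intro: sums_summable[OF s])
  finally show ?thesis .
qed

lemma suminf_outside_finite:
  fixes p :: "nat \<Rightarrow> real"
  assumes p: "p sums s" and nn: "\<And>j. 0 \<le> p j" and T: "finite T"
  shows "(\<Sum>j. if j \<in> - T then ennreal (p j) else 0) = ennreal (s - (\<Sum>j\<in>T. p j))"
    and "(\<Sum>j\<in>T. p j) \<le> s"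
proof -
  have *: "(\<lambda>j. p j - (if j \<in> T then p j else 0)) sums (s - (\<Sum>j\<in>T. p j))"
    by (intro sums_diff p sums_If_finite_set T)
  also have "(\<lambda>j. p j - (if j \<in> T then p j else 0)) = (\<lambda>j. if j \<in> - T then p j else 0)" by auto
  finally have s: "(\<lambda>j. if j \<in> - T then p j else 0) sums (s - (\<Sum>j\<in>T. p j))" .
  have "(\<Sum>j. if j \<in> - T then ennreal (p j) else 0) = (\<Sum>j. ennreal (if j \<in> - T then p j else 0))"
    by (intro suminf_cong) auto
  also have "\<dots> = ennreal (\<Sum>j. if j \<in> - T then p j else 0)"
    using nn by (intro suminf_ennreal2 sums_summable[OF s]) auto
  finally show "(\<Sum>j. if j \<in> - T then ennreal (p j) else 0) = ennreal (s - (\<Sum>j\<in>T. p j))"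
    using sums_unique[OF s] by simp
  have "0 \<le> s - (\<Sum>j\<in>T. p j)" by (rule sums_le[OF _ sums_zero s]) (use nn in auto)
  then show "(\<Sum>j\<in>T. p j) \<le> s" by simp
qed

text \<open>Continuity of the power leaves room for a strict inequality between rates.\<close>
lemma powr_gap:
  fixes \<kappa> \<rho> a :: real
  assumes "0 < \<kappa>"
  shows "a < \<kappa> powr \<rho> \<Longrightarrow> \<exists>r>0. r < \<kappa> \<and> a < r powr \<rho>"
    and "\<kappa> powr \<rho> < a \<Longrightarrow> \<exists>r>\<kappa>. r powr \<rho> < a"
proof -
  have cont: "((\<lambda>r. r powr \<rho>) \<longlongrightarrow> \<kappa> powr \<rho>) (at \<kappa> within S)" for S
    using assms by (intro tendsto_intros) auto
  show "\<exists>r>0. r < \<kappa> \<and> a < r powr \<rho>" if "a < \<kappa> powr \<rho>"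
  proof -
    have "\<forall>\<^sub>F r in at_left \<kappa>. (0 < r \<and> r < \<kappa>) \<and> a < r powr \<rho>"
      using assms that
      by (intro eventually_conj order_tendstoD(1)[OF cont]) (auto simp: eventually_at_left_field intro!: exI[of _ 0])
    then show ?thesis using eventually_happens[of _ "at_left \<kappa>"] by (auto simp: trivial_limit_at_left_real)
  qed
  show "\<exists>r>\<kappa>. r powr \<rho> < a" if "\<kappa> powr \<rho> < a"
  proof -
    have "\<forall>\<^sub>F r in at_right \<kappa>. \<kappa> < r \<and> r powr \<rho> < a"
      using that by (intro eventually_conj order_tendstoD(2)[OF cont] eventually_at_right_less) auto
    then show ?thesis using eventually_happens[of _ "at_right \<kappa>"] by (auto simp: trivial_limit_at_right_real)
  qed
qed

lemma power_one_minus_tendsto_exp: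
  fixes t :: "nat \<Rightarrow> real"
  assumes lim: "(\<lambda>n. real n * t n) \<longlonglongrightarrow> a"
  shows "(\<lambda>n. (1 - t n) ^ n) \<longlonglongrightarrow> exp (- a)"
proof -
  have t0: "t \<longlonglongrightarrow> 0"
  proof -
    have "(\<lambda>n. real n * t n * inverse (real n)) \<longlonglongrightarrow> a * 0" by (intro tendsto_intros lim lim_inverse_n)
    then have "(\<lambda>n. real n * t n * inverse (real n)) \<longlonglongrightarrow> 0" by simp
    then show ?thesis
      by (rule Lim_transform_eventually) (use eventually_gt_at_top[of 0] in eventually_elim, simp)
  qed
  have small: "\<forall>\<^sub>F n in sequentially. \<bar>t n\<bar> < 1 / 2"
    using tendsto_rabs[OF t0] by (rule order_tendstoD) simp
  have "(\<lambda>n. real n * (ln (1 - t n) + t n)) \<longlonglongrightarrow> 0"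
  proof (rule Lim_null_comparison)
    have "(\<lambda>n. 2 * \<bar>real n * t n\<bar> * \<bar>t n\<bar>) \<longlonglongrightarrow> 2 * \<bar>a\<bar> * \<bar>0\<bar>" by (intro tendsto_intros lim t0)
    then show "(\<lambda>n. 2 * \<bar>real n * t n\<bar> * \<bar>t n\<bar>) \<longlonglongrightarrow> 0" by simp
    show "\<forall>\<^sub>F n in sequentially. norm (real n * (ln (1 - t n) + t n)) \<le> 2 * \<bar>real n * t n\<bar> * \<bar>t n\<bar>"
      using small
    proof eventually_elim
      case (elim n)
      then have "\<bar>ln (1 - t n) + t n\<bar> \<le> 2 * (t n)\<^sup>2" using abs_ln_one_plus_x_minus_x_bound[of "- t n"] by simp
      then have "real n * \<bar>ln (1 - t n) + t n\<bar> \<le> real n * (2 * (t n)\<^sup>2)" by (intro mult_left_mono) auto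
      also have "\<dots> = 2 * \<bar>real n * t n\<bar> * \<bar>t n\<bar>" by (simp add: abs_mult power2_eq_square)
      finally show ?case by (simp add: abs_mult)
    qed
  qed
  from tendsto_exp[OF tendsto_diff[OF this lim]]
  have "(\<lambda>n. exp (real n * (ln (1 - t n) + t n) - real n * t n)) \<longlonglongrightarrow> exp (- a)" by simp
  then show ?thesis
  proof (rule Lim_transform_eventually, use small in eventually_elim)
    case (elim n)
    have "real n * (ln (1 - t n) + t n) - real n * t n = real n * ln (1 - t n)" by (simp add: algebra_simps)
    then show ?case using elim by (simp add: exp_of_nat_mult)
  qed
qed

section \<open>A strong law from a relative variance bound\<close>

lemma AE_summable_if_summable_integrals:
  fixes f :: "nat \<Rightarrow> 'a \<Rightarrow> real"
  assumes [measurable]: "\<And>j. f j \<in> borel_measurable M"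
    and nonneg: "\<And>j. AE x in M. 0 \<le> f j x"
    and le: "\<And>j. (\<integral>\<^sup>+x. ennreal (f j x) \<partial>M) \<le> ennreal (a j)"
    and a: "summable a" "\<And>j. 0 \<le> a j"
  shows "AE x in M. summable (\<lambda>j. f j x)"
proof -
  have "(\<integral>\<^sup>+x. (\<Sum>j. ennreal (f j x)) \<partial>M) = (\<Sum>j. \<integral>\<^sup>+x. ennreal (f j x) \<partial>M)"
    by (rule nn_integral_suminf) simp
  also have "\<dots> \<le> (\<Sum>j. ennreal (a j))"
    by (intro suminf_le le) auto
  also have "\<dots> = ennreal (suminf a)"
    by (intro suminf_ennreal2 a)
  finally have "(\<integral>\<^sup>+x. (\<Sum>j. ennreal (f j x)) \<partial>M) \<noteq> \<infinity>"
    by (auto simp: top_unique)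
  then have "AE x in M. (\<Sum>j. ennreal (f j x)) \<noteq> \<infinity>"
    by (intro nn_integral_noteq_infinite) auto
  moreover have "AE x in M. \<forall>j. 0 \<le> f j x" by (subst AE_all_countable) (use nonneg in blast)
  ultimately show ?thesis
    by eventually_elim (auto intro: summable_suminf_not_top)
qed

text \<open>If the relative fluctuation \<open>(S\<^sub>n - Q\<^sub>n)\<^sup>2 / Q\<^sub>n\<close> has expectation at most \<open>1\<close> and \<open>Q\<^sub>n\<close> grows like
  \<open>n powr \<alpha>\<close>, then \<open>(S\<^sub>n / Q\<^sub>n - 1)\<^sup>2\<close> is of order \<open>n powr (- \<alpha>)\<close>, which is summable along \<open>n = k\<^sup>m\<close> once
  \<open>m \<alpha> \<ge> 2\<close>. The centring \<open>Q\<close> may be random, as it is when \<open>Q\<^sub>n\<close> is a conditional expectation.\<close>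
lemma LLN_along_powers:
  fixes S Q :: "nat \<Rightarrow> 'a \<Rightarrow> real" and D :: "'a \<Rightarrow> real"
  assumes [measurable]: "\<And>n. S n \<in> borel_measurable M" "\<And>n. Q n \<in> borel_measurable M"
    and \<alpha>: "0 < \<alpha>"
    and mono: "AE x in M. mono (\<lambda>n. S n x) \<and> (\<forall>n. 0 \<le> S n x)"
    and Q: "AE x in M. \<forall>n\<ge>1. 0 < Q n x"
    and chi: "\<And>n. 1 \<le> n \<Longrightarrow> (\<integral>\<^sup>+x. ennreal ((S n x - Q n x)\<^sup>2 / Q n x) \<partial>M) \<le> 1"
    and lim: "AE x in M. (\<lambda>n. Q n x / real n powr \<alpha>) \<longlonglongrightarrow> D x"
  shows "AE x in M. (\<lambda>n. S n x / real n powr \<alpha>) \<longlonglongrightarrow> D x"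
proof -
  \<comment> \<open>along \<open>n = k\<^sup>m\<close> the bound \<open>n powr (- \<alpha>)\<close> is at most \<open>1 / k\<^sup>2\<close>\<close>
  obtain m :: nat where m: "2 / \<alpha> < real m" using reals_Archimedean2 by blast
  with \<alpha> have m0: "0 < m" and m2: "2 \<le> real m * \<alpha>"
    by (auto simp: field_simps intro!: Nat.gr0I)
  define Z where "Z k x = (S (Suc k ^ m) x - Q (Suc k ^ m) x)\<^sup>2 / Q (Suc k ^ m) x / (real (Suc k))\<^sup>2" for k x
  have [measurable]: "Z k \<in> borel_measurable M" for k unfolding Z_def by measurable
  have "AE x in M. summable (\<lambda>k. Z k x)"
  proof (rule AE_summable_if_summable_integrals)
    show "AE x in M. 0 \<le> Z j x" for j
      using Q by eventually_elim (simp add: Z_def less_imp_le)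
    show "(\<integral>\<^sup>+x. ennreal (Z j x) \<partial>M) \<le> ennreal (1 / (real (Suc j))\<^sup>2)" for j
    proof -
      have "(\<integral>\<^sup>+x. ennreal (Z j x) \<partial>M) =
          (\<integral>\<^sup>+x. ennreal (1 / (real (Suc j))\<^sup>2) * ennreal ((S (Suc j ^ m) x - Q (Suc j ^ m) x)\<^sup>2 / Q (Suc j ^ m) x) \<partial>M)"
        unfolding Z_def by (intro nn_integral_cong) (simp add: ennreal_mult'[symmetric] mult.commute del: power_Suc of_nat_Suc)
      also have "\<dots> = ennreal (1 / (real (Suc j))\<^sup>2) *
          (\<integral>\<^sup>+x. ennreal ((S (Suc j ^ m) x - Q (Suc j ^ m) x)\<^sup>2 / Q (Suc j ^ m) x) \<partial>M)"
        by (rule nn_integral_cmult) measurable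
      also have "\<dots> \<le> ennreal (1 / (real (Suc j))\<^sup>2) * 1"
        by (intro mult_left_mono chi) auto
      finally show ?thesis by simp
    qed
    show "summable (\<lambda>j. 1 / (real (Suc j))\<^sup>2)"
      by (rule summable_inverse_squares_Suc)
  qed auto
  with mono Q lim show ?thesis
  proof eventually_elim
    case (elim x)
    define n where "n k = Suc k ^ m" for k
    have n_top: "filterlim n at_top sequentially"
      by (rule filterlim_at_top_mono[OF filterlim_Suc])
         (use m0 in \<open>auto simp: n_def intro!: always_eventually self_le_power\<close>)
    have Qlim: "(\<lambda>k. Q (n k) x / real (n k) powr \<alpha>) \<longlonglongrightarrow> D x"
      using filterlim_compose[OF _ n_top] elim(3) by blast
    have Zlim: "(\<lambda>k. Z k x) \<longlonglongrightarrow> 0" using elim(4) by (rule summable_LIMSEQ_zero)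
    have pow: "(real (Suc k))\<^sup>2 \<le> real (n k) powr \<alpha>" for k
    proof -
      have "(real (Suc k))\<^sup>2 = real (Suc k) powr 2" by simp
      also have "\<dots> \<le> real (Suc k) powr (real m * \<alpha>)" by (intro powr_mono m2) auto
      also have "\<dots> = real (n k) powr \<alpha>"
        unfolding n_def by (simp add: powr_powr[symmetric] powr_realpow del: of_nat_Suc power_Suc)
      finally show ?thesis .
    qed
    have pos: "0 < Q (n k) x" "0 < real (n k) powr \<alpha>" for k
      using elim(2) by (auto simp: n_def)
    have "(\<lambda>k. ((S (n k) x - Q (n k) x) / real (n k) powr \<alpha>)\<^sup>2) \<longlonglongrightarrow> 0"
    proof (rule tendsto_sandwich[OF _ _ tendsto_const])
      show "(\<lambda>k. Z k x * (Q (n k) x / real (n k) powr \<alpha>)) \<longlonglongrightarrow> 0"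
        using tendsto_mult[OF Zlim Qlim] by simp
      show "\<forall>\<^sub>F k in sequentially. ((S (n k) x - Q (n k) x) / real (n k) powr \<alpha>)\<^sup>2
          \<le> Z k x * (Q (n k) x / real (n k) powr \<alpha>)"
      proof (rule always_eventually, rule allI)
        fix k
        have "((S (n k) x - Q (n k) x) / real (n k) powr \<alpha>)\<^sup>2
            = (S (n k) x - Q (n k) x)\<^sup>2 / real (n k) powr \<alpha> / real (n k) powr \<alpha>"
          by (simp add: power_divide power2_eq_square)
        also have "\<dots> \<le> (S (n k) x - Q (n k) x)\<^sup>2 / (real (Suc k))\<^sup>2 / real (n k) powr \<alpha>"
          using pos pow[of k] by (intro divide_right_mono divide_left_mono) auto
        also have "\<dots> = Z k x * (Q (n k) x / real (n k) powr \<alpha>)"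
          using pos[of k] by (simp add: Z_def n_def[symmetric])
        finally show "((S (n k) x - Q (n k) x) / real (n k) powr \<alpha>)\<^sup>2
          \<le> Z k x * (Q (n k) x / real (n k) powr \<alpha>)" .
      qed
    qed auto
    then have "(\<lambda>k. \<bar>(S (n k) x - Q (n k) x) / real (n k) powr \<alpha>\<bar>) \<longlonglongrightarrow> 0"
      using tendsto_real_sqrt by fastforce
    then have "(\<lambda>k. (S (n k) x - Q (n k) x) / real (n k) powr \<alpha>) \<longlonglongrightarrow> 0"
      by (rule tendsto_rabs_zero_cancel)
    from tendsto_add[OF this Qlim] have "(\<lambda>k. S (n k) x / real (n k) powr \<alpha>) \<longlonglongrightarrow> D x"
      by (simp add: diff_divide_distrib)
    then have "(\<lambda>k. S (k ^ m) x / real (k ^ m) powr \<alpha>) \<longlonglongrightarrow> D x"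
      unfolding n_def by (rule LIMSEQ_imp_Suc)
    then show ?case
      using elim(1) by (intro power_block_limit[OF _ _ \<alpha> m0]) auto
  qed
qed

text \<open>Variance at most mean, in a form that covers constant and conditional means at once: \<open>q\<^sub>j\<close> stands for
  the (conditional) mean of \<open>I\<^sub>j\<close>, and conditioning is expressed by the weight \<open>1 / Q\<close>, a function of the
  conditioning variable. Off the diagonal the correlations are dominated by \<open>q\<^sub>i q\<^sub>j\<close>; on the diagonal
  \<open>I\<^sub>j\<^sup>2 \<le> I\<^sub>j\<close> contributes \<open>Q\<close>, that is \<open>1\<close> after division by \<open>Q\<close>.\<close>
lemma chi_square_count_bound:
  fixes I q :: "nat \<Rightarrow> 'a \<Rightarrow> real" and M :: "'a measure"
  defines "S \<equiv> \<lambda>x. \<Sum>j. I j x" and "Q \<equiv> \<lambda>x. \<Sum>j. q j x"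
  assumes M: "prob_space M"
    and [measurable]: "\<And>j. I j \<in> borel_measurable M" "\<And>j. q j \<in> borel_measurable M"
    and I01: "\<And>j. AE x in M. 0 \<le> I j x \<and> I j x \<le> 1"
    and q0: "\<And>j. AE x in M. 0 \<le> q j x"
    and sumI: "AE x in M. summable (\<lambda>j. I j x)"
    and sumq: "AE x in M. summable (\<lambda>j. q j x) \<and> 0 < Q x"
    and mean: "\<And>j. (\<integral>\<^sup>+x. ennreal (I j x) \<partial>M) = (\<integral>\<^sup>+x. ennreal (q j x) \<partial>M)"
    and weighted_mean: "\<And>j. (\<integral>\<^sup>+x. ennreal (I j x / Q x) \<partial>M) = (\<integral>\<^sup>+x. ennreal (q j x / Q x) \<partial>M)"
    and weighted_neg_corr: "\<And>i j. i \<noteq> j \<Longrightarrow>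
      (\<integral>\<^sup>+x. ennreal (I i x * I j x / Q x) \<partial>M) \<le> (\<integral>\<^sup>+x. ennreal (q i x * q j x / Q x) \<partial>M)"
    and fin: "(\<integral>\<^sup>+x. ennreal (Q x) \<partial>M) \<noteq> \<infinity>"
  shows "(\<integral>\<^sup>+x. ennreal ((S x - Q x)\<^sup>2 / Q x) \<partial>M) \<le> 1"
proof -
  interpret prob_space M by fact
  have [measurable]: "S \<in> borel_measurable M" "Q \<in> borel_measurable M"
    unfolding S_def Q_def by measurable
  have q0': "AE x in M. \<forall>j. 0 \<le> q j x" by (subst AE_all_countable) (use q0 in blast)
  have I01': "AE x in M. \<forall>j. 0 \<le> I j x \<and> I j x \<le> 1" by (subst AE_all_countable) (use I01 in blast)
  have double: "ennreal ((\<Sum>j. a j)\<^sup>2 / c) = (\<Sum>i. \<Sum>j. ennreal (a i * a j / c))"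
    if "summable a" "\<And>j. 0 \<le> a j" "0 < c" for a :: "nat \<Rightarrow> real" and c
  proof -
    have "(\<Sum>i. \<Sum>j. ennreal (a i * a j / c)) = (\<Sum>i. ennreal (a i * (suminf a) / c))"
    proof (intro suminf_cong)
      fix i
      have "(\<Sum>j. ennreal (a i * a j / c)) = ennreal (\<Sum>j. a i * a j / c)"
        using that by (intro suminf_ennreal2 summable_divide summable_mult) auto
      also have "(\<Sum>j. a i * a j / c) = a i * suminf a / c"
        using that by (simp add: suminf_divide suminf_mult summable_mult)
      finally show "(\<Sum>j. ennreal (a i * a j / c)) = ennreal (a i * suminf a / c)" .
    qed
    also have "\<dots> = ennreal (\<Sum>i. a i * suminf a / c)"
      using that by (intro suminf_ennreal2 summable_divide summable_mult2 divide_nonneg_nonneg mult_nonneg_nonneg suminf_nonneg) auto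
    also have "(\<Sum>i. a i * suminf a / c) = (suminf a)\<^sup>2 / c"
      using that by (simp add: suminf_divide suminf_mult2[symmetric] summable_mult2 power2_eq_square)
    finally show ?thesis ..
  qed
  have "(\<integral>\<^sup>+x. ennreal ((S x)\<^sup>2 / Q x) \<partial>M)
      = (\<integral>\<^sup>+x. (\<Sum>i. \<Sum>j. ennreal (I i x * I j x / Q x)) \<partial>M)"
    by (rule nn_integral_cong_AE) (use sumI sumq I01' in \<open>eventually_elim, auto simp: S_def intro!: double\<close>)
  also have "\<dots> = (\<Sum>i. \<Sum>j. \<integral>\<^sup>+x. ennreal (I i x * I j x / Q x) \<partial>M)"
    by (simp add: nn_integral_suminf)
  also have "\<dots> \<le> (\<Sum>i. (\<Sum>j. \<integral>\<^sup>+x. ennreal (q i x * q j x / Q x) \<partial>M) + (\<integral>\<^sup>+x. ennreal (q i x / Q x) \<partial>M))"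
  proof (intro suminf_le summableI)
    fix i
    let ?d = "\<integral>\<^sup>+x. ennreal (q i x / Q x) \<partial>M"
    have "(\<Sum>j. \<integral>\<^sup>+x. ennreal (I i x * I j x / Q x) \<partial>M)
        \<le> (\<Sum>j. (\<integral>\<^sup>+x. ennreal (q i x * q j x / Q x) \<partial>M) + (if j = i then ?d else 0))"
    proof (intro suminf_le summableI)
      fix j
      show "(\<integral>\<^sup>+x. ennreal (I i x * I j x / Q x) \<partial>M)
        \<le> (\<integral>\<^sup>+x. ennreal (q i x * q j x / Q x) \<partial>M) + (if j = i then ?d else 0)"
      proof (cases "j = i")
        case True
        have "(\<integral>\<^sup>+x. ennreal (I i x * I i x / Q x) \<partial>M) \<le> (\<integral>\<^sup>+x. ennreal (I i x / Q x) \<partial>M)"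
        proof (rule nn_integral_mono_AE, use sumq I01' in eventually_elim)
          case (elim x)
          then have "I i x * I i x \<le> I i x * 1" by (intro mult_left_mono) auto
          with elim show ?case by (intro ennreal_leI divide_right_mono) auto
        qed
        then show ?thesis using True weighted_mean[of i] by (simp add: add_increasing)
      qed (use weighted_neg_corr[of i j] in auto)
    qed
    also have "\<dots> = (\<Sum>j. \<integral>\<^sup>+x. ennreal (q i x * q j x / Q x) \<partial>M) + ?d"
      by (subst suminf_add[symmetric]) (auto simp: sums_unique[OF sums_single, symmetric])
    finally show "(\<Sum>j. \<integral>\<^sup>+x. ennreal (I i x * I j x / Q x) \<partial>M)
        \<le> (\<Sum>j. \<integral>\<^sup>+x. ennreal (q i x * q j x / Q x) \<partial>M) + ?d" .
  qed
  also have "\<dots> = (\<integral>\<^sup>+x. (\<Sum>i. \<Sum>j. ennreal (q i x * q j x / Q x)) \<partial>M)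
      + (\<integral>\<^sup>+x. (\<Sum>i. ennreal (q i x / Q x)) \<partial>M)"
    by (simp add: nn_integral_suminf suminf_add)
  also have "(\<integral>\<^sup>+x. (\<Sum>i. \<Sum>j. ennreal (q i x * q j x / Q x)) \<partial>M) = (\<integral>\<^sup>+x. ennreal (Q x) \<partial>M)"
  proof (rule nn_integral_cong_AE, use sumq q0' in eventually_elim)
    case (elim x)
    have "(\<Sum>i. \<Sum>j. ennreal (q i x * q j x / Q x)) = ennreal ((Q x)\<^sup>2 / Q x)"
      using elim unfolding Q_def by (intro double[symmetric]) auto
    then show ?case using elim by (simp add: power2_eq_square)
  qed
  also have "(\<integral>\<^sup>+x. (\<Sum>i. ennreal (q i x / Q x)) \<partial>M) = (\<integral>\<^sup>+x. 1 \<partial>M)"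
  proof (rule nn_integral_cong_AE, use sumq q0' in eventually_elim)
    case (elim x)
    have "(\<Sum>i. ennreal (q i x / Q x)) = ennreal (\<Sum>i. q i x / Q x)"
      using elim by (intro suminf_ennreal2 summable_divide) auto
    also have "(\<Sum>i. q i x / Q x) = 1" using elim by (simp add: suminf_divide Q_def)
    finally show ?case by simp
  qed
  finally have second: "(\<integral>\<^sup>+x. ennreal ((S x)\<^sup>2 / Q x) \<partial>M) \<le> (\<integral>\<^sup>+x. ennreal (Q x) \<partial>M) + 1"
    by (simp add: emeasure_space_1)
  have first: "(\<integral>\<^sup>+x. ennreal (S x) \<partial>M) = (\<integral>\<^sup>+x. ennreal (Q x) \<partial>M)"
  proof -
    have "(\<integral>\<^sup>+x. ennreal (S x) \<partial>M) = (\<integral>\<^sup>+x. (\<Sum>j. ennreal (I j x)) \<partial>M)"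
      by (rule nn_integral_cong_AE) (use sumI I01' in \<open>eventually_elim, auto simp: S_def intro!: suminf_ennreal2[symmetric]\<close>)
    also have "\<dots> = (\<integral>\<^sup>+x. (\<Sum>j. ennreal (q j x)) \<partial>M)"
      by (simp add: nn_integral_suminf mean)
    also have "\<dots> = (\<integral>\<^sup>+x. ennreal (Q x) \<partial>M)"
      by (rule nn_integral_cong_AE) (use sumq q0' in \<open>eventually_elim, auto simp: Q_def intro!: suminf_ennreal2\<close>)
    finally show ?thesis .
  qed
  \<comment> \<open>the cross term is added on the left, so that no extended reals are subtracted\<close>
  let ?E = "\<integral>\<^sup>+x. ennreal (Q x) \<partial>M"
  have "(\<integral>\<^sup>+x. ennreal ((S x - Q x)\<^sup>2 / Q x) \<partial>M) + (?E + ?E)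
      = (\<integral>\<^sup>+x. ennreal ((S x - Q x)\<^sup>2 / Q x) + (ennreal (S x) + ennreal (S x)) \<partial>M)"
    by (simp add: nn_integral_add first)
  also have "\<dots> = (\<integral>\<^sup>+x. ennreal ((S x)\<^sup>2 / Q x) + ennreal (Q x) \<partial>M)"
  proof (rule nn_integral_cong_AE, use sumq sumI I01' in eventually_elim)
    case (elim x)
    have "0 \<le> S x" unfolding S_def using elim by (intro suminf_nonneg) auto
    moreover have "(S x - Q x)\<^sup>2 / Q x + (S x + S x) = (S x)\<^sup>2 / Q x + Q x"
      using elim by (simp add: field_simps power2_eq_square)
    ultimately show ?case
      using elim by (simp flip: ennreal_plus)
  qed
  also have "\<dots> = (\<integral>\<^sup>+x. ennreal ((S x)\<^sup>2 / Q x) \<partial>M) + ?E"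
    by (simp add: nn_integral_add)
  also have "\<dots> \<le> 1 + (?E + ?E)"
    using add_right_mono[OF second, of ?E] by (simp add: ac_simps)
  finally show ?thesis
    using fin by (simp add: ennreal_add_left_cancel_le add.commute)
qed

section \<open>The beta distribution\<close>

lemma nn_integral_Beta:
  assumes "0 < a" "0 < b"
  shows "(\<integral>\<^sup>+x. ennreal (indicator {0<..<1} x * (x powr (a - 1) * (1 - x) powr (b - 1))) \<partial>lborel) = ennreal (Beta a b)"
proof -
  have "((\<lambda>x. x powr (a - 1) * (1 - x) powr (b - 1)) has_integral Beta a b) {0<..<1}"
    using has_integral_Beta_real[OF assms] by (simp add: has_integral_Icc_iff_Ioo)
  then have "((\<lambda>x. indicator {0<..<1} x * (x powr (a - 1) * (1 - x) powr (b - 1))) has_integral Beta a b) UNIV"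
    by (subst (asm) has_integral_restrict_UNIV[symmetric]) (simp add: indicator_def of_bool_def if_distrib[of "\<lambda>z. z * _"] cong: if_cong)
  then show ?thesis
    by (intro nn_integral_has_integral_lborel) (auto simp: indicator_def)
qed

lemma Beta_real_pos: "0 < a \<Longrightarrow> 0 < b \<Longrightarrow> 0 < Beta a (b::real)"
  by (simp add: Beta_def)

lemma beta_density_eq:
  "beta_density a b x = indicator {0<..<1} x * (x powr (a - 1) * (1 - x) powr (b - 1)) / Beta a b"
  by (simp add: beta_density_def indicator_def)

lemma borel_measurable_beta_density[measurable]: "beta_density a b \<in> borel_measurable borel"
  unfolding beta_density_eq by measurable

lemma beta_density_nonneg: "0 < a \<Longrightarrow> 0 < b \<Longrightarrow> 0 \<le> beta_density a b x"
  using Beta_real_pos[of a b] by (simp add: beta_density_eq)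

lemma sets_beta_distribution[simp, measurable_cong]: "sets (beta_distribution a b) = sets borel"
  and space_beta_distribution[simp]: "space (beta_distribution a b) = UNIV"
  by (simp_all add: beta_distribution_def)

lemma nn_integral_beta_distribution:
  assumes "0 < a" "0 < b" and [measurable]: "f \<in> borel_measurable borel" and f: "\<And>x. 0 < x \<Longrightarrow> x < 1 \<Longrightarrow> 0 \<le> f x"
  shows "(\<integral>\<^sup>+x. ennreal (f x) \<partial>beta_distribution a b) = (\<integral>\<^sup>+x. ennreal (beta_density a b x * f x) \<partial>lborel)"
  unfolding beta_distribution_def
  by (subst nn_integral_density) (auto simp: ennreal_mult'[symmetric] beta_density_nonneg assms)

lemma beta_moment:
  assumes "0 < a" "0 < b"
  shows "(\<integral>\<^sup>+x. ennreal (x ^ k) \<partial>beta_distribution a b) = ennreal (Beta (a + real k) b / Beta a b)"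
proof -
  have "(\<integral>\<^sup>+x. ennreal (x ^ k) \<partial>beta_distribution a b) = (\<integral>\<^sup>+x. ennreal (beta_density a b x * x ^ k) \<partial>lborel)"
    using assms by (intro nn_integral_beta_distribution) auto
  also have "\<dots> = (\<integral>\<^sup>+x. ennreal (1 / Beta a b) * ennreal (indicator {0<..<1} x * (x powr (a + real k - 1) * (1 - x) powr (b - 1))) \<partial>lborel)"
    using Beta_real_pos[OF assms]
    by (intro nn_integral_cong)
       (auto simp: beta_density_eq indicator_def ennreal_mult'[symmetric] powr_realpow[symmetric] powr_add[symmetric] algebra_simps)
  also have "\<dots> = ennreal (1 / Beta a b) * ennreal (Beta (a + real k) b)"
    using assms by (subst nn_integral_cmult) (auto simp: nn_integral_Beta)
  finally show ?thesis using Beta_real_pos[OF assms] by (simp add: ennreal_mult'[symmetric])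
qed

lemma prob_space_beta_distribution:
  assumes "0 < a" "0 < b"
  shows "prob_space (beta_distribution a b)"
  using beta_moment[OF assms, of 0] Beta_real_pos[OF assms] by (intro prob_spaceI) simp

lemma AE_beta_distribution:
  "AE x in beta_distribution a b. 0 < x \<and> x < 1"
  unfolding beta_distribution_def
  by (subst AE_density) (auto simp: beta_density_def)

lemma beta_mean:
  assumes "0 < a" "0 < b"
  shows "integrable (beta_distribution a b) (\<lambda>x. x)" "(\<integral>x. x \<partial>beta_distribution a b) = a / (a + b)"
proof -
  have eq: "Beta (a + 1) b / Beta a b = a / (a + b)"
  proof -
    have "(a + b) * Beta (a + 1) b = a * Beta a b"
      using Beta_plus1_left[of a b] assms by (auto simp: nonpos_Ints_def)
    then have "Beta (a + 1) b = a * Beta a b / (a + b)"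
      using assms by (auto simp: eq_divide_eq mult.commute)
    then show ?thesis using Beta_real_pos[OF assms] by simp
  qed
  have nn: "(\<integral>\<^sup>+x. ennreal x \<partial>beta_distribution a b) = ennreal (a / (a + b))"
    using beta_moment[OF assms, of 1] eq by simp
  have ae: "AE x in beta_distribution a b. 0 \<le> x"
    using AE_beta_distribution by eventually_elim auto
  show "integrable (beta_distribution a b) (\<lambda>x. x)"
    using nn ae by (intro integrableI_nonneg) auto
  show "(\<integral>x. x \<partial>beta_distribution a b) = a / (a + b)"
    using nn ae assms by (subst integral_eq_nn_integral) auto
qed

lemma beta_second_moment:
  assumes "0 < a" "a \<le> 1" "0 < b"
  shows "integrable (beta_distribution a b) (\<lambda>x. x\<^sup>2)" "(\<integral>\<^sup>+x. ennreal (x\<^sup>2) \<partial>beta_distribution a b) \<le> ennreal (2 / (a + b)\<^sup>2)"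
proof -
  have "Beta (a + 2) b / Beta a b = (a + 1) / (a + 1 + b) * (a / (a + b))"
  proof -
    have "(a + b) * Beta (a + 1) b = a * Beta a b" "(a + 1 + b) * Beta (a + 2) b = (a + 1) * Beta (a + 1) b"
      using Beta_plus1_left[of a b] Beta_plus1_left[of "a + 1" b] assms
      by (auto simp: nonpos_Ints_def add.assoc)
    then have "Beta (a + 1) b = a * Beta a b / (a + b)" "Beta (a + 2) b = (a + 1) * Beta (a + 1) b / (a + 1 + b)"
      using assms by (auto simp: eq_divide_eq mult.commute)
    then show ?thesis using Beta_real_pos[OF assms(1,3)] assms by simp
  qed
  also have "\<dots> \<le> 2 / (a + b) * (1 / (a + b))"
    using assms by (intro mult_mono frac_le) auto
  finally have "Beta (a + 2) b / Beta a b \<le> 2 / (a + b)\<^sup>2" by (simp add: power2_eq_square)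
  then show nn: "(\<integral>\<^sup>+x. ennreal (x\<^sup>2) \<partial>beta_distribution a b) \<le> ennreal (2 / (a + b)\<^sup>2)"
    using beta_moment[of a b 2] assms by (simp add: ennreal_leI)
  then show "integrable (beta_distribution a b) (\<lambda>x. x\<^sup>2)"
    by (intro integrableI_nonneg) (auto simp: le_less_trans[OF _ ennreal_less_top])
qed

text \<open>The substitution \<open>y = x (1 + v) / (1 + v x)\<close> maps the unit interval onto itself and turns the beta
  density into itself times \<open>(1 + v) powr a * (1 + v x) powr (- (a + b))\<close>. In terms of gamma variables: if \<open>G\<close> has
  the gamma law with shape \<open>a + b\<close> and is independent of \<open>H\<close>, then \<open>G H\<close> is gamma with shape \<open>a\<close>, and
  both sides are the Laplace transform of \<open>G H\<close> at \<open>v\<close>.\<close>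
lemma beta_power_expectation:
  assumes a: "0 < a" and b: "0 < b" and v: "0 \<le> (v::real)"
  shows "(\<integral>\<^sup>+x. ennreal ((1 + v * x) powr - (a + b)) \<partial>beta_distribution a b) = ennreal ((1 + v) powr - a)"
proof -
  define f where "f x = indicator {0<..<1} x * (x powr (a - 1) * (1 - x) powr (b - 1))" for x :: real
  define g where "g x = x * (1 + v) / (1 + v * x)" for x :: real
  define g' where "g' x = (1 + v) / (1 + v * x)\<^sup>2" for x :: real
  have pos: "0 < 1 + v * x" if "0 \<le> x" for x using that v by (simp add: add_pos_nonneg)
  have [measurable]: "f \<in> borel_measurable borel" unfolding f_def by measurable
  have "ennreal (Beta a b) = (\<integral>\<^sup>+x. ennreal (f x) * indicator {g 0..g 1} x \<partial>lborel)"
    unfolding nn_integral_Beta[OF a b, symmetric] g_def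
    using v by (intro nn_integral_cong) (auto simp: f_def indicator_def)
  also have "\<dots> = (\<integral>\<^sup>+x. ennreal (f (g x)) * ennreal (g' x) * indicator {0..1} x \<partial>lborel)"
  proof (rule nn_integral_substitution_aux)
    show "(g has_real_derivative g' x) (at x)" if "x \<in> {0..1}" for x
      unfolding g_def g'_def using pos[of x] that
      by (auto intro!: derivative_eq_intros simp: power2_eq_square field_simps)
    show "continuous_on {0..1} g'" unfolding g'_def
    proof (intro continuous_intros ballI)
      fix x :: real assume "x \<in> {0..1}" then show "(1 + v * x)\<^sup>2 \<noteq> 0" using pos[of x] by simp
    qed
    show "0 \<le> g' x" for x using v by (simp add: g'_def)
  qed auto
  also have "\<dots> = (\<integral>\<^sup>+x. ennreal ((1 + v) powr a * Beta a b) * ennreal (beta_density a b x * (1 + v * x) powr - (a + b)) \<partial>lborel)"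
  proof (rule nn_integral_cong_AE, rule AE_mp[OF AE_conjI[OF AE_lborel_singleton[of 0] AE_lborel_singleton[of 1]]], intro AE_I2 impI, elim conjE)
    fix x :: real assume x: "x \<noteq> 0" "x \<noteq> 1"
    show "ennreal (f (g x)) * ennreal (g' x) * indicator {0..1} x
      = ennreal ((1 + v) powr a * Beta a b) * ennreal (beta_density a b x * (1 + v * x) powr - (a + b))"
    proof (cases "0 < x \<and> x < 1")
      case False
      then show ?thesis using x by (auto simp: indicator_def beta_density_def)
    next
      case True
      let ?d = "1 + v * x"
      have d: "0 < ?d" using pos True by simp
      have v1: "0 < 1 + v" using v by simp
      have "1 - g x = (1 - x) / ?d" using d by (simp add: g_def field_simps)
      moreover have "0 < g x" using True d v1 by (simp add: g_def)
      moreover have "0 < (1 - x) / ?d" using True d by simp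
      ultimately have "f (g x) = (x * (1 + v) / ?d) powr (a - 1) * ((1 - x) / ?d) powr (b - 1)"
        by (simp add: f_def indicator_def) (simp add: g_def)
      also have "\<dots> = x powr (a - 1) * (1 - x) powr (b - 1) * (1 + v) powr (a - 1) * (?d powr (- (a - 1)) * ?d powr (- (b - 1)))"
        unfolding powr_minus_divide using True d v1 by (simp add: powr_mult powr_divide)
      also have "\<dots> * g' x = x powr (a - 1) * (1 - x) powr (b - 1) * ((1 + v) powr (a - 1) * (1 + v) powr 1) *
          (?d powr (- (a - 1)) * ?d powr (- (b - 1)) * ?d powr (- 2))"
        using d v1 by (simp add: g'_def powr_minus divide_simps)
      also have "\<dots> = x powr (a - 1) * (1 - x) powr (b - 1) * (1 + v) powr a * ?d powr - (a + b)"
        by (simp only: powr_add[symmetric]) (simp add: algebra_simps)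
      also have "\<dots> = (1 + v) powr a * Beta a b * (beta_density a b x * ?d powr - (a + b))"
        using True Beta_real_pos[OF a b] by (simp add: beta_density_def)
      finally show ?thesis using True v1 d Beta_real_pos[OF a b]
        by (simp add: ennreal_mult'[symmetric] ennreal_mult''[symmetric] g'_def f_def)
    qed
  qed
  also have "\<dots> = ennreal ((1 + v) powr a * Beta a b) * (\<integral>\<^sup>+x. ennreal (beta_density a b x * (1 + v * x) powr - (a + b)) \<partial>lborel)"
    by (rule nn_integral_cmult) measurable
  also have "(\<integral>\<^sup>+x. ennreal (beta_density a b x * (1 + v * x) powr - (a + b)) \<partial>lborel)
      = (\<integral>\<^sup>+x. ennreal ((1 + v * x) powr - (a + b)) \<partial>beta_distribution a b)"
    by (intro nn_integral_beta_distribution[symmetric] a b) auto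
  finally have eq: "ennreal (Beta a b) = ennreal ((1 + v) powr a * Beta a b) * (\<integral>\<^sup>+x. ennreal ((1 + v * x) powr - (a + b)) \<partial>beta_distribution a b)" .
  have B: "0 < Beta a b" "0 < (1 + v) powr a" using Beta_real_pos[OF a b] v by auto
  have "ennreal ((1 + v) powr - a) = ennreal ((1 + v) powr - a / Beta a b) * ennreal (Beta a b)"
    using B by (simp add: ennreal_mult''[symmetric])
  also have "\<dots> = ennreal ((1 + v) powr - a / Beta a b * ((1 + v) powr a * Beta a b)) * (\<integral>\<^sup>+x. ennreal ((1 + v * x) powr - (a + b)) \<partial>beta_distribution a b)"
    using B by (subst eq, subst mult.assoc[symmetric], subst ennreal_mult'[symmetric]) auto
  also have "(1 + v) powr - a / Beta a b * ((1 + v) powr a * Beta a b) = 1"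
    using B by (simp add: powr_minus)
  finally show ?thesis by simp
qed

lemma beta_power_complement_expectation:
  assumes "0 < a" "0 < b" and v: "0 \<le> (v::real)"
  shows "(\<integral>\<^sup>+x. ennreal (1 - (1 + v * x) powr - (a + b)) \<partial>beta_distribution a b) = ennreal (1 - (1 + v) powr - a)"
proof -
  interpret prob_space "beta_distribution a b" by (rule prob_space_beta_distribution) fact+
  let ?f = "\<lambda>x. (1 + v * x) powr - (a + b)"
  have bd: "AE x in beta_distribution a b. ?f x \<le> 1"
    using AE_beta_distribution
  proof eventually_elim
    case (elim x)
    then have "?f x \<le> 1 powr - (a + b)" using assms by (intro powr_mono2') auto
    then show ?case by simp
  qed
  have meas: "?f \<in> borel_measurable (beta_distribution a b)" by measurable
  have int: "integrable (beta_distribution a b) ?f"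
    using beta_power_expectation[OF assms] by (intro integrableI_nonneg meas) auto
  have "(\<integral>x. ?f x \<partial>beta_distribution a b) = (1 + v) powr - a"
    using beta_power_expectation[OF assms] by (subst integral_eq_nn_integral[OF meas]) auto
  moreover have "(\<integral>\<^sup>+x. ennreal (1 - ?f x) \<partial>beta_distribution a b) = ennreal (\<integral>x. 1 - ?f x \<partial>beta_distribution a b)"
    using int bd by (intro nn_integral_eq_integral) auto
  ultimately show ?thesis using int prob_space by simp
qed

section \<open>Stick-breaking with a fixed sequence of sticks\<close>

definition stick_remainder :: "(nat \<Rightarrow> real) \<Rightarrow> nat \<Rightarrow> real" where
  "stick_remainder h k = (\<Prod>i\<in>{1..k}. 1 - h i)"

text \<open>The sum of the two parameters \<open>1 - \<alpha>\<close> and \<open>\<theta> + j \<alpha>\<close> of the law of the \<open>j\<close>-th stick.\<close>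
definition gem_shape :: "real \<Rightarrow> real \<Rightarrow> nat \<Rightarrow> real" where
  "gem_shape \<alpha> \<theta> j = 1 + \<theta> + (real j - 1) * \<alpha>"

text \<open>A substitute for \<open>1 - exp (- \<alpha> \<mu> j powr (- (1 - \<alpha>) / \<alpha>) * h\<^sub>j)\<close>, hence for the probability that a
  sample of size proportional to \<open>\<mu>\<close> hits the value \<open>j\<close>. The power is chosen instead of the exponential because its
  expectation under the beta law is known exactly; for large \<open>j\<close> the two agree, the exponent
  \<open>gem_shape \<alpha> \<theta> j\<close> being asymptotic to \<open>\<alpha> j\<close>.\<close>
definition surrogate_term :: "real \<Rightarrow> real \<Rightarrow> (nat \<Rightarrow> real) \<Rightarrow> real \<Rightarrow> nat \<Rightarrow> real" where
  "surrogate_term \<alpha> \<theta> h \<mu> j = 1 - (1 + \<mu> * real j powr - (1 / \<alpha>) * h j) powr - gem_shape \<alpha> \<theta> j"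

definition surrogate_count :: "real \<Rightarrow> real \<Rightarrow> (nat \<Rightarrow> real) \<Rightarrow> real \<Rightarrow> real" where
  "surrogate_count \<alpha> \<theta> h \<mu> = (\<Sum>j. surrogate_term \<alpha> \<theta> h \<mu> (Suc j))"

definition expected_count :: "(nat \<Rightarrow> real) \<Rightarrow> nat \<Rightarrow> real" where
  "expected_count p n = (\<Sum>j. 1 - (1 - p (Suc j)) ^ n)"

lemma gem_shape_lower:
  assumes "0 < \<alpha>" "\<alpha> < 1" "\<theta> > - \<alpha>" "1 \<le> j"
  shows "min \<alpha> (1 + \<theta>) * real j \<le> gem_shape \<alpha> \<theta> j" "0 < gem_shape \<alpha> \<theta> j"
proof -
  let ?d = "min \<alpha> (1 + \<theta>)"
  have "?d * real j = ?d + (real j - 1) * ?d" by (simp add: algebra_simps)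
  also have "\<dots> \<le> (1 + \<theta>) + (real j - 1) * \<alpha>"
    using assms by (intro add_mono mult_left_mono) auto
  finally show *: "?d * real j \<le> gem_shape \<alpha> \<theta> j" by (simp add: gem_shape_def)
  have "0 < ?d * real j" using assms by (intro mult_pos_pos) auto
  with * show "0 < gem_shape \<alpha> \<theta> j" by linarith
qed

lemma stick_remainder_0[simp]: "stick_remainder h 0 = 1"
  and stick_remainder_Suc: "stick_remainder h (Suc k) = stick_remainder h k * (1 - h (Suc k))"
  by (simp_all add: stick_remainder_def)

lemma stick_remainder_bounds:
  assumes "\<And>j. 1 \<le> j \<Longrightarrow> 0 < h j \<and> h j < 1"
  shows "0 < stick_remainder h k" "stick_remainder h k \<le> 1"
  using assms unfolding stick_remainder_def by (auto intro!: prod_pos prod_le_1 simp: less_imp_le)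

lemma stick_breaking_Suc: "stick_breaking h (Suc j) = h (Suc j) * stick_remainder h j"
  by (simp add: stick_breaking_def stick_remainder_def atLeastLessThanSuc_atLeastAtMost)

lemma sum_stick_breaking: "(\<Sum>j<k. stick_breaking h (Suc j)) = 1 - stick_remainder h k"
  by (induction k) (simp_all add: stick_breaking_Suc stick_remainder_Suc algebra_simps)

text \<open>Taking logarithms, \<open>- ln W\<^sub>N - \<gamma> ln N\<close> splits into the series of \<open>ln (1 - h\<^sub>j) + h\<^sub>j\<close>, of order
  \<open>h\<^sub>j\<^sup>2\<close>, the centred sums, the deviation of the means \<open>(1 - \<alpha>) / A\<^sub>j\<close> from \<open>\<gamma> / j\<close>, of order
  \<open>1 / j\<^sup>2\<close>, and the harmonic numbers minus the logarithm. The centred sums are only assumed to converge along the cubes;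
  monotonicity of \<open>W\<close> supplies the rest.\<close>
lemma stick_remainder_regular:
  fixes h :: "nat \<Rightarrow> real"
  assumes \<alpha>: "0 < \<alpha>" "\<alpha> < 1" and \<theta>: "\<theta> > - \<alpha>"
    and h: "\<And>j. 1 \<le> j \<Longrightarrow> 0 < h j \<and> h j < 1"
    and sq: "summable (\<lambda>j. (h (Suc j))\<^sup>2)"
    and centred: "convergent (\<lambda>k. \<Sum>j<k ^ 3. h (Suc j) - (1 - \<alpha>) / gem_shape \<alpha> \<theta> (Suc j))"
  shows "\<exists>c>0. (\<lambda>k. stick_remainder h k * real k powr ((1 - \<alpha>) / \<alpha>)) \<longlonglongrightarrow> c"
proof -
  define \<gamma> where "\<gamma> = (1 - \<alpha>) / \<alpha>"
  have \<gamma>: "0 < \<gamma>" using \<alpha> by (simp add: \<gamma>_def)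
  let ?A = "gem_shape \<alpha> \<theta>"
  note W = stick_remainder_bounds[of h, OF h]
  have h0: "(\<lambda>j. h (Suc j)) \<longlonglongrightarrow> 0"
    using tendsto_real_sqrt[OF summable_LIMSEQ_zero[OF sq]] h
    by (simp add: less_imp_le abs_of_pos)
  have s1: "summable (\<lambda>j. ln (1 - h (Suc j)) + h (Suc j))"
  proof (rule summable_comparison_test_ev)
    show "summable (\<lambda>j. 2 * (h (Suc j))\<^sup>2)" using sq by (rule summable_mult)
    have "\<forall>\<^sub>F j in sequentially. h (Suc j) < 1 / 2"
      using h0 by (rule order_tendstoD) simp
    then show "\<forall>\<^sub>F j in sequentially. norm (ln (1 - h (Suc j)) + h (Suc j)) \<le> 2 * (h (Suc j))\<^sup>2"
    proof eventually_elim
      case (elim j)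
      with h[of "Suc j"] abs_ln_one_plus_x_minus_x_bound[of "- h (Suc j)"] show ?case by simp
    qed
  qed
  have s2: "summable (\<lambda>j. (1 - \<alpha>) / ?A (Suc j) - \<gamma> / real (Suc j))"
  proof (rule summable_comparison_test')
    let ?C = "\<bar>\<gamma> * (1 + \<theta> - \<alpha>)\<bar> / min \<alpha> (1 + \<theta>)"
    show "summable (\<lambda>j. ?C * (1 / (real (Suc j))\<^sup>2))"
      using summable_inverse_squares_Suc[of 1] by (intro summable_mult) simp
    fix j
    have A: "min \<alpha> (1 + \<theta>) * real (Suc j) \<le> ?A (Suc j)" "0 < ?A (Suc j)"
      using gem_shape_lower[OF \<alpha> \<theta>, of "Suc j"] by auto
    have "(1 - \<alpha>) / ?A (Suc j) - \<gamma> / real (Suc j) = - (\<gamma> * (1 + \<theta> - \<alpha>)) / (real (Suc j) * ?A (Suc j))"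
      using A \<alpha> by (simp add: divide_simps \<gamma>_def) (simp add: gem_shape_def algebra_simps)
    then have "norm ((1 - \<alpha>) / ?A (Suc j) - \<gamma> / real (Suc j)) = \<bar>\<gamma> * (1 + \<theta> - \<alpha>)\<bar> / (real (Suc j) * ?A (Suc j))"
      using A by (simp add: abs_mult)
    also have "\<dots> \<le> \<bar>\<gamma> * (1 + \<theta> - \<alpha>)\<bar> / (real (Suc j) * (min \<alpha> (1 + \<theta>) * real (Suc j)))"
      using A \<alpha> \<theta> by (intro divide_left_mono mult_left_mono mult_pos_pos) auto
    finally show "norm ((1 - \<alpha>) / ?A (Suc j) - \<gamma> / real (Suc j)) \<le> ?C * (1 / (real (Suc j))\<^sup>2)"
      by (simp add: power2_eq_square mult_ac)
  qed
  have cube_top: "filterlim (\<lambda>k::nat. k ^ 3) at_top sequentially"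
    by (rule filterlim_at_top_mono[OF filterlim_ident]) (auto intro!: always_eventually self_le_power simp: numeral_3_eq_3)
  obtain L1 where L1: "(\<lambda>k. \<Sum>j<k ^ 3. h (Suc j) - (1 - \<alpha>) / ?A (Suc j)) \<longlonglongrightarrow> L1"
    using centred by (auto simp: convergent_def)
  obtain L2 where L2: "(\<lambda>k. \<Sum>j<k. ln (1 - h (Suc j)) + h (Suc j)) \<longlonglongrightarrow> L2"
    using s1 by (auto simp: summable_def sums_def)
  obtain L3 where L3: "(\<lambda>k. \<Sum>j<k. (1 - \<alpha>) / ?A (Suc j) - \<gamma> / real (Suc j)) \<longlonglongrightarrow> L3"
    using s2 by (auto simp: summable_def sums_def)
  define S where "S n = inverse (stick_remainder h n)" for n
  have lim: "(\<lambda>k. exp (- (\<Sum>j<k ^ 3. ln (1 - h (Suc j)) + h (Suc j))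
      + (\<Sum>j<k ^ 3. h (Suc j) - (1 - \<alpha>) / ?A (Suc j))
      + (\<Sum>j<k ^ 3. (1 - \<alpha>) / ?A (Suc j) - \<gamma> / real (Suc j))
      + \<gamma> * (harm (k ^ 3) - ln (real (k ^ 3))))) \<longlonglongrightarrow> exp (- L2 + L1 + L3 + \<gamma> * euler_mascheroni)"
    by (intro tendsto_intros L1 filterlim_compose[OF L2 cube_top] filterlim_compose[OF L3 cube_top]
        filterlim_compose[OF euler_mascheroni_LIMSEQ cube_top])
  have "(\<lambda>k. S (k ^ 3) / real (k ^ 3) powr \<gamma>) \<longlonglongrightarrow> exp (- L2 + L1 + L3 + \<gamma> * euler_mascheroni)"
  proof (rule Lim_transform_eventually[OF lim], use eventually_gt_at_top[of 0] in eventually_elim)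
    case (elim k)
    define N where "N = k ^ 3"
    have N: "0 < N" using elim by (simp add: N_def)
    have lnW: "(\<Sum>j<N. ln (1 - h (Suc j))) = ln (stick_remainder h N)"
    proof (induction N)
      case (Suc N)
      then show ?case using W(1)[of N] h[of "Suc N"] by (simp add: stick_remainder_Suc ln_mult)
    qed simp
    have harm: "(\<Sum>j<N. \<gamma> / real (Suc j)) = \<gamma> * harm N"
      by (simp add: harm_def sum_distrib_left sum.atLeast1_atMost_eq divide_inverse)
    have "- (\<Sum>j<N. ln (1 - h (Suc j)) + h (Suc j))
      + (\<Sum>j<N. h (Suc j) - (1 - \<alpha>) / ?A (Suc j))
      + (\<Sum>j<N. (1 - \<alpha>) / ?A (Suc j) - \<gamma> / real (Suc j))
      + \<gamma> * (harm N - ln (real N)) = - ln (stick_remainder h N) - \<gamma> * ln (real N)"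
      by (simp only: sum.distrib sum_subtractf lnW harm) (simp add: algebra_simps)
    also have "exp \<dots> = S N / real N powr \<gamma>"
      using N W(1)[of N] by (simp add: S_def exp_diff exp_minus powr_def)
    finally show ?case by (simp only: N_def)
  qed
  then have "(\<lambda>n. S n / real n powr \<gamma>) \<longlonglongrightarrow> exp (- L2 + L1 + L3 + \<gamma> * euler_mascheroni)"
  proof (rule power_block_limit[rotated -1])
    show "mono S" unfolding S_def
    proof (rule incseq_SucI)
      fix n
      have "stick_remainder h (Suc n) \<le> stick_remainder h n"
        unfolding stick_remainder_Suc using W(1)[of n] h[of "Suc n"] by (intro mult_left_le) auto
      then show "inverse (stick_remainder h n) \<le> inverse (stick_remainder h (Suc n))"
        using W(1) by (intro le_imp_inverse_le) auto
    qed
    show "0 \<le> S n" for n using W(1)[of n] by (simp add: S_def less_imp_le)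
  qed (use \<gamma> in auto)
  from tendsto_inverse[OF this] have "(\<lambda>n. stick_remainder h n * real n powr \<gamma>) \<longlonglongrightarrow> inverse (exp (- L2 + L1 + L3 + \<gamma> * euler_mascheroni))"
    by (simp add: S_def field_simps)
  then show ?thesis unfolding \<gamma>_def by (intro exI[of _ "inverse (exp (- L2 + L1 + L3 + (1 - \<alpha>) / \<alpha> * euler_mascheroni))"]) simp
qed

section \<open>The expected number of distinct values for fixed sticks\<close>

text \<open>The integral test with the integral replaced by an explicit antiderivative: by the mean value theorem
  the value of a decreasing derivative at \<open>j\<close> lies between the increments of \<open>G\<close> after and before \<open>j\<close>, and these
  telescope.\<close>
lemma summable_suminf_bounds_by_decreasing_derivative:
  fixes F G :: "real \<Rightarrow> real"
  assumes deriv: "\<And>t. 0 < t \<Longrightarrow> (G has_real_derivative F t) (at t)"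
    and cont: "continuous_on {0..} G"
    and anti: "\<And>s t. 0 < s \<Longrightarrow> s \<le> t \<Longrightarrow> F t \<le> F s"
    and nonneg: "\<And>t. 0 < t \<Longrightarrow> 0 \<le> F t"
    and lim: "(\<lambda>n. G (real n)) \<longlonglongrightarrow> L"
  shows "summable (\<lambda>j. F (real (Suc j)))" "L - G 1 \<le> (\<Sum>j. F (real (Suc j)))"
    "(\<Sum>j. F (real (Suc j))) \<le> L - G 0"
proof -
  have mvt: "\<exists>z. s < z \<and> z < s + 1 \<and> G (s + 1) - G s = F z" if "0 \<le> s" for s
  proof -
    have "\<exists>l z. s < z \<and> z < s + 1 \<and> (G has_real_derivative l) (at z) \<and> G (s + 1) - G s = (s + 1 - s) * l"
    proof (rule MVT)
      show "continuous_on {s..s + 1} G" using that by (intro continuous_on_subset[OF cont]) auto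
      show "G differentiable (at z)" if "s < z" for z
        using deriv[of z] \<open>0 \<le> s\<close> that real_differentiable_def by auto
    qed auto
    then obtain l z where lz: "s < z" "z < s + 1" "(G has_real_derivative l) (at z)" "G (s + 1) - G s = l" by auto
    moreover from lz deriv[of z] that have "l = F z" by (intro DERIV_unique) auto
    ultimately show ?thesis by auto
  qed
  have up: "F (real (Suc j)) \<le> G (real (Suc j)) - G (real j)" for j
  proof -
    obtain z where "real j < z" "z < real j + 1" "G (real j + 1) - G (real j) = F z" using mvt[of "real j"] by auto
    moreover have "F (real (Suc j)) \<le> F z" using calculation by (intro anti) auto
    ultimately show ?thesis by (simp add: add.commute)
  qed
  have lo: "G (real (Suc (Suc j))) - G (real (Suc j)) \<le> F (real (Suc j))" for j
  proof -
    obtain z where z: "real (Suc j) < z" "z < real (Suc j) + 1" "G (real (Suc j) + 1) - G (real (Suc j)) = F z" using mvt[of "real (Suc j)"] by auto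
    then have "F z \<le> F (real (Suc j))" by (intro anti) auto
    with z show ?thesis by (simp add: add.commute)
  qed
  have s1: "(\<lambda>j. G (real (Suc j)) - G (real j)) sums (L - G 0)"
    using telescope_sums[OF lim] by simp
  have s2: "(\<lambda>j. G (real (Suc (Suc j))) - G (real (Suc j))) sums (L - G 1)"
    using telescope_sums[OF LIMSEQ_Suc[OF lim]] by simp
  show s: "summable (\<lambda>j. F (real (Suc j)))"
    by (rule summable_comparison_test'[OF sums_summable[OF s1], where N = 0]) (use up nonneg in auto)
  show "L - G 1 \<le> (\<Sum>j. F (real (Suc j)))"
    using suminf_le[OF lo sums_summable[OF s2] s] sums_unique[OF s2] by simp
  show "(\<Sum>j. F (real (Suc j))) \<le> L - G 0"
    using suminf_le[OF up s sums_summable[OF s1]] sums_unique[OF s1] by simp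
qed

text \<open>The summand is the derivative of \<open>G t = t - (t powr (1 / \<alpha>) + \<mu>) powr \<alpha>\<close>, with \<open>G 0 = - (\<mu> powr \<alpha>)\<close> and
  \<open>G t\<close> tending to \<open>0\<close> at infinity.\<close>
lemma expected_occupancy_sum:
  fixes \<alpha> \<mu> :: real
  assumes \<alpha>: "0 < \<alpha>" "\<alpha> < 1" and \<mu>: "0 < \<mu>"
  defines "F \<equiv> \<lambda>t. 1 - (1 + \<mu> * t powr - (1 / \<alpha>)) powr - (1 - \<alpha>)"
  shows "summable (\<lambda>j. F (real (Suc j)))" "(1 + \<mu>) powr \<alpha> - 1 \<le> (\<Sum>j. F (real (Suc j)))"
    "(\<Sum>j. F (real (Suc j))) \<le> \<mu> powr \<alpha>"
proof -
  define G where "G t = t - (t powr (1 / \<alpha>) + \<mu>) powr \<alpha>" for t :: real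
  have pos: "0 < t powr (1 / \<alpha>) + \<mu>" for t using \<mu> by (simp add: add_nonneg_pos)
  have deriv: "(G has_real_derivative F t) (at t)" if t: "0 < t" for t
  proof -
    have "(G has_real_derivative 1 - \<alpha> * (t powr (1 / \<alpha>) + \<mu>) powr (\<alpha> - 1) * (1 / \<alpha> * t powr (1 / \<alpha> - 1))) (at t)"
      unfolding G_def using t \<alpha> pos[of t] by (auto intro!: derivative_eq_intros simp: mult_ac)
    also have "\<alpha> * (t powr (1 / \<alpha>) + \<mu>) powr (\<alpha> - 1) * (1 / \<alpha> * t powr (1 / \<alpha> - 1))
        = (t powr (1 / \<alpha>) + \<mu>) powr (\<alpha> - 1) * (t powr - (1 / \<alpha>)) powr (\<alpha> - 1)"
    proof -
      have "1 / \<alpha> - 1 = - (1 / \<alpha>) * (\<alpha> - 1)" using \<alpha> by (simp add: field_simps)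
      then show ?thesis using \<alpha> by (simp only: powr_powr) simp
    qed
    also have "\<dots> = ((t powr (1 / \<alpha>) + \<mu>) * t powr - (1 / \<alpha>)) powr (\<alpha> - 1)"
      using pos[of t] by (simp add: powr_mult)
    also have "(t powr (1 / \<alpha>) + \<mu>) * t powr - (1 / \<alpha>) = 1 + \<mu> * t powr - (1 / \<alpha>)"
      using t by (simp add: algebra_simps powr_add[symmetric])
    finally show ?thesis by (simp add: F_def)
  qed
  have cont: "continuous_on {0..} G"
    unfolding G_def using \<alpha> \<mu> pos by (intro continuous_intros continuous_on_powr') (auto simp: less_imp_neq[symmetric] less_imp_le)
  have anti: "F t \<le> F s" if "0 < s" "s \<le> t" for s t
    unfolding F_def using that \<alpha> \<mu>
    by (intro diff_left_mono powr_mono2' add_left_mono mult_left_mono) (auto intro!: add_pos_nonneg)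
  have nonneg: "0 \<le> F t" if "0 < t" for t
    unfolding F_def using that \<alpha> \<mu> powr_mono2'[of "-(1 - \<alpha>)" 1 "1 + \<mu> * t powr - (1 / \<alpha>)"] by auto
  have lim: "(\<lambda>n. G (real n)) \<longlonglongrightarrow> 0"
  proof (rule tendsto_sandwich[OF _ _ _ tendsto_const])
    \<comment> \<open>the tangent line of the concave \<open>\<alpha>\<close>-th power\<close>
    have tangent: "(1 + y) powr \<alpha> \<le> 1 + \<alpha> * y" if "0 \<le> y" for y
    proof -
      have "\<alpha> * ln (1 + y) \<le> ln (1 + \<alpha> * y)"
      proof -
        have "concave_on {0<..} ln" by (simp add: ln_concave)
        from concave_onD[OF this, of \<alpha> 1 "1 + y"] \<alpha> that show ?thesis
          by (simp add: algebra_simps)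
      qed
      then have "exp (\<alpha> * ln (1 + y)) \<le> exp (ln (1 + \<alpha> * y))" by simp
      then show ?thesis using that \<alpha> by (simp add: powr_def add_pos_nonneg)
    qed
    show "\<forall>\<^sub>F n in sequentially. - (\<alpha> * \<mu> * real n powr (1 - 1 / \<alpha>)) \<le> G (real n)"
      using eventually_gt_at_top[of 0]
    proof eventually_elim
      case (elim n)
      have "(real n powr (1 / \<alpha>) + \<mu>) powr \<alpha> = (real n powr (1 / \<alpha>) * (1 + \<mu> * real n powr - (1 / \<alpha>))) powr \<alpha>"
        using elim by (simp add: algebra_simps powr_add[symmetric])
      also have "\<dots> = real n * (1 + \<mu> * real n powr - (1 / \<alpha>)) powr \<alpha>"
        using elim \<alpha> \<mu> by (subst powr_mult) (auto simp: powr_powr)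
      also have "\<dots> \<le> real n * (1 + \<alpha> * (\<mu> * real n powr - (1 / \<alpha>)))"
        using \<mu> by (intro mult_left_mono tangent) auto
      also have "\<dots> = real n + \<alpha> * \<mu> * (real n powr 1 * real n powr - (1 / \<alpha>))"
        using elim by (simp add: algebra_simps)
      also have "\<dots> = real n + \<alpha> * \<mu> * real n powr (1 - 1 / \<alpha>)"
        by (simp only: powr_add[symmetric]) simp
      finally show ?case by (simp add: G_def)
    qed
    show "\<forall>\<^sub>F n in sequentially. G (real n) \<le> 0"
    proof (rule always_eventually, rule allI)
      fix n :: nat
      have "real n = (real n powr (1 / \<alpha>)) powr \<alpha>" using \<alpha> by (simp add: powr_powr)
      also have "\<dots> \<le> (real n powr (1 / \<alpha>) + \<mu>) powr \<alpha>" using \<alpha> \<mu> by (intro powr_mono2) auto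
      finally show "G (real n) \<le> 0" by (simp add: G_def)
    qed
    have "(\<lambda>n. real n powr (1 - 1 / \<alpha>)) \<longlonglongrightarrow> 0"
      using \<alpha> by (intro tendsto_neg_powr filterlim_real_sequentially) (auto simp: field_simps)
    from tendsto_mult_left[OF this, of "- (\<alpha> * \<mu>)"]
    show "(\<lambda>n. - (\<alpha> * \<mu> * real n powr (1 - 1 / \<alpha>))) \<longlonglongrightarrow> 0" by simp
  qed
  note * = summable_suminf_bounds_by_decreasing_derivative[OF deriv cont anti nonneg lim]
  show "summable (\<lambda>j. F (real (Suc j)))" by (rule *(1))
  show "(1 + \<mu>) powr \<alpha> - 1 \<le> (\<Sum>j. F (real (Suc j)))" using *(2) by (simp add: G_def)
  show "(\<Sum>j. F (real (Suc j))) \<le> \<mu> powr \<alpha>" using *(3) by (simp add: G_def)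
qed

lemma occupancy_bounds:
  assumes "0 \<le> p" "p \<le> 1"
  shows "0 \<le> 1 - (1 - p) ^ n" "1 - (1 - p) ^ n \<le> 1" "1 - (1 - p) ^ n \<le> real n * p" "1 \<le> n \<Longrightarrow> p \<le> 1 - (1 - (p::real)) ^ n"
proof -
  show "0 \<le> 1 - (1 - p) ^ n" "1 - (1 - p) ^ n \<le> 1" using assms by (auto intro: power_le_one)
  show "1 - (1 - p) ^ n \<le> real n * p" using Bernoulli_inequality[of "- p" n] assms by simp
  show "p \<le> 1 - (1 - p) ^ n" if "1 \<le> n"
    using power_decreasing[OF that, of "1 - p"] assms by simp
qed

lemma surrogate_term_bounds:
  assumes "0 < \<alpha>" "\<alpha> < 1" "\<theta> > - \<alpha>" "0 \<le> h j" "1 \<le> j" "0 \<le> \<mu>"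
  shows "0 \<le> surrogate_term \<alpha> \<theta> h \<mu> j" "surrogate_term \<alpha> \<theta> h \<mu> j \<le> 1"
proof -
  have "1 \<le> 1 + \<mu> * real j powr - (1 / \<alpha>) * h j" using assms by simp
  moreover have "0 \<le> gem_shape \<alpha> \<theta> j" using gem_shape_lower(2)[of \<alpha> \<theta> j] assms by simp
  ultimately have "(1 + \<mu> * real j powr - (1 / \<alpha>) * h j) powr - gem_shape \<alpha> \<theta> j \<le> 1"
    using powr_mono2'[of "- gem_shape \<alpha> \<theta> j" 1 "1 + \<mu> * real j powr - (1 / \<alpha>) * h j"] by simp
  then show "0 \<le> surrogate_term \<alpha> \<theta> h \<mu> j" "surrogate_term \<alpha> \<theta> h \<mu> j \<le> 1"
    by (simp_all add: surrogate_term_def)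
qed

lemma surrogate_term_mono:
  assumes "0 < \<alpha>" "\<alpha> < 1" "\<theta> > - \<alpha>" "0 \<le> h j" "1 \<le> j" "0 \<le> \<mu>" "\<mu> \<le> \<nu>"
  shows "surrogate_term \<alpha> \<theta> h \<mu> j \<le> surrogate_term \<alpha> \<theta> h \<nu> j"
  unfolding surrogate_term_def
  using assms gem_shape_lower(2)[of \<alpha> \<theta> j]
  by (intro diff_left_mono powr_mono2' add_left_mono mult_right_mono) (auto intro!: add_pos_nonneg)

text \<open>This comparison uses \<open>(1 - p)\<^sup>n \<le> exp (- n p)\<close> and \<open>ln (1 + y) \<le> y\<close>, both of which go in the right
  direction, so it holds for all \<open>n\<close> as soon as \<open>j\<close> is large.\<close>
lemma surrogate_term_le_occupancy:
  assumes "0 < \<alpha>" "\<alpha> < 1" "\<theta> > - \<alpha>" "0 < h" "1 \<le> j" "0 \<le> r" "p \<le> 1" "0 \<le> p"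
    and "gem_shape \<alpha> \<theta> j * (r * real j powr - (1 / \<alpha>)) * h \<le> p"
  shows "1 - (1 + r * real n * real j powr - (1 / \<alpha>) * h) powr - gem_shape \<alpha> \<theta> j \<le> 1 - (1 - p) ^ n"
proof -
  let ?A = "gem_shape \<alpha> \<theta> j" and ?x = "r * real n * real j powr - (1 / \<alpha>) * h"
  have A: "0 < ?A" using gem_shape_lower(2)[of \<alpha> \<theta> j] assms by simp
  have x: "0 \<le> ?x" using assms by simp
  have "(1 - p) ^ n \<le> exp (- p) ^ n"
    using assms exp_ge_add_one_self[of "- p"] by (intro power_mono) auto
  also have "\<dots> = exp (- (real n * p))" by (simp add: exp_of_nat_mult[symmetric])
  also have "\<dots> \<le> exp (- ?A * ln (1 + ?x))"
  proof -
    have "?A * ln (1 + ?x) \<le> ?A * ?x"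
      using A x by (intro mult_left_mono ln_add_one_self_le_self) auto
    also have "\<dots> = real n * (?A * (r * real j powr - (1 / \<alpha>)) * h)" by simp
    also have "\<dots> \<le> real n * p" using assms by (intro mult_left_mono) auto
    finally show ?thesis by simp
  qed
  also have "\<dots> = (1 + ?x) powr - ?A" using x by (simp add: powr_def add_pos_nonneg)
  finally show ?thesis by simp
qed

text \<open>In this direction both inequalities have to be reversed at the price of factors: \<open>1 - p\<close> for the
  first, and \<open>1 + y\<close> for the second, which is close to \<open>1\<close> only if \<open>y = r n j powr (- 1 / \<alpha>) * h\<close> is small.
  The bound \<open>V\<close> makes this hold when \<open>j\<close> is at least a small multiple of \<open>n powr \<alpha>\<close>.\<close>
lemma occupancy_le_surrogate_term:
  assumes "0 < \<alpha>" "\<alpha> < 1" "\<theta> > - \<alpha>" "0 < h" "1 \<le> j" "0 \<le> r" "p < 1" "0 \<le> p"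
    and V: "r * real n * real j powr - (1 / \<alpha>) \<le> V"
    and dom: "p / (1 - p) * (1 + V * h) \<le> gem_shape \<alpha> \<theta> j * (r * real j powr - (1 / \<alpha>)) * h"
  shows "1 - (1 - p) ^ n \<le> 1 - (1 + r * real n * real j powr - (1 / \<alpha>) * h) powr - gem_shape \<alpha> \<theta> j"
proof -
  let ?A = "gem_shape \<alpha> \<theta> j" and ?x = "r * real n * real j powr - (1 / \<alpha>) * h"
  have A: "0 < ?A" using gem_shape_lower(2)[of \<alpha> \<theta> j] assms by simp
  have x: "0 \<le> ?x" using assms by simp
  have ln_lower: "y / (1 + y) \<le> ln (1 + y)" if "0 \<le> y" for y :: real
  proof -
    have "y / (1 + y) = 1 - inverse (1 + y)" using that by (simp add: field_simps)
    also have "\<dots> \<le> - ln (inverse (1 + y))" using ln_le_minus_one[of "inverse (1 + y)"] that by simp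
    finally show ?thesis using that by (simp add: ln_inverse)
  qed
  have xV: "?x \<le> V * h" using V assms by (intro mult_right_mono) auto
  have "(1 + ?x) powr - ?A = exp (- ?A * ln (1 + ?x))" using x by (simp add: powr_def add_pos_nonneg)
  also have "\<dots> \<le> exp (real n * ln (1 - p))"
  proof -
    have "1 - p = inverse (1 + p / (1 - p))" using assms by (simp add: field_simps)
    then have "- ln (1 - p) = ln (1 + p / (1 - p))"
      using assms by (metis add.inverse_inverse ln_inverse)
    also have "\<dots> \<le> p / (1 - p)" using assms by (intro ln_add_one_self_le_self) auto
    finally have "real n * - ln (1 - p) \<le> real n * (p / (1 - p))" by (intro mult_left_mono) auto
    also have "\<dots> \<le> real n * (?A * (r * real j powr - (1 / \<alpha>)) * h / (1 + V * h))"
      using dom x xV by (intro mult_left_mono) (auto simp: pos_le_divide_eq add_pos_nonneg)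
    also have "\<dots> = ?A * (?x / (1 + V * h))" by simp
    also have "\<dots> \<le> ?A * (?x / (1 + ?x))"
      using A x xV by (intro mult_left_mono divide_left_mono mult_pos_pos) (auto intro: add_pos_nonneg)
    also have "\<dots> \<le> ?A * ln (1 + ?x)" using A x by (intro mult_left_mono ln_lower) auto
    finally show ?thesis by simp
  qed
  also have "\<dots> = (1 - p) ^ n" using assms by (simp add: exp_of_nat_mult)
  finally show ?thesis by simp
qed

text \<open>With \<open>\<kappa> = c / \<alpha>\<close>, the frequency \<open>p\<^sub>j = h\<^sub>j W\<^sub>j\<^sub>-\<^sub>1\<close> is asymptotic to \<open>A\<^sub>j \<kappa> j powr (- 1 / \<alpha>) * h\<^sub>j\<close>. Hence
  for \<open>r < \<kappa>\<close> all but finitely many occupancy probabilities dominate the surrogate terms with parameter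
  \<open>r n\<close>. For \<open>r > \<kappa>\<close> they are dominated by them, apart from the first \<open>N + \<delta> n powr \<alpha>\<close> ones, which contribute
  at most \<open>1\<close> each. Letting \<open>r\<close> tend to \<open>\<kappa>\<close> and \<open>\<delta>\<close> to \<open>0\<close> gives the claim.\<close>
lemma expected_count_asymp:
  fixes h :: "nat \<Rightarrow> real"
  assumes \<alpha>: "0 < \<alpha>" "\<alpha> < 1" and \<theta>: "\<theta> > - \<alpha>"
    and h: "\<And>j. 1 \<le> j \<Longrightarrow> 0 < h j \<and> h j < 1"
    and h0: "(\<lambda>j. h (Suc j)) \<longlonglongrightarrow> 0"
    and c: "0 < c" and W: "(\<lambda>k. stick_remainder h k * real k powr ((1 - \<alpha>) / \<alpha>)) \<longlonglongrightarrow> c"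
    and summable: "\<And>n. summable (\<lambda>j. surrogate_term \<alpha> \<theta> h (real n) (Suc j))"
    and tilted: "(\<lambda>n. surrogate_count \<alpha> \<theta> h (real n) / real n powr \<alpha>) \<longlonglongrightarrow> 1"
  shows "(\<lambda>n. expected_count (stick_breaking h) n / real n powr \<alpha>) \<longlonglongrightarrow> (c / \<alpha>) powr \<alpha>"
proof -
  let ?A = "gem_shape \<alpha> \<theta>" and ?p = "stick_breaking h" and ?W = "stick_remainder h"
  note Wb = stick_remainder_bounds[of h, OF h]
  have hS: "0 < h (Suc j)" "h (Suc j) < 1" for j using h[of "Suc j"] by auto
  have p: "0 < ?p (Suc j)" "?p (Suc j) < 1" for j
  proof -
    show "0 < ?p (Suc j)" using Wb(1)[of j] hS[of j] by (simp add: stick_breaking_Suc)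
    have "?p (Suc j) \<le> h (Suc j) * 1" unfolding stick_breaking_Suc using Wb hS[of j] by (intro mult_left_mono) auto
    then show "?p (Suc j) < 1" using hS[of j] by simp
  qed
  have sum_p: "summable (\<lambda>j. ?p (Suc j))"
  proof (rule summableI_nonneg_bounded)
    show "(\<Sum>i<n. ?p (Suc i)) \<le> 1" for n using Wb(1)[of n] by (simp add: sum_stick_breaking)
  qed (use p in \<open>simp add: less_imp_le\<close>)
  define \<phi> where "\<phi> n j = 1 - (1 - ?p (Suc j)) ^ n" for n j
  have \<phi>: "0 \<le> \<phi> n j" "\<phi> n j \<le> 1" "\<phi> n j \<le> real n * ?p (Suc j)" for n j
    unfolding \<phi>_def using occupancy_bounds[of "?p (Suc j)" n] p[of j] by auto
  have sum_\<phi>: "summable (\<phi> n)" for n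
    by (rule summable_comparison_test'[OF summable_mult[OF sum_p, of "real n"], where N = 0]) (use \<phi> in auto)
  let ?\<psi> = "\<lambda>\<mu> j. surrogate_term \<alpha> \<theta> h \<mu> (Suc j)"
  have \<psi>: "0 \<le> ?\<psi> \<mu> j" "?\<psi> \<mu> j \<le> 1" if "0 \<le> \<mu>" for \<mu> j
    using surrogate_term_bounds[OF \<alpha> \<theta>, of h "Suc j" \<mu>] that hS[of j] by auto
  have sum_\<psi>: "summable (?\<psi> \<mu>)" if "0 \<le> \<mu>" for \<mu>
  proof (rule summable_comparison_test'[OF summable, where N = 0])
    fix j show "norm (?\<psi> \<mu> j) \<le> ?\<psi> (real (nat \<lceil>\<mu>\<rceil>)) j"
      using \<psi>[OF that, of j] surrogate_term_mono[OF \<alpha> \<theta>, of h "Suc j" \<mu> "real (nat \<lceil>\<mu>\<rceil>)"] that hS[of j]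
      by (auto simp: real_nat_ceiling_ge)
  qed
  have scaled: "(\<lambda>n. surrogate_count \<alpha> \<theta> h (r * real n) / real n powr \<alpha>) \<longlonglongrightarrow> r powr \<alpha>" if "0 < r" for r
  proof -
    have "(\<lambda>n. surrogate_count \<alpha> \<theta> h (r * real n) / real n powr \<alpha>) \<longlonglongrightarrow> 1 * r powr \<alpha>"
    proof (rule regular_growth_rescale[OF _ tilted that])
      fix s t :: real assume st: "0 \<le> s" "s \<le> t"
      then show "surrogate_count \<alpha> \<theta> h s \<le> surrogate_count \<alpha> \<theta> h t"
        unfolding surrogate_count_def using hS
        by (intro suminf_le surrogate_term_mono \<alpha> \<theta> sum_\<psi>) (auto simp: less_imp_le)
    qed
    then show ?thesis by simp
  qed
  define \<kappa> where "\<kappa> = c / \<alpha>"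
  have \<kappa>: "0 < \<kappa>" using c \<alpha> by (simp add: \<kappa>_def)
  define R where "R j = ?W j / (?A (Suc j) * real (Suc j) powr - (1 / \<alpha>))" for j
  have A: "0 < ?A (Suc j)" for j using gem_shape_lower(2)[OF \<alpha> \<theta>, of "Suc j"] by simp
  have R: "R \<longlonglongrightarrow> \<kappa>"
  proof -
    have inv: "(\<lambda>n. inverse (real (Suc n))) \<longlonglongrightarrow> 0" by (rule LIMSEQ_inverse_real_of_nat)
    have "(\<lambda>j. ?W j * real j powr ((1 - \<alpha>) / \<alpha>) / (real j / real (Suc j)) powr ((1 - \<alpha>) / \<alpha>)
        / (\<alpha> + (1 + \<theta> - \<alpha>) * inverse (real (Suc j)))) \<longlonglongrightarrow> c / 1 powr ((1 - \<alpha>) / \<alpha>) / (\<alpha> + (1 + \<theta> - \<alpha>) * 0)"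
      using \<alpha> by (intro tendsto_intros W LIMSEQ_n_over_Suc_n inv) auto
    moreover have "\<forall>\<^sub>F j in sequentially. ?W j * real j powr ((1 - \<alpha>) / \<alpha>) / (real j / real (Suc j)) powr ((1 - \<alpha>) / \<alpha>)
        / (\<alpha> + (1 + \<theta> - \<alpha>) * inverse (real (Suc j))) = R j"
      using eventually_gt_at_top[of 0]
    proof eventually_elim
      case (elim j)
      have eA: "\<alpha> + (1 + \<theta> - \<alpha>) * inverse (real (Suc j)) = ?A (Suc j) / real (Suc j)"
        by (simp add: gem_shape_def field_simps)
      have e: "real (Suc j) powr ((1 - \<alpha>) / \<alpha>) * real (Suc j) = real (Suc j) powr (1 / \<alpha>)"
      proof -
        have "real (Suc j) powr ((1 - \<alpha>) / \<alpha>) * real (Suc j) powr 1 = real (Suc j) powr (1 / \<alpha>)"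
          unfolding powr_add[symmetric] using \<alpha> by (simp add: field_simps)
        then show ?thesis by simp
      qed
      have "?W j * real j powr ((1 - \<alpha>) / \<alpha>) / (real j / real (Suc j)) powr ((1 - \<alpha>) / \<alpha>)
        / (?A (Suc j) / real (Suc j)) = ?W j * (real (Suc j) powr ((1 - \<alpha>) / \<alpha>) * real (Suc j)) / ?A (Suc j)"
        using elim A[of j] by (simp add: powr_divide field_simps del: of_nat_Suc)
      then show ?case unfolding eA e R_def by (simp add: powr_minus divide_inverse mult_ac)
    qed
    ultimately show ?thesis using \<alpha> by (auto simp: \<kappa>_def elim: Lim_transform_eventually)
  qed
  have dom_eq: "?A (Suc j) * (r * real (Suc j) powr - (1 / \<alpha>)) * h (Suc j) = ?p (Suc j) * (r / R j)" for r j
    using Wb(1)[of j] A[of j] by (simp add: R_def stick_breaking_Suc)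
  have Rpos: "0 < R j" for j using Wb(1)[of j] A[of j] by (simp add: R_def)
  show ?thesis
  proof (rule order_tendstoI)
    fix a assume "a < (c / \<alpha>) powr \<alpha>"
    then obtain r where r: "0 < r" "r < \<kappa>" "a < r powr \<alpha>"
      using powr_gap(1)[OF \<kappa>, of a \<alpha>] by (auto simp: \<kappa>_def)
    obtain N where N: "\<And>j. N \<le> j \<Longrightarrow> r < R j"
      using order_tendstoD(1)[OF R r(2)] by (auto simp: eventually_sequentially)
    have low: "surrogate_count \<alpha> \<theta> h (r * real n) \<le> expected_count ?p n + real N" for n
      unfolding surrogate_count_def expected_count_def \<phi>_def[symmetric]
    proof (rule suminf_le_suminf_plus_exceptions[OF sum_\<psi> sum_\<phi>])
      show "0 \<le> r * real n" using r by simp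
      fix j
      show "?\<psi> (r * real n) j \<le> \<phi> n j + 1" using \<psi>(2)[of "r * real n" j] \<phi>(1)[of n j] r by simp
      assume "N \<le> j"
      then have "r / R j \<le> 1" using N[of j] Rpos[of j] by (simp add: less_imp_le)
      then have "?p (Suc j) * (r / R j) \<le> ?p (Suc j)" using p[of j] by (intro mult_left_le) (auto simp: less_imp_le)
      then show "?\<psi> (r * real n) j \<le> \<phi> n j" unfolding \<phi>_def surrogate_term_def
        using r p[of j] hS[of j] by (intro surrogate_term_le_occupancy \<alpha> \<theta>) (auto simp only: dom_eq less_imp_le)
    qed
    have "(\<lambda>n. surrogate_count \<alpha> \<theta> h (r * real n) / real n powr \<alpha> - real N * real n powr - \<alpha>) \<longlonglongrightarrow> r powr \<alpha> - real N * 0"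
      using \<alpha> by (intro tendsto_intros scaled r tendsto_neg_powr filterlim_real_sequentially) auto
    then have "\<forall>\<^sub>F n in sequentially. a < surrogate_count \<alpha> \<theta> h (r * real n) / real n powr \<alpha> - real N * real n powr - \<alpha>"
      by (rule order_tendstoD) (use r in simp)
    then show "\<forall>\<^sub>F n in sequentially. a < expected_count ?p n / real n powr \<alpha>"
    proof eventually_elim
      case (elim n)
      also have "surrogate_count \<alpha> \<theta> h (r * real n) / real n powr \<alpha> - real N * real n powr - \<alpha>
          = (surrogate_count \<alpha> \<theta> h (r * real n) - real N) / real n powr \<alpha>"
        by (simp add: powr_minus divide_inverse left_diff_distrib)
      also have "\<dots> \<le> expected_count ?p n / real n powr \<alpha>"
        using low[of n] by (intro divide_right_mono) auto
      finally show ?case .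
    qed
  next
    fix a assume "(c / \<alpha>) powr \<alpha> < a"
    then obtain r where r: "\<kappa> < r" "r powr \<alpha> < a"
      using powr_gap(2)[OF \<kappa>, of \<alpha> a] by (auto simp: \<kappa>_def)
    have r0: "0 < r" using r \<kappa> by simp
    \<comment> \<open>\<open>\<delta> n powr \<alpha>\<close> is the allowance for the small indices; it leaves half of the gap to spare\<close>
    define \<delta> where "\<delta> = (a - r powr \<alpha>) / 2"
    have \<delta>: "0 < \<delta>" using r by (simp add: \<delta>_def)
    \<comment> \<open>the value of \<open>r n j powr (- 1 / \<alpha>)\<close> at \<open>j = \<delta> n powr \<alpha>\<close>\<close>
    define V where "V = r * \<delta> powr - (1 / \<alpha>)"
    have V: "0 \<le> V" using r0 by (simp add: V_def)
    have p0: "(\<lambda>j. ?p (Suc j)) \<longlonglongrightarrow> 0" by (rule summable_LIMSEQ_zero[OF sum_p])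
    have "(\<lambda>j. R j * (1 + V * h (Suc j)) / (1 - ?p (Suc j))) \<longlonglongrightarrow> \<kappa> * (1 + V * 0) / (1 - 0)"
      by (intro tendsto_intros R h0 p0) auto
    then have "\<forall>\<^sub>F j in sequentially. R j * (1 + V * h (Suc j)) / (1 - ?p (Suc j)) < r"
      by (rule order_tendstoD) (use r in simp)
    then obtain N where N: "\<And>j. N \<le> j \<Longrightarrow> R j * (1 + V * h (Suc j)) / (1 - ?p (Suc j)) < r"
      by (auto simp: eventually_sequentially)
    have up: "expected_count ?p n \<le> surrogate_count \<alpha> \<theta> h (r * real n) + real (N + nat \<lceil>\<delta> * real n powr \<alpha>\<rceil>)" for n
      unfolding surrogate_count_def expected_count_def \<phi>_def[symmetric]
    proof (rule suminf_le_suminf_plus_exceptions[OF sum_\<phi> sum_\<psi>])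
      show "0 \<le> r * real n" using r0 by simp
      fix j
      show "\<phi> n j \<le> ?\<psi> (r * real n) j + 1" using \<psi>(1)[of "r * real n" j] \<phi>(2)[of n j] r0 by simp
      assume j: "N + nat \<lceil>\<delta> * real n powr \<alpha>\<rceil> \<le> j"
      then have j': "\<delta> * real n powr \<alpha> \<le> real (Suc j)" by linarith
      have "r * real n * real (Suc j) powr - (1 / \<alpha>) \<le> V"
      proof (cases "n = 0")
        case False
        then have "real (Suc j) powr - (1 / \<alpha>) \<le> (\<delta> * real n powr \<alpha>) powr - (1 / \<alpha>)"
          using \<alpha> \<delta> j' by (intro powr_mono2') auto
        also have "\<dots> = \<delta> powr - (1 / \<alpha>) * real n powr - 1"
          using \<alpha> \<delta> False by (simp add: powr_mult powr_powr)
        finally have "r * real n * real (Suc j) powr - (1 / \<alpha>) \<le> r * real n * (\<delta> powr - (1 / \<alpha>) * real n powr - 1)"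
          using r0 by (intro mult_left_mono) auto
        also have "\<dots> = V" using False by (simp add: V_def powr_minus)
        finally show ?thesis .
      qed (use V in simp)
      moreover have "?p (Suc j) / (1 - ?p (Suc j)) * (1 + V * h (Suc j)) \<le> ?p (Suc j) * (r / R j)"
      proof -
        have "(1 + V * h (Suc j)) / (1 - ?p (Suc j)) \<le> r / R j"
          using N[of j] j Rpos[of j] by (simp add: pos_le_divide_eq mult_ac less_imp_le)
        then have "?p (Suc j) * ((1 + V * h (Suc j)) / (1 - ?p (Suc j))) \<le> ?p (Suc j) * (r / R j)"
          using p[of j] by (intro mult_left_mono) auto
        then show ?thesis by simp
      qed
      ultimately show "\<phi> n j \<le> ?\<psi> (r * real n) j" unfolding \<phi>_def surrogate_term_def
        using r0 p[of j] hS[of j] by (intro occupancy_le_surrogate_term[where V = V] \<alpha> \<theta>) (auto simp only: dom_eq less_imp_le)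
    qed
    have "(\<lambda>n. surrogate_count \<alpha> \<theta> h (r * real n) / real n powr \<alpha> + (real N + 1) * real n powr - \<alpha> + \<delta>) \<longlonglongrightarrow> r powr \<alpha> + (real N + 1) * 0 + \<delta>"
      using \<alpha> by (intro tendsto_intros scaled r0 tendsto_neg_powr filterlim_real_sequentially) auto
    then have "\<forall>\<^sub>F n in sequentially. surrogate_count \<alpha> \<theta> h (r * real n) / real n powr \<alpha> + (real N + 1) * real n powr - \<alpha> + \<delta> < a"
      by (rule order_tendstoD) (use \<delta> in \<open>simp add: \<delta>_def field_simps\<close>)
    then show "\<forall>\<^sub>F n in sequentially. expected_count ?p n / real n powr \<alpha> < a"
      using eventually_gt_at_top[of 0]
    proof eventually_elim
      case (elim n)
      have "0 \<le> \<delta> * real n powr \<alpha>" using \<delta> by simp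
      then have "real (nat \<lceil>\<delta> * real n powr \<alpha>\<rceil>) \<le> \<delta> * real n powr \<alpha> + 1" by linarith
      then have "expected_count ?p n / real n powr \<alpha> \<le> (surrogate_count \<alpha> \<theta> h (r * real n) + (real N + 1) + \<delta> * real n powr \<alpha>) / real n powr \<alpha>"
        using up[of n] by (intro divide_right_mono) auto
      also have "\<dots> = surrogate_count \<alpha> \<theta> h (r * real n) / real n powr \<alpha> + (real N + 1) * real n powr - \<alpha> + \<delta>"
        using elim by (simp add: add_divide_distrib powr_minus divide_inverse[of _ "real n powr \<alpha>"] distrib_right)
      finally show ?case using elim by simp
    qed
  qed
qed

section \<open>Independent beta sticks\<close>

text \<open>The joint law of the sticks, of which \<open>GEM \<alpha> \<theta>\<close> is the image under \<open>stick_breaking\<close>.\<close>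
definition stick_law :: "real \<Rightarrow> real \<Rightarrow> (nat \<Rightarrow> real) measure" where
  "stick_law \<alpha> \<theta> = (\<Pi>\<^sub>M i\<in>{1..}. beta_distribution (1 - \<alpha>) (\<theta> + real i * \<alpha>))"

lemma stick_params:
  fixes \<alpha> \<theta> :: real
  assumes "0 < \<alpha>" "\<alpha> < 1" "\<theta> > - \<alpha>" "1 \<le> i"
  shows "0 < 1 - \<alpha>" "0 < \<theta> + real i * \<alpha>" "(1 - \<alpha>) + (\<theta> + real i * \<alpha>) = gem_shape \<alpha> \<theta> i"
proof -
  have "\<alpha> \<le> real i * \<alpha>" using assms by simp
  then show "0 < \<theta> + real i * \<alpha>" using assms by linarith
qed (use assms in \<open>auto simp: gem_shape_def algebra_simps\<close>)

lemma sets_stick_law[measurable_cong]: "sets (stick_law \<alpha> \<theta>) = sets seq_space"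
  unfolding stick_law_def by (intro sets_PiM_cong) auto

context
  fixes \<alpha> \<theta> :: real
  assumes \<alpha>: "0 < \<alpha>" "\<alpha> < 1" and \<theta>: "\<theta> > - \<alpha>"
begin

lemma beta_prob: "1 \<le> i \<Longrightarrow> prob_space (beta_distribution (1 - \<alpha>) (\<theta> + real i * \<alpha>))"
  using stick_params[OF \<alpha> \<theta>] by (intro prob_space_beta_distribution) auto

lemma prob_space_stick_law: "prob_space (stick_law \<alpha> \<theta>)"
  unfolding stick_law_def by (intro prob_space_PiM beta_prob) auto

lemma distr_stick:
  assumes "1 \<le> i"
  shows "distr (stick_law \<alpha> \<theta>) borel (\<lambda>h. h i) = beta_distribution (1 - \<alpha>) (\<theta> + real i * \<alpha>)"
proof -
  have "distr (stick_law \<alpha> \<theta>) (beta_distribution (1 - \<alpha>) (\<theta> + real i * \<alpha>)) (\<lambda>h. h i) = beta_distribution (1 - \<alpha>) (\<theta> + real i * \<alpha>)"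
    unfolding stick_law_def using assms by (intro distr_PiM_component beta_prob) auto
  then show ?thesis by (simp cong: distr_cong)
qed

lemma indep_vars_sticks:
  "prob_space.indep_vars (stick_law \<alpha> \<theta>) (\<lambda>_. borel) (\<lambda>i h. h i) {1..}"
proof -
  interpret prob_space "stick_law \<alpha> \<theta>" by (rule prob_space_stick_law)
  have "distr (stick_law \<alpha> \<theta>) seq_space (\<lambda>h. \<lambda>i\<in>{1..}. h i) = distr (stick_law \<alpha> \<theta>) (stick_law \<alpha> \<theta>) (\<lambda>h. h)"
  proof (rule distr_cong[OF refl sets_stick_law[symmetric]])
    fix h assume "h \<in> space (stick_law \<alpha> \<theta>)"
    then show "(\<lambda>i\<in>{1..}. h i) = h" by (auto simp: stick_law_def space_PiM PiE_restrict)
  qed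
  also have "\<dots> = (\<Pi>\<^sub>M i\<in>{1..}. distr (stick_law \<alpha> \<theta>) borel (\<lambda>h. h i))"
    unfolding distr_id by (subst (1) stick_law_def) (intro PiM_cong, auto simp: distr_stick)
  finally show ?thesis by (subst indep_vars_iff_distr_eq_PiM') auto
qed

lemma nn_integral_stick:
  assumes "1 \<le> i" "f \<in> borel_measurable borel"
  shows "(\<integral>\<^sup>+h. f (h i) \<partial>stick_law \<alpha> \<theta>) = (\<integral>\<^sup>+x. f x \<partial>beta_distribution (1 - \<alpha>) (\<theta> + real i * \<alpha>))"
  using assms by (subst distr_stick[symmetric]) (auto simp: nn_integral_distr)

lemma nn_integral_two_sticks:
  fixes f g :: "real \<Rightarrow> ennreal"
  assumes "1 \<le> i" "1 \<le> j" "i \<noteq> j" and [measurable]: "f \<in> borel_measurable borel" "g \<in> borel_measurable borel"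
  shows "(\<integral>\<^sup>+h. f (h i) * g (h j) \<partial>stick_law \<alpha> \<theta>) = (\<integral>\<^sup>+h. f (h i) \<partial>stick_law \<alpha> \<theta>) * (\<integral>\<^sup>+h. g (h j) \<partial>stick_law \<alpha> \<theta>)"
proof -
  interpret prob_space "stick_law \<alpha> \<theta>" by (rule prob_space_stick_law)
  have "indep_vars (\<lambda>_. borel) (\<lambda>k h. (if k = i then f else g) (h k)) {i, j}"
    by (rule indep_vars_compose2[OF indep_vars_subset[OF indep_vars_sticks]]) (use assms in auto)
  then have "(\<integral>\<^sup>+h. (\<Prod>k\<in>{i, j}. (if k = i then f else g) (h k)) \<partial>stick_law \<alpha> \<theta>)
      = (\<Prod>k\<in>{i, j}. \<integral>\<^sup>+h. (if k = i then f else g) (h k) \<partial>stick_law \<alpha> \<theta>)"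
    by (intro indep_vars_nn_integral) auto
  then show ?thesis using assms by simp
qed

lemma AE_sticks_in_unit_interval: "AE h in stick_law \<alpha> \<theta>. \<forall>j\<ge>1. 0 < h j \<and> h j < 1"
proof -
  have "AE h in stick_law \<alpha> \<theta>. 1 \<le> j \<longrightarrow> 0 < h j \<and> h j < 1" for j
  proof (cases "1 \<le> j")
    case True
    have "AE h in stick_law \<alpha> \<theta>. 0 < h j \<and> h j < 1"
      unfolding stick_law_def by (rule AE_PiM_component) (use True beta_prob AE_beta_distribution in auto)
    then show ?thesis by eventually_elim simp
  qed simp
  then show ?thesis by (simp add: AE_all_countable)
qed

lemma stick_second_moment:
  "\<exists>C\<ge>0. \<forall>j\<ge>1. (\<integral>\<^sup>+h. ennreal ((h j)\<^sup>2) \<partial>stick_law \<alpha> \<theta>) \<le> ennreal (C / (real j)\<^sup>2)"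
proof (intro exI[of _ "2 / (min \<alpha> (1 + \<theta>))\<^sup>2"] conjI allI impI)
  fix j :: nat assume j: "1 \<le> j"
  note A = gem_shape_lower[OF \<alpha> \<theta> j]
  have d: "0 < min \<alpha> (1 + \<theta>)" using \<alpha> \<theta> by auto
  have "(\<integral>\<^sup>+h. ennreal ((h j)\<^sup>2) \<partial>stick_law \<alpha> \<theta>) \<le> ennreal (2 / (gem_shape \<alpha> \<theta> j)\<^sup>2)"
    using stick_params[OF \<alpha> \<theta> j] beta_second_moment(2)[of "1 - \<alpha>" "\<theta> + real j * \<alpha>"] \<alpha> j
    by (subst nn_integral_stick) auto
  also have "\<dots> \<le> ennreal (2 / (min \<alpha> (1 + \<theta>) * real j)\<^sup>2)"
    using A d j by (intro ennreal_leI divide_left_mono power_mono mult_pos_pos zero_less_power) auto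
  finally show "(\<integral>\<^sup>+h. ennreal ((h j)\<^sup>2) \<partial>stick_law \<alpha> \<theta>) \<le> ennreal (2 / (min \<alpha> (1 + \<theta>))\<^sup>2 / (real j)\<^sup>2)"
    by (simp add: power_mult_distrib)
qed simp

lemma AE_summable_square_sticks: "AE h in stick_law \<alpha> \<theta>. summable (\<lambda>j. (h (Suc j))\<^sup>2)"
proof -
  obtain C where C: "0 \<le> C" "\<And>j. 1 \<le> j \<Longrightarrow> (\<integral>\<^sup>+h. ennreal ((h j)\<^sup>2) \<partial>stick_law \<alpha> \<theta>) \<le> ennreal (C / (real j)\<^sup>2)"
    using stick_second_moment by blast
  show ?thesis
    by (rule AE_summable_if_summable_integrals[where a = "\<lambda>j. C / (real (Suc j))\<^sup>2"])
       (use C in \<open>auto intro!: C summable_inverse_squares_Suc simp del: of_nat_Suc\<close>)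
qed

lemma centred_stick_moments:
  fixes Y
  defines "Y \<equiv> \<lambda>j h. h (Suc j) - (1 - \<alpha>) / gem_shape \<alpha> \<theta> (Suc j)"
  shows "integrable (stick_law \<alpha> \<theta>) (Y j)" "integrable (stick_law \<alpha> \<theta>) (\<lambda>h. (Y j h)\<^sup>2)"
    "(\<integral>h. (Y j h)\<^sup>2 \<partial>stick_law \<alpha> \<theta>) \<le> (\<integral>h. (h (Suc j))\<^sup>2 \<partial>stick_law \<alpha> \<theta>)"
    "integrable (stick_law \<alpha> \<theta>) (\<lambda>h. (h (Suc j))\<^sup>2)"
    "i \<noteq> j \<Longrightarrow> integrable (stick_law \<alpha> \<theta>) (\<lambda>h. Y i h * Y j h)"
    "i \<noteq> j \<Longrightarrow> (\<integral>h. Y i h * Y j h \<partial>stick_law \<alpha> \<theta>) = 0"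
proof -
  interpret prob_space "stick_law \<alpha> \<theta>" by (rule prob_space_stick_law)
  let ?B = "\<lambda>j. beta_distribution (1 - \<alpha>) (\<theta> + real (Suc j) * \<alpha>)"
  let ?e = "\<lambda>j. (1 - \<alpha>) / gem_shape \<alpha> \<theta> (Suc j)"
  have int1: "integrable (stick_law \<alpha> \<theta>) (\<lambda>h. h (Suc j))" and mean: "(\<integral>h. h (Suc j) \<partial>stick_law \<alpha> \<theta>) = ?e j"
    and int2: "integrable (stick_law \<alpha> \<theta>) (\<lambda>h. (h (Suc j))\<^sup>2)" for j
  proof -
    note p = stick_params[OF \<alpha> \<theta>, of "Suc j"]
    have ab: "0 < 1 - \<alpha>" "0 < \<theta> + real (Suc j) * \<alpha>" "1 - \<alpha> \<le> 1" using p \<alpha> by auto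
    have "integrable (distr (stick_law \<alpha> \<theta>) borel (\<lambda>h. h (Suc j))) (\<lambda>x. x)"
      unfolding distr_stick[of "Suc j", simplified] using beta_mean(1)[OF ab(1,2)] by simp
    then show "integrable (stick_law \<alpha> \<theta>) (\<lambda>h. h (Suc j))" by (subst (asm) integrable_distr_eq) auto
    have "(\<integral>x. x \<partial>distr (stick_law \<alpha> \<theta>) borel (\<lambda>h. h (Suc j))) = ?e j"
      unfolding distr_stick[of "Suc j", simplified] using beta_mean(2)[OF ab(1,2)] p(3) by simp
    then show "(\<integral>h. h (Suc j) \<partial>stick_law \<alpha> \<theta>) = ?e j" by (subst (asm) integral_distr) auto
    have "integrable (distr (stick_law \<alpha> \<theta>) borel (\<lambda>h. h (Suc j))) (\<lambda>x. x\<^sup>2)"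
      unfolding distr_stick[of "Suc j", simplified] using beta_second_moment(1)[OF ab(1,3,2)] by simp
    then show "integrable (stick_law \<alpha> \<theta>) (\<lambda>h. (h (Suc j))\<^sup>2)" by (subst (asm) integrable_distr_eq) auto
  qed
  show intY: "integrable (stick_law \<alpha> \<theta>) (Y j)" for j unfolding Y_def using int1 by simp
  have meanY: "(\<integral>h. Y j h \<partial>stick_law \<alpha> \<theta>) = 0" for j
    unfolding Y_def using int1 mean by (simp add: prob_space)
  have sqY: "(Y j h)\<^sup>2 = (h (Suc j))\<^sup>2 - 2 * ?e j * h (Suc j) + (?e j)\<^sup>2" for j h
    by (simp add: Y_def power2_eq_square algebra_simps)
  show "integrable (stick_law \<alpha> \<theta>) (\<lambda>h. (Y j h)\<^sup>2)" unfolding sqY using int1 int2 by simp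
  show "(\<integral>h. (Y j h)\<^sup>2 \<partial>stick_law \<alpha> \<theta>) \<le> (\<integral>h. (h (Suc j))\<^sup>2 \<partial>stick_law \<alpha> \<theta>)"
  proof -
    define e where "e = ?e j"
    have "(\<integral>h. (Y j h)\<^sup>2 \<partial>stick_law \<alpha> \<theta>) = (\<integral>h. (h (Suc j))\<^sup>2 \<partial>stick_law \<alpha> \<theta>) - 2 * e * e + e\<^sup>2"
      unfolding sqY e_def[symmetric] using int1 int2 by (simp add: mean prob_space) (simp add: e_def)
    then show ?thesis using zero_le_power2[of e] by (simp add: power2_eq_square)
  qed
  show "integrable (stick_law \<alpha> \<theta>) (\<lambda>h. (h (Suc j))\<^sup>2)" by (rule int2)
  assume ij: "i \<noteq> j"
  have ind: "indep_vars (\<lambda>_. borel) (\<lambda>k h. h k - (1 - \<alpha>) / gem_shape \<alpha> \<theta> k) {Suc i, Suc j}"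
    by (rule indep_vars_compose2[OF indep_vars_subset[OF indep_vars_sticks]]) auto
  have int: "integrable (stick_law \<alpha> \<theta>) (\<lambda>h. h k - (1 - \<alpha>) / gem_shape \<alpha> \<theta> k)" if "k \<in> {Suc i, Suc j}" for k
    using that intY[of i] intY[of j] by (auto simp: Y_def)
  from indep_vars_integrable[OF _ ind int] ij show "integrable (stick_law \<alpha> \<theta>) (\<lambda>h. Y i h * Y j h)"
    by (simp add: Y_def)
  from indep_vars_lebesgue_integral[OF _ ind int] ij meanY show "(\<integral>h. Y i h * Y j h \<partial>stick_law \<alpha> \<theta>) = 0"
    by (simp add: Y_def)
qed

text \<open>The variance of the \<open>j\<close>-th stick is of order \<open>1 / j\<^sup>2\<close>. The block sum \<open>X\<^sub>k\<close> over the indices from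
  \<open>k\<^sup>3\<close> to \<open>(k + 1)\<^sup>3\<close> thus has variance of order \<open>k\<^sup>2 / k\<^sup>6 = 1 / k\<^sup>4\<close> and absolute mean of order \<open>1 / k\<^sup>2\<close>,
  so the block sums are almost surely absolutely summable.\<close>
lemma AE_centred_sticks_converge:
  "AE h in stick_law \<alpha> \<theta>. convergent (\<lambda>k. \<Sum>j<k ^ 3. h (Suc j) - (1 - \<alpha>) / gem_shape \<alpha> \<theta> (Suc j))"
proof -
  interpret prob_space "stick_law \<alpha> \<theta>" by (rule prob_space_stick_law)
  define Y where "Y j h = h (Suc j) - (1 - \<alpha>) / gem_shape \<alpha> \<theta> (Suc j)" for j and h :: "nat \<Rightarrow> real"
  note Y = centred_stick_moments[folded Y_def]
  have [measurable]: "Y j \<in> borel_measurable (stick_law \<alpha> \<theta>)" for j using Y(1) by auto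
  obtain C where C: "0 \<le> C" "\<And>j. 1 \<le> j \<Longrightarrow> (\<integral>\<^sup>+h. ennreal ((h j)\<^sup>2) \<partial>stick_law \<alpha> \<theta>) \<le> ennreal (C / (real j)\<^sup>2)"
    using stick_second_moment by blast
  have var: "(\<integral>h. (Y j h)\<^sup>2 \<partial>stick_law \<alpha> \<theta>) \<le> C / (real (Suc j))\<^sup>2" for j
  proof -
    have "ennreal (\<integral>h. (h (Suc j))\<^sup>2 \<partial>stick_law \<alpha> \<theta>) \<le> ennreal (C / (real (Suc j))\<^sup>2)"
      using C(2)[of "Suc j"] nn_integral_eq_integral[OF Y(4)[of j]] by simp
    then have "(\<integral>h. (h (Suc j))\<^sup>2 \<partial>stick_law \<alpha> \<theta>) \<le> C / (real (Suc j))\<^sup>2"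
      using C(1) by (simp add: ennreal_le_iff)
    with Y(3)[of j] show ?thesis by linarith
  qed
  define X where "X k h = (\<Sum>j\<in>{k ^ 3..<Suc k ^ 3}. Y j h)" for k h
  have [measurable]: "X k \<in> borel_measurable (stick_law \<alpha> \<theta>)" for k unfolding X_def by measurable
  have expand: "(X k h)\<^sup>2 = (\<Sum>i\<in>{k ^ 3..<Suc k ^ 3}. \<Sum>j\<in>{k ^ 3..<Suc k ^ 3}. Y i h * Y j h)" for k h
    unfolding X_def power2_eq_square by (rule sum_product)
  have intYY: "integrable (stick_law \<alpha> \<theta>) (\<lambda>h. Y i h * Y j h)" for i j
    using Y(2)[of i] Y(5)[of i j] by (cases "i = j") (auto simp: power2_eq_square)
  have intX: "integrable (stick_law \<alpha> \<theta>) (\<lambda>h. (X k h)\<^sup>2)" for k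
    unfolding expand by (intro Bochner_Integration.integrable_sum intYY)
  have varX: "(\<integral>h. (X k h)\<^sup>2 \<partial>stick_law \<alpha> \<theta>) \<le> 112 * C / real (Suc k) ^ 4" for k
  proof -
    let ?I = "{k ^ 3..<Suc k ^ 3}"
    have "(\<integral>h. (X k h)\<^sup>2 \<partial>stick_law \<alpha> \<theta>) = (\<Sum>i\<in>?I. \<Sum>j\<in>?I. (\<integral>h. Y i h * Y j h \<partial>stick_law \<alpha> \<theta>))"
      unfolding expand using intYY by (simp del: power_Suc)
    also have "\<dots> = (\<Sum>i\<in>?I. \<Sum>j\<in>?I. if j = i then (\<integral>h. (Y i h)\<^sup>2 \<partial>stick_law \<alpha> \<theta>) else 0)"
      by (intro sum.cong refl) (auto simp: power2_eq_square Y(6))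
    also have "\<dots> = (\<Sum>i\<in>?I. (\<integral>h. (Y i h)\<^sup>2 \<partial>stick_law \<alpha> \<theta>))"
      by (intro sum.cong refl) (simp del: power_Suc)
    also have "\<dots> \<le> (\<Sum>i\<in>?I. 16 * C / real (Suc k) ^ 6)"
    proof (intro sum_mono)
      fix i assume i: "i \<in> ?I"
      have "real (Suc k) ^ 3 \<le> 4 * real (Suc i)"
      proof -
        \<comment> \<open>this product is \<open>4 (k\<^sup>3 + 1) - (k + 1)\<^sup>3\<close>\<close>
        have "0 \<le> 3 * (real k - 1)\<^sup>2 * (real k + 1)" by simp
        then have "real (Suc k) ^ 3 \<le> 4 * (real k ^ 3 + 1)"
          by (simp add: power2_eq_square power3_eq_cube algebra_simps)
        also have "real k ^ 3 \<le> real i" using i by (simp flip: of_nat_power)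
        finally show ?thesis by simp
      qed
      then have "(real (Suc k) ^ 3)\<^sup>2 \<le> (4 * real (Suc i))\<^sup>2" by (intro power_mono) auto
      then have "real (Suc k) ^ 6 \<le> 16 * (real (Suc i))\<^sup>2"
        by (simp add: power_mult_distrib power_mult[symmetric] del: of_nat_Suc)
      then have "16 * C / (16 * (real (Suc i))\<^sup>2) \<le> 16 * C / real (Suc k) ^ 6"
        using C(1) by (intro divide_left_mono mult_pos_pos) auto
      with var[of i] show "(\<integral>h. (Y i h)\<^sup>2 \<partial>stick_law \<alpha> \<theta>) \<le> 16 * C / real (Suc k) ^ 6" by simp
    qed
    also have "\<dots> = real (card ?I) * (16 * C / real (Suc k) ^ 6)" by simp
    also have "\<dots> \<le> (7 * (real (Suc k))\<^sup>2) * (16 * C / real (Suc k) ^ 6)"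
    proof (intro mult_right_mono)
      have "k ^ 3 \<le> Suc k ^ 3" by (intro power_mono) auto
      then have "real (card ?I) = real (Suc k) ^ 3 - real k ^ 3" by (simp add: of_nat_diff del: power_Suc of_nat_Suc)
      also have "\<dots> \<le> 7 * (real (Suc k))\<^sup>2" by (simp add: power2_eq_square power3_eq_cube algebra_simps)
      finally show "real (card ?I) \<le> 7 * (real (Suc k))\<^sup>2" .
    qed (use C in simp)
    also have "\<dots> = 112 * C / real (Suc k) ^ 4"
    proof -
      have "(real (Suc k))\<^sup>2 / real (Suc k) ^ 6 = (real (Suc k))\<^sup>2 / (real (Suc k) ^ 4 * (real (Suc k))\<^sup>2)"
        by (simp only: power_add[symmetric]) simp
      also have "\<dots> = 1 / real (Suc k) ^ 4" by (rule nonzero_divide_mult_cancel_right) simp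
      finally have e: "(real (Suc k))\<^sup>2 / real (Suc k) ^ 6 = 1 / real (Suc k) ^ 4" .
      have "(7 * (real (Suc k))\<^sup>2) * (16 * C / real (Suc k) ^ 6) = 112 * C * ((real (Suc k))\<^sup>2 / real (Suc k) ^ 6)"
        by (simp only: times_divide_eq_right times_divide_eq_left mult_ac) simp
      then show ?thesis unfolding e by simp
    qed
    finally show ?thesis .
  qed
  have "AE h in stick_law \<alpha> \<theta>. summable (\<lambda>k. \<bar>X k h\<bar>)"
  proof (rule AE_summable_if_summable_integrals[where a = "\<lambda>k. (112 * C + 1) / (real (Suc k))\<^sup>2"])
    fix k
    let ?s = "real (Suc k)"
    \<comment> \<open>weights that make both terms of the same order \<open>1 / k\<^sup>2\<close> in the mean\<close>
    have amgm: "\<bar>X k h\<bar> \<le> ?s\<^sup>2 * (X k h)\<^sup>2 + 1 / ?s\<^sup>2" for h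
    proof -
      have "0 \<le> (?s * \<bar>X k h\<bar> - 1 / ?s)\<^sup>2" by simp
      also have "\<dots> = ?s\<^sup>2 * (X k h)\<^sup>2 + 1 / ?s\<^sup>2 - 2 * \<bar>X k h\<bar>"
        by (simp add: power2_diff power_mult_distrib power_divide del: of_nat_Suc)
      finally show ?thesis by linarith
    qed
    have "(\<integral>\<^sup>+h. ennreal \<bar>X k h\<bar> \<partial>stick_law \<alpha> \<theta>) \<le> (\<integral>\<^sup>+h. ennreal (?s\<^sup>2 * (X k h)\<^sup>2 + 1 / ?s\<^sup>2) \<partial>stick_law \<alpha> \<theta>)"
      by (intro nn_integral_mono ennreal_leI amgm)
    also have "\<dots> = ennreal (\<integral>h. ?s\<^sup>2 * (X k h)\<^sup>2 + 1 / ?s\<^sup>2 \<partial>stick_law \<alpha> \<theta>)"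
      by (intro nn_integral_eq_integral) (auto intro!: intX)
    also have "(\<integral>h. ?s\<^sup>2 * (X k h)\<^sup>2 + 1 / ?s\<^sup>2 \<partial>stick_law \<alpha> \<theta>) = ?s\<^sup>2 * (\<integral>h. (X k h)\<^sup>2 \<partial>stick_law \<alpha> \<theta>) + 1 / ?s\<^sup>2"
      using intX by (simp add: prob_space del: of_nat_Suc)
    also have "\<dots> \<le> ?s\<^sup>2 * (112 * C / ?s ^ 4) + 1 / ?s\<^sup>2"
      by (intro add_mono mult_left_mono varX) auto
    also have "\<dots> = (112 * C + 1) / ?s\<^sup>2"
    proof -
      have "?s\<^sup>2 / ?s ^ 4 = ?s\<^sup>2 / (?s\<^sup>2 * ?s\<^sup>2)"
        by (simp only: power_add[symmetric]) simp
      also have "\<dots> = 1 / ?s\<^sup>2" by (rule nonzero_divide_mult_cancel_right) simp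
      finally have e: "?s\<^sup>2 / ?s ^ 4 = 1 / ?s\<^sup>2" .
      have "?s\<^sup>2 * (112 * C / ?s ^ 4) = 112 * C * (?s\<^sup>2 / ?s ^ 4)"
        by (simp only: times_divide_eq_right mult_ac)
      then show ?thesis unfolding e by (simp add: add_divide_distrib del: of_nat_Suc)
    qed
    finally show "(\<integral>\<^sup>+h. ennreal \<bar>X k h\<bar> \<partial>stick_law \<alpha> \<theta>) \<le> ennreal ((112 * C + 1) / ?s\<^sup>2)"
      by (simp add: ennreal_leI)
  qed (use C in \<open>auto intro!: summable_inverse_squares_Suc simp del: of_nat_Suc\<close>)
  then show ?thesis
  proof eventually_elim
    case (elim h)
    have "(\<Sum>k<K. X k h) = (\<Sum>j<K ^ 3. Y j h)" for K
    proof (induction K)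
      case (Suc K)
      have "{..<Suc K ^ 3} = {..<K ^ 3} \<union> {K ^ 3..<Suc K ^ 3}"
        using power_mono[of K "Suc K" 3] by (intro ivl_disj_un_one(2)[symmetric]) auto
      then have "(\<Sum>j<Suc K ^ 3. Y j h) = (\<Sum>j<K ^ 3. Y j h) + X K h"
        unfolding X_def by (simp add: sum.union_disjoint ivl_disj_int del: power_Suc)
      with Suc show ?case by (simp del: power_Suc)
    qed simp
    with summable_rabs_cancel[OF elim] show ?case
      by (simp add: summable_iff_convergent Y_def)
  qed
qed

end

lemma surrogate_term_mean:
  assumes \<alpha>: "0 < \<alpha>" "\<alpha> < 1" and \<theta>: "\<theta> > - \<alpha>" and j: "1 \<le> j" and \<mu>: "0 \<le> \<mu>"
  shows "(\<integral>\<^sup>+h. ennreal (surrogate_term \<alpha> \<theta> h \<mu> j) \<partial>stick_law \<alpha> \<theta>)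
    = ennreal (1 - (1 + \<mu> * real j powr - (1 / \<alpha>)) powr - (1 - \<alpha>))"
proof -
  note p = stick_params[OF \<alpha> \<theta> j]
  show ?thesis unfolding surrogate_term_def
    using beta_power_complement_expectation[OF p(1,2), of "\<mu> * real j powr - (1 / \<alpha>)"] \<mu> j unfolding p(3)
    by (subst nn_integral_stick[OF \<alpha> \<theta> j, of "\<lambda>x. ennreal (1 - (1 + \<mu> * real j powr - (1 / \<alpha>) * x) powr - gem_shape \<alpha> \<theta> j)"]) auto
qed

lemma borel_measurable_surrogate_term[measurable]:
  "1 \<le> j \<Longrightarrow> (\<lambda>h. surrogate_term \<alpha> \<theta> h \<mu> j) \<in> borel_measurable (stick_law \<alpha> \<theta>)"
  unfolding surrogate_term_def by measurable

lemma borel_measurable_surrogate_count[measurable]: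
  "(\<lambda>h. surrogate_count \<alpha> \<theta> h \<mu>) \<in> borel_measurable (stick_law \<alpha> \<theta>)"
  unfolding surrogate_count_def by measurable

text \<open>The strong law applies with the constant centring \<open>Q\<^sub>n\<close>, the expectation of the count, which
  \<open>expected_occupancy_sum\<close> locates between \<open>(1 + n) powr \<alpha> - 1\<close> and \<open>n powr \<alpha>\<close>.\<close>
lemma AE_surrogate_count:
  assumes \<alpha>: "0 < \<alpha>" "\<alpha> < 1" and \<theta>: "\<theta> > - \<alpha>"
  shows "AE h in stick_law \<alpha> \<theta>. (\<forall>n. summable (\<lambda>j. surrogate_term \<alpha> \<theta> h (real n) (Suc j))) \<and>
    (\<lambda>n. surrogate_count \<alpha> \<theta> h (real n) / real n powr \<alpha>) \<longlonglongrightarrow> 1"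
proof -
  interpret prob_space "stick_law \<alpha> \<theta>" by (rule prob_space_stick_law[OF \<alpha> \<theta>])
  define q where "q n j = 1 - (1 + real n * real (Suc j) powr - (1 / \<alpha>)) powr - (1 - \<alpha>)" for n j
  define Q where "Q n = (\<Sum>j. q n j)" for n
  have q01: "0 \<le> q n j" for n j
    unfolding q_def using \<alpha> powr_mono2'[of "-(1 - \<alpha>)" 1 "1 + real n * real (Suc j) powr - (1 / \<alpha>)"] by auto
  have q_sum: "summable (q n)" "(1 + real n) powr \<alpha> - 1 \<le> Q n" "Q n \<le> real n powr \<alpha>" if "1 \<le> n" for n
    using expected_occupancy_sum[OF \<alpha>, of "real n"] that unfolding q_def Q_def by auto
  have Qpos: "0 < Q n" if "1 \<le> n" for n
  proof -
    have "1 powr \<alpha> < (1 + real n) powr \<alpha>" using that \<alpha> by (intro powr_less_mono2) auto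
    then show ?thesis using q_sum(2)[OF that] by simp
  qed
  have mean: "(\<integral>\<^sup>+h. ennreal (surrogate_term \<alpha> \<theta> h (real n) (Suc j)) \<partial>stick_law \<alpha> \<theta>) = ennreal (q n j)" for n j
    unfolding q_def by (rule surrogate_term_mean[OF \<alpha> \<theta>]) auto
  have bounds: "AE h in stick_law \<alpha> \<theta>. 0 \<le> surrogate_term \<alpha> \<theta> h (real n) (Suc j) \<and> surrogate_term \<alpha> \<theta> h (real n) (Suc j) \<le> 1" for n j
    using AE_sticks_in_unit_interval[OF \<alpha> \<theta>]
  proof eventually_elim
    case (elim h)
    then have "0 \<le> h (Suc j)" by (auto simp: less_imp_le)
    then show ?case using surrogate_term_bounds[OF \<alpha> \<theta>, of h "Suc j" "real n"] by auto
  qed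
  have summ: "AE h in stick_law \<alpha> \<theta>. summable (\<lambda>j. surrogate_term \<alpha> \<theta> h (real n) (Suc j))" for n
  proof (cases "n = 0")
    case False
    then show ?thesis
      by (intro AE_summable_if_summable_integrals[where a = "q n"]) (use mean bounds q_sum q01 in auto)
  qed (simp add: surrogate_term_def)
  have all_summ: "AE h in stick_law \<alpha> \<theta>. \<forall>n. summable (\<lambda>j. surrogate_term \<alpha> \<theta> h (real n) (Suc j))"
    unfolding AE_all_countable using summ by blast
  have chi: "(\<integral>\<^sup>+h. ennreal ((surrogate_count \<alpha> \<theta> h (real n) - Q n)\<^sup>2 / Q n) \<partial>stick_law \<alpha> \<theta>) \<le> 1" if n: "1 \<le> n" for n
    unfolding surrogate_count_def Q_def
  proof (rule chi_square_count_bound[OF prob_space_stick_law[OF \<alpha> \<theta>], where q = "\<lambda>j _. q n j" and I = "\<lambda>j h. surrogate_term \<alpha> \<theta> h (real n) (Suc j)"],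
      fold Q_def)
    have scale: "(\<integral>\<^sup>+h. ennreal (f h / Q n) \<partial>stick_law \<alpha> \<theta>) = ennreal (1 / Q n) * (\<integral>\<^sup>+h. ennreal (f h) \<partial>stick_law \<alpha> \<theta>)"
      if "f \<in> borel_measurable (stick_law \<alpha> \<theta>)" for f
      using that Qpos[OF n] by (subst nn_integral_cmult[symmetric]) (auto simp: ennreal_mult'[symmetric])
    show "(\<integral>\<^sup>+h. ennreal (surrogate_term \<alpha> \<theta> h (real n) (Suc j) / Q n) \<partial>stick_law \<alpha> \<theta>) = (\<integral>\<^sup>+h. ennreal (q n j / Q n) \<partial>stick_law \<alpha> \<theta>)" for j
      using Qpos[OF n] by (subst scale) (auto simp: mean emeasure_space_1 ennreal_mult'[symmetric])
    fix i j :: nat assume ij: "i \<noteq> j"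
    have "(\<integral>\<^sup>+h. ennreal (surrogate_term \<alpha> \<theta> h (real n) (Suc i) * surrogate_term \<alpha> \<theta> h (real n) (Suc j)) \<partial>stick_law \<alpha> \<theta>)
        = (\<integral>\<^sup>+h. ennreal (surrogate_term \<alpha> \<theta> h (real n) (Suc i)) * ennreal (surrogate_term \<alpha> \<theta> h (real n) (Suc j)) \<partial>stick_law \<alpha> \<theta>)"
      by (intro nn_integral_cong_AE, use bounds[of n i] in eventually_elim) (simp add: ennreal_mult')
    also have "\<dots> = ennreal (q n i) * ennreal (q n j)"
      unfolding mean[symmetric] unfolding surrogate_term_def
      using ij by (intro nn_integral_two_sticks[OF \<alpha> \<theta>,
          of "Suc i" "Suc j" "\<lambda>x. ennreal (1 - (1 + real n * real (Suc i) powr - (1 / \<alpha>) * x) powr - gem_shape \<alpha> \<theta> (Suc i))"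
             "\<lambda>x. ennreal (1 - (1 + real n * real (Suc j) powr - (1 / \<alpha>) * x) powr - gem_shape \<alpha> \<theta> (Suc j))"]) auto
    finally have "(\<integral>\<^sup>+h. ennreal (surrogate_term \<alpha> \<theta> h (real n) (Suc i) * surrogate_term \<alpha> \<theta> h (real n) (Suc j) / Q n) \<partial>stick_law \<alpha> \<theta>)
        = ennreal (1 / Q n) * (ennreal (q n i) * ennreal (q n j))"
      by (subst scale) auto
    also have "\<dots> = (\<integral>\<^sup>+h. ennreal (q n i * q n j / Q n) \<partial>stick_law \<alpha> \<theta>)"
      using Qpos[OF n] q01 by (simp add: emeasure_space_1 ennreal_mult'[symmetric])
    finally show "(\<integral>\<^sup>+h. ennreal (surrogate_term \<alpha> \<theta> h (real n) (Suc i) * surrogate_term \<alpha> \<theta> h (real n) (Suc j) / Q n) \<partial>stick_law \<alpha> \<theta>)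
        \<le> (\<integral>\<^sup>+h. ennreal (q n i * q n j / Q n) \<partial>stick_law \<alpha> \<theta>)" by simp
  qed (use bounds summ mean q01 q_sum[OF n] Qpos[OF n] in \<open>auto simp: emeasure_space_1\<close>)
  have Qlim: "(\<lambda>n. Q n / real n powr \<alpha>) \<longlonglongrightarrow> 1"
  proof (rule tendsto_sandwich[OF _ _ _ tendsto_const])
    have "(\<lambda>n. 1 - real n powr - \<alpha>) \<longlonglongrightarrow> 1 - 0"
      using \<alpha> by (intro tendsto_intros tendsto_neg_powr filterlim_real_sequentially) auto
    then show "(\<lambda>n. 1 - real n powr - \<alpha>) \<longlonglongrightarrow> 1" by simp
    show "\<forall>\<^sub>F n in sequentially. 1 - real n powr - \<alpha> \<le> Q n / real n powr \<alpha>"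
      using eventually_ge_at_top[of 1]
    proof eventually_elim
      case (elim n)
      have "real n powr \<alpha> - 1 \<le> (1 + real n) powr \<alpha> - 1" using \<alpha> by (intro diff_right_mono powr_mono2) auto
      then have "(real n powr \<alpha> - 1) / real n powr \<alpha> \<le> Q n / real n powr \<alpha>"
        using q_sum(2)[OF elim] by (intro divide_right_mono) auto
      then show ?case using elim by (simp add: diff_divide_distrib powr_minus_divide)
    qed
    show "\<forall>\<^sub>F n in sequentially. Q n / real n powr \<alpha> \<le> 1"
      using eventually_ge_at_top[of 1] by eventually_elim (use q_sum(3) in \<open>simp add: divide_le_eq\<close>)
  qed
  have "AE h in stick_law \<alpha> \<theta>. (\<lambda>n. surrogate_count \<alpha> \<theta> h (real n) / real n powr \<alpha>) \<longlonglongrightarrow> 1"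
  proof (rule LLN_along_powers[where Q = "\<lambda>n _. Q n" and \<alpha> = \<alpha>])
    show "AE h in stick_law \<alpha> \<theta>. mono (\<lambda>n. surrogate_count \<alpha> \<theta> h (real n)) \<and> (\<forall>n. 0 \<le> surrogate_count \<alpha> \<theta> h (real n))"
      using all_summ AE_sticks_in_unit_interval[OF \<alpha> \<theta>]
    proof eventually_elim
      case (elim h)
      have h: "0 \<le> h (Suc j)" for j using elim(2) by (auto simp: less_imp_le)
      show ?case unfolding surrogate_count_def
        using elim(1) h
        by (intro conjI monoI allI suminf_le surrogate_term_mono[OF \<alpha> \<theta>] suminf_nonneg surrogate_term_bounds[OF \<alpha> \<theta>]) auto
    qed
  qed (use \<alpha> Qpos Qlim chi in auto)
  with all_summ show ?thesis by eventually_elim blast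
qed

lemma AE_stick_breaking_regular:
  assumes \<alpha>: "0 < \<alpha>" "\<alpha> < 1" and \<theta>: "\<theta> > - \<alpha>"
  shows "AE h in stick_law \<alpha> \<theta>. (\<forall>j\<ge>1. 0 < h j \<and> h j < 1) \<and>
    (\<exists>c>0. (\<lambda>k. stick_remainder h k * real k powr ((1 - \<alpha>) / \<alpha>)) \<longlonglongrightarrow> c \<and>
      (\<lambda>n. expected_count (stick_breaking h) n / real n powr \<alpha>) \<longlonglongrightarrow> (c / \<alpha>) powr \<alpha>)"
  using AE_sticks_in_unit_interval[OF assms] AE_summable_square_sticks[OF assms]
    AE_centred_sticks_converge[OF assms] AE_surrogate_count[OF assms]
proof eventually_elim
  case (elim h)
  have h: "0 < h j \<and> h j < 1" if "1 \<le> j" for j using elim(1) that by blast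
  obtain c where c: "0 < c" "(\<lambda>k. stick_remainder h k * real k powr ((1 - \<alpha>) / \<alpha>)) \<longlonglongrightarrow> c"
    using stick_remainder_regular[OF assms h elim(2,3)] by blast
  have "(\<lambda>j. h (Suc j)) \<longlonglongrightarrow> 0"
    using tendsto_real_sqrt[OF summable_LIMSEQ_zero[OF elim(2)]] h
    by (simp add: less_imp_le abs_of_pos)
  with c h elim(4) have "(\<lambda>n. expected_count (stick_breaking h) n / real n powr \<alpha>) \<longlonglongrightarrow> (c / \<alpha>) powr \<alpha>"
    by (intro expected_count_asymp[OF assms]) auto
  with c elim(1) show ?case by blast
qed

section \<open>Regular frequencies\<close>

text \<open>The almost sure properties of the sticks are now restated as a property of the frequencies alone,
  because a sample comes with random frequencies of the right law but without sticks. The constant \<open>C\<close> is named as a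
  limit, rather than quantified existentially, so that the property defines a measurable set and can be transferred
  between spaces.\<close>
definition tail_mass :: "(nat \<Rightarrow> real) \<Rightarrow> nat \<Rightarrow> real" where
  "tail_mass p k = 1 - (\<Sum>j<k. p (Suc j))"

definition tail_constant :: "real \<Rightarrow> (nat \<Rightarrow> real) \<Rightarrow> real" where
  "tail_constant \<alpha> p = lim (\<lambda>k. tail_mass p k * real k powr ((1 - \<alpha>) / \<alpha>))"

definition regular_frequencies :: "real \<Rightarrow> (nat \<Rightarrow> real) \<Rightarrow> bool" where
  "regular_frequencies \<alpha> p \<longleftrightarrow> (\<forall>j. 0 < p (Suc j)) \<and> tail_mass p \<longlonglongrightarrow> 0 \<and> 0 < tail_constant \<alpha> p \<and>
    (\<lambda>k. tail_mass p k * real k powr ((1 - \<alpha>) / \<alpha>)) \<longlonglongrightarrow> tail_constant \<alpha> p \<and>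
    (\<lambda>n. expected_count p n / real n powr \<alpha>) \<longlonglongrightarrow> (tail_constant \<alpha> p / \<alpha>) powr \<alpha>"

lemma measurable_tail_mass[measurable]: "(\<lambda>p. tail_mass p k) \<in> borel_measurable seq_space"
  unfolding tail_mass_def by measurable

lemma measurable_tail_constant[measurable]: "tail_constant \<alpha> \<in> borel_measurable seq_space"
  unfolding tail_constant_def by measurable

lemma measurable_expected_count[measurable]: "(\<lambda>p. expected_count p n) \<in> borel_measurable seq_space"
  unfolding expected_count_def by measurable

lemma measurable_regular_frequencies: "{p \<in> space seq_space. regular_frequencies \<alpha> p} \<in> sets seq_space"
proof -
  have tendsto_iff_countable: "(f \<longlonglongrightarrow> l) \<longleftrightarrow> (\<forall>r::nat. \<exists>N::nat. \<forall>n\<ge>N. \<bar>f n - l\<bar> < inverse (real (Suc r)))"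
    for f :: "nat \<Rightarrow> real" and l
  proof
    assume "f \<longlonglongrightarrow> l"
    then show "\<forall>r::nat. \<exists>N::nat. \<forall>n\<ge>N. \<bar>f n - l\<bar> < inverse (real (Suc r))"
      unfolding lim_sequentially dist_real_def by (simp del: of_nat_Suc)
  next
    assume *: "\<forall>r::nat. \<exists>N::nat. \<forall>n\<ge>N. \<bar>f n - l\<bar> < inverse (real (Suc r))"
    show "f \<longlonglongrightarrow> l"
      unfolding lim_sequentially dist_real_def
    proof (intro allI impI)
      fix e :: real assume "0 < e"
      then obtain r where r: "inverse (real (Suc r)) < e" using reals_Archimedean by blast
      from * obtain N where "\<forall>n\<ge>N. \<bar>f n - l\<bar> < inverse (real (Suc r))" by blast
      with r show "\<exists>N. \<forall>n\<ge>N. \<bar>f n - l\<bar> < e" by (meson less_trans)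
    qed
  qed
  show ?thesis unfolding regular_frequencies_def tendsto_iff_countable by measurable
qed

lemma AE_GEM_regular:
  assumes \<alpha>: "0 < \<alpha>" "\<alpha> < 1" and \<theta>: "\<theta> > - \<alpha>"
  shows "AE p in GEM \<alpha> \<theta>. regular_frequencies \<alpha> p"
proof -
  have meas: "stick_breaking \<in> measurable (stick_law \<alpha> \<theta>) seq_space"
    unfolding stick_breaking_def by measurable
  have "AE h in stick_law \<alpha> \<theta>. regular_frequencies \<alpha> (stick_breaking h)"
    using AE_stick_breaking_regular[OF assms]
  proof eventually_elim
    case (elim h)
    then obtain c where c: "0 < c" "(\<lambda>k. stick_remainder h k * real k powr ((1 - \<alpha>) / \<alpha>)) \<longlonglongrightarrow> c"
      "(\<lambda>n. expected_count (stick_breaking h) n / real n powr \<alpha>) \<longlonglongrightarrow> (c / \<alpha>) powr \<alpha>" by blast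
    have t: "tail_mass (stick_breaking h) = stick_remainder h"
      by (rule ext) (simp add: tail_mass_def sum_stick_breaking)
    have tc: "tail_constant \<alpha> (stick_breaking h) = c"
      unfolding tail_constant_def t by (rule limI) (rule c)
    have "0 < stick_breaking h (Suc j)" for j
      using elim stick_remainder_bounds(1)[of h j] by (simp add: stick_breaking_Suc)
    moreover have "(\<lambda>k. stick_remainder h k) \<longlonglongrightarrow> 0"
    proof -
      have "(\<lambda>k. stick_remainder h k * real k powr ((1 - \<alpha>) / \<alpha>) * real k powr - ((1 - \<alpha>) / \<alpha>)) \<longlonglongrightarrow> c * 0"
        using \<alpha> by (intro tendsto_mult c tendsto_neg_powr filterlim_real_sequentially) auto
      then have "(\<lambda>k. stick_remainder h k * real k powr ((1 - \<alpha>) / \<alpha>) * real k powr - ((1 - \<alpha>) / \<alpha>)) \<longlonglongrightarrow> 0" by simp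
      then show ?thesis
        by (rule Lim_transform_eventually)
           (use eventually_gt_at_top[of 0] in eventually_elim, simp add: powr_minus field_simps)
    qed
    ultimately show ?case using c by (simp add: regular_frequencies_def t tc)
  qed
  then show ?thesis unfolding GEM_def stick_law_def[symmetric]
    by (subst AE_distr_iff[OF meas measurable_regular_frequencies])
qed

lemma regular_frequenciesD:
  assumes "regular_frequencies \<alpha> p"
  shows "(\<lambda>j. p (Suc j)) sums 1" "0 < p (Suc j)" "p (Suc j) \<le> 1"
    and "summable (\<lambda>j. 1 - (1 - p (Suc j)) ^ n)" "1 \<le> n \<Longrightarrow> 1 \<le> expected_count p n" "expected_count p n \<le> real n"
proof -
  have pos: "0 < p (Suc j)" for j using assms by (auto simp: regular_frequencies_def)
  then show "0 < p (Suc j)" .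
  have "tail_mass p \<longlonglongrightarrow> 0" using assms by (auto simp: regular_frequencies_def)
  from tendsto_diff[OF tendsto_const[of 1] this]
  show s: "(\<lambda>j. p (Suc j)) sums 1" unfolding sums_def by (simp add: tail_mass_def)
  have le: "p (Suc j) \<le> 1" for j
    using suminf_outside_finite(2)[OF s, of "{j}"] pos by (simp add: less_imp_le)
  then show "p (Suc j) \<le> 1" .
  note ob = occupancy_bounds[OF less_imp_le[OF pos] le]
  show summ: "summable (\<lambda>j. 1 - (1 - p (Suc j)) ^ n)" for n
    by (rule summable_comparison_test'[OF summable_mult[OF sums_summable[OF s], of "real n"], where N = 0]) (use ob in auto)
  show "expected_count p n \<le> real n"
  proof -
    have "expected_count p n \<le> (\<Sum>j. real n * p (Suc j))"
      unfolding expected_count_def by (intro suminf_le summ summable_mult sums_summable[OF s] ob)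
    also have "\<dots> = real n" using sums_unique[OF sums_mult[OF s, of "real n"]] by simp
    finally show ?thesis .
  qed
  assume n: "1 \<le> n"
  have "1 = (\<Sum>j. p (Suc j))" by (rule sums_unique[OF s])
  also have "\<dots> \<le> expected_count p n"
    unfolding expected_count_def by (intro suminf_le summ sums_summable[OF s] ob n)
  finally show "1 \<le> expected_count p n" .
qed

lemma tail_mass_bounds:
  assumes "regular_frequencies \<alpha> p"
  shows "0 \<le> tail_mass p k" "tail_mass p k \<le> 1"
proof -
  note nonneg = less_imp_le[OF regular_frequenciesD(2)[OF assms]]
  show "0 \<le> tail_mass p k"
    using suminf_outside_finite(2)[OF regular_frequenciesD(1)[OF assms] nonneg, of "{..<k}"]
    by (simp add: tail_mass_def)
  show "tail_mass p k \<le> 1"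
    unfolding tail_mass_def using nonneg by (simp add: sum_nonneg)
qed

section \<open>Sampling from regular frequencies\<close>

text \<open>Induction on the number of observations that are only required to lie in \<open>S\<close>: releasing one more of
  them means summing over its value.\<close>
lemma nn_integral_all_in_set:
  fixes Z :: "nat \<Rightarrow> 'a \<Rightarrow> nat" and p :: "'a \<Rightarrow> nat \<Rightarrow> ennreal" and g :: "'a \<Rightarrow> ennreal"
  assumes [measurable]: "\<And>i. Z i \<in> measurable M (count_space UNIV)" "\<And>j. (\<lambda>\<omega>. p \<omega> j) \<in> borel_measurable M"
      "g \<in> borel_measurable M"
    and fdd: "\<And>n b. (\<integral>\<^sup>+\<omega>. g \<omega> * (if \<forall>i<n. Z i \<omega> = b i then 1 else 0) \<partial>M) = (\<integral>\<^sup>+\<omega>. g \<omega> * (\<Prod>i<n. p \<omega> (b i)) \<partial>M)"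
  shows "(\<integral>\<^sup>+\<omega>. g \<omega> * (if \<forall>i<n. Z i \<omega> \<in> S then 1 else 0) \<partial>M)
    = (\<integral>\<^sup>+\<omega>. g \<omega> * (\<Sum>j. if j \<in> S then p \<omega> j else 0) ^ n \<partial>M)"
proof -
  define \<mu> where "\<mu> \<omega> = (\<Sum>j. if j \<in> S then p \<omega> j else 0)" for \<omega>
  have [measurable]: "\<mu> \<in> borel_measurable M" unfolding \<mu>_def by measurable
  have "(\<integral>\<^sup>+\<omega>. g \<omega> * (if (\<forall>i<n. Z i \<omega> = b i) \<and> (\<forall>i\<in>{n..<n + m}. Z i \<omega> \<in> S) then 1 else 0) \<partial>M)
    = (\<integral>\<^sup>+\<omega>. g \<omega> * (\<Prod>i<n. p \<omega> (b i)) * \<mu> \<omega> ^ m \<partial>M)" for n m b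
  proof (induction m arbitrary: n b)
    case 0
    then show ?case using fdd[of n b] by simp
  next
    case (Suc m)
    let ?e = "\<lambda>n b \<omega>. if (\<forall>i<n. Z i \<omega> = b i) \<and> (\<forall>i\<in>{n..<n + m}. Z i \<omega> \<in> S) then 1 else 0 :: ennreal"
    have split: "(if (\<forall>i<n. Z i \<omega> = b i) \<and> (\<forall>i\<in>{n..<n + Suc m}. Z i \<omega> \<in> S) then 1 else 0)
        = (\<Sum>j. if j \<in> S then ?e (Suc n) (b(n := j)) \<omega> else 0)" for \<omega>
    proof -
      have "(\<Sum>j. if j \<in> S then ?e (Suc n) (b(n := j)) \<omega> else 0)
          = (\<Sum>j\<in>{Z n \<omega>}. if j \<in> S then ?e (Suc n) (b(n := j)) \<omega> else 0)"
        by (intro suminf_finite) auto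
      also have "\<dots> = (if Z n \<omega> \<in> S then ?e (Suc n) (b(n := Z n \<omega>)) \<omega> else 0)" by simp
      also have "\<dots> = (if (\<forall>i<n. Z i \<omega> = b i) \<and> (\<forall>i\<in>{n..<n + Suc m}. Z i \<omega> \<in> S) then 1 else 0)"
      proof -
        have "{n..<n + Suc m} = insert n {Suc n..<Suc n + m}" by auto
        moreover have "(\<forall>i<Suc n. Z i \<omega> = (b(n := Z n \<omega>)) i) \<longleftrightarrow> (\<forall>i<n. Z i \<omega> = b i)"
          by (auto simp: less_Suc_eq)
        ultimately show ?thesis by auto
      qed
      finally show ?thesis ..
    qed
    have "(\<integral>\<^sup>+\<omega>. g \<omega> * (if (\<forall>i<n. Z i \<omega> = b i) \<and> (\<forall>i\<in>{n..<n + Suc m}. Z i \<omega> \<in> S) then 1 else 0) \<partial>M)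
        = (\<integral>\<^sup>+\<omega>. (\<Sum>j. g \<omega> * (if j \<in> S then ?e (Suc n) (b(n := j)) \<omega> else 0)) \<partial>M)"
      unfolding split by (simp del: ennreal_suminf_cmult add: ennreal_suminf_cmult[symmetric])
    also have "\<dots> = (\<Sum>j. \<integral>\<^sup>+\<omega>. g \<omega> * (if j \<in> S then ?e (Suc n) (b(n := j)) \<omega> else 0) \<partial>M)"
      by (rule nn_integral_suminf) measurable
    also have "\<dots> = (\<Sum>j. \<integral>\<^sup>+\<omega>. g \<omega> * (\<Prod>i<n. p \<omega> (b i)) * \<mu> \<omega> ^ m * (if j \<in> S then p \<omega> j else 0) \<partial>M)"
    proof (intro suminf_cong)
      fix j
      show "(\<integral>\<^sup>+\<omega>. g \<omega> * (if j \<in> S then ?e (Suc n) (b(n := j)) \<omega> else 0) \<partial>M)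
        = (\<integral>\<^sup>+\<omega>. g \<omega> * (\<Prod>i<n. p \<omega> (b i)) * \<mu> \<omega> ^ m * (if j \<in> S then p \<omega> j else 0) \<partial>M)"
      proof (cases "j \<in> S")
        case True
        have "(\<Prod>i<n. p \<omega> ((b(n := j)) i)) = (\<Prod>i<n. p \<omega> (b i))" for \<omega>
          by (intro prod.cong) auto
        then show ?thesis using Suc.IH[of "Suc n" "b(n := j)"] True
          by (simp add: mult_ac del: fun_upd_apply) (simp add: mult_ac)
      qed simp
    qed
    also have "\<dots> = (\<integral>\<^sup>+\<omega>. (\<Sum>j. g \<omega> * (\<Prod>i<n. p \<omega> (b i)) * \<mu> \<omega> ^ m * (if j \<in> S then p \<omega> j else 0)) \<partial>M)"
      by (rule nn_integral_suminf[symmetric]) measurable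
    also have "\<dots> = (\<integral>\<^sup>+\<omega>. g \<omega> * (\<Prod>i<n. p \<omega> (b i)) * \<mu> \<omega> ^ Suc m \<partial>M)"
      by (simp only: ennreal_suminf_cmult \<mu>_def[symmetric] power_Suc2 mult.assoc)
    finally show ?case .
  qed
  from this[where n = 0 and m = n] show ?thesis by (simp add: \<mu>_def atLeast0LessThan lessThan_def)
qed

text \<open>The defining property of the conditional expectation, tested against a bounded function of the
  frequencies.\<close>
lemma expectation_sample_equals:
  assumes "prob_space M" and sample: "sample_from M P X" and b: "\<And>i. i \<in> {1..n} \<Longrightarrow> 1 \<le> b i"
    and fm[measurable]: "f \<in> borel_measurable seq_space" and f: "\<And>p. 0 \<le> f p" "\<And>p. f p \<le> B"
    and Pnn: "AE \<omega> in M. \<forall>j. 0 \<le> P \<omega> (Suc j)"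
  shows "(\<integral>\<^sup>+\<omega>. ennreal (f (P \<omega>)) * (if \<forall>i\<in>{1..n}. X i \<omega> = b i then 1 else 0) \<partial>M)
    = (\<integral>\<^sup>+\<omega>. ennreal (f (P \<omega>)) * (\<Prod>i\<in>{1..n}. ennreal (P \<omega> (b i))) \<partial>M)"
proof -
  interpret prob_space M by fact
  have P[measurable]: "P \<in> measurable M seq_space"
    and X: "\<And>i. 1 \<le> i \<Longrightarrow> X i \<in> measurable M (count_space {1..})"
    using sample by (auto simp: sample_from_def)
  let ?F = "vimage_algebra (space M) P seq_space"
  let ?E = "{\<omega>\<in>space M. \<forall>i\<in>{1..n}. X i \<omega> = b i}"
  have sub: "subalgebra M ?F"
    unfolding subalgebra_def using sets_image_in_sets[OF refl P] by simp
  interpret finite_measure_subalgebra M ?F by unfold_locales (rule sub)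
  have E: "?E \<in> sets M"
  proof (rule sets.sets_Collect_finite_All)
    fix i assume i: "i \<in> {1..n}"
    have "X i -` {b i} \<inter> space M \<in> sets M"
      using i b[OF i] by (intro measurable_sets[OF X]) auto
    also have "X i -` {b i} \<inter> space M = {\<omega> \<in> space M. X i \<omega> = b i}" by auto
    finally show "{\<omega> \<in> space M. X i \<omega> = b i} \<in> sets M" .
  qed simp
  have fP_F: "(\<lambda>\<omega>. f (P \<omega>)) \<in> borel_measurable ?F"
    by (rule measurable_compose[OF measurable_vimage_algebra1 fm]) (use measurable_space[OF P] in blast)
  have int: "integrable M (\<lambda>\<omega>. f (P \<omega>) * indicator ?E \<omega>)"
    using f E by (intro integrable_const_bound[where B = B]) (auto simp: indicator_def intro: order_trans)
  note ce = real_cond_exp_intg[OF int fP_F borel_measurable_indicator[OF E]]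
  have ae: "AE \<omega> in M. f (P \<omega>) * real_cond_exp M ?F (indicator ?E) \<omega> = f (P \<omega>) * (\<Prod>i\<in>{1..n}. P \<omega> (b i))"
  proof -
    have "AE \<omega> in M. real_cond_exp M ?F (indicator ?E) \<omega> = (\<Prod>i\<in>{1..n}. P \<omega> (b i))"
      using sample b unfolding sample_from_def by blast
    then show ?thesis by eventually_elim simp
  qed
  have meas: "(\<lambda>\<omega>. \<Prod>i\<in>{1..n}. P \<omega> (b i)) \<in> borel_measurable M"
  proof (rule borel_measurable_prod)
    fix i assume i: "i \<in> {1..n}"
    show "(\<lambda>\<omega>. P \<omega> (b i)) \<in> borel_measurable M"
      using b[OF i] by (intro measurable_compose[OF P measurable_component_singleton]) auto
  qed
  have fP: "(\<lambda>\<omega>. f (P \<omega>)) \<in> borel_measurable M" by measurable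
  have int': "integrable M (\<lambda>\<omega>. f (P \<omega>) * (\<Prod>i\<in>{1..n}. P \<omega> (b i)))"
    using ce(1) ae meas fP by (subst integrable_cong_AE[symmetric, OF _ _ ae]) auto
  have eq: "(\<integral>\<omega>. f (P \<omega>) * indicator ?E \<omega> \<partial>M) = (\<integral>\<omega>. f (P \<omega>) * (\<Prod>i\<in>{1..n}. P \<omega> (b i)) \<partial>M)"
    unfolding ce(2)[symmetric] using ce(1) int' ae by (intro integral_cong_AE) auto
  have prod_nn: "AE \<omega> in M. 0 \<le> (\<Prod>i\<in>{1..n}. P \<omega> (b i)) \<and>
      ennreal (\<Prod>i\<in>{1..n}. P \<omega> (b i)) = (\<Prod>i\<in>{1..n}. ennreal (P \<omega> (b i)))"
    using Pnn
  proof eventually_elim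
    case (elim \<omega>)
    have nn: "0 \<le> P \<omega> (b i)" if "i \<in> {1..n}" for i
      using elim[rule_format, of "b i - 1"] b[OF that] by simp
    then show ?case by (auto intro!: prod_nonneg prod_ennreal[symmetric])
  qed
  have "(\<integral>\<^sup>+\<omega>. ennreal (f (P \<omega>)) * (if \<forall>i\<in>{1..n}. X i \<omega> = b i then 1 else 0) \<partial>M)
      = (\<integral>\<^sup>+\<omega>. ennreal (f (P \<omega>) * indicator ?E \<omega>) \<partial>M)"
    by (intro nn_integral_cong) (auto simp: indicator_def)
  also have "\<dots> = ennreal (\<integral>\<omega>. f (P \<omega>) * (\<Prod>i\<in>{1..n}. P \<omega> (b i)) \<partial>M)"
    unfolding eq[symmetric] using f by (intro nn_integral_eq_integral int) auto
  also have "\<dots> = (\<integral>\<^sup>+\<omega>. ennreal (f (P \<omega>) * (\<Prod>i\<in>{1..n}. P \<omega> (b i))) \<partial>M)"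
    using prod_nn f by (intro nn_integral_eq_integral[symmetric] int') (auto elim!: eventually_mono)
  also have "\<dots> = (\<integral>\<^sup>+\<omega>. ennreal (f (P \<omega>)) * (\<Prod>i\<in>{1..n}. ennreal (P \<omega> (b i))) \<partial>M)"
    by (rule nn_integral_cong_AE) (use prod_nn in eventually_elim, use f in \<open>auto simp: ennreal_mult\<close>)
  finally show ?thesis .
qed

text \<open>For a sample, all that matters about the GEM law is that it is carried by regular frequencies.\<close>
locale regular_sample = prob_space M for M :: "'a measure" +
  fixes P :: "'a \<Rightarrow> nat \<Rightarrow> real" and X :: "nat \<Rightarrow> 'a \<Rightarrow> nat" and \<alpha> :: real
  assumes \<alpha>: "0 < \<alpha>" "\<alpha> < 1"
    and sample: "sample_from M P X"
    and regular: "AE \<omega> in M. regular_frequencies \<alpha> (P \<omega>)"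
begin

text \<open>Observations numbered from \<open>0\<close> and with values shifted to start from \<open>0\<close>, so that they range over
  all natural numbers and the series over the values have the index set of \<open>suminf\<close>.\<close>
definition label :: "nat \<Rightarrow> 'a \<Rightarrow> nat" where "label i \<omega> = X (Suc i) \<omega> - 1"

lemma measurable_P[measurable]: "P \<in> measurable M seq_space"
  using sample by (auto simp: sample_from_def)

lemma measurable_P_coord[measurable]: "(\<lambda>\<omega>. P \<omega> (Suc j)) \<in> borel_measurable M"
  by (intro measurable_compose[OF measurable_P measurable_component_singleton]) auto

lemma X_pos: "\<omega> \<in> space M \<Longrightarrow> 1 \<le> X (Suc i) \<omega>"
  using sample measurable_space[of "X (Suc i)" M "count_space {1..}" \<omega>] by (auto simp: sample_from_def)

lemma X_eq_Suc_label: "\<omega> \<in> space M \<Longrightarrow> X (Suc i) \<omega> = Suc (label i \<omega>)"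
  using X_pos[of \<omega> i] by (simp add: label_def)

lemma measurable_label[measurable]: "label i \<in> measurable M (count_space UNIV)"
proof -
  have "X (Suc i) \<in> measurable M (count_space {1..})" using sample by (auto simp: sample_from_def)
  then have "(\<lambda>\<omega>. X (Suc i) \<omega> - 1) \<in> measurable M (count_space UNIV)"
    by (rule measurable_compose) simp
  then show ?thesis by (simp add: label_def[abs_def])
qed

lemma all_label_iff_all_X:
  "\<omega> \<in> space M \<Longrightarrow> (\<forall>i<n. label i \<omega> = b i) \<longleftrightarrow> (\<forall>i\<in>{1..n}. X i \<omega> = Suc (b (i - 1)))"
proof (intro iffI ballI allI impI)
  assume \<omega>: "\<omega> \<in> space M"
  { fix i assume "\<forall>i<n. label i \<omega> = b i" "i \<in> {1..n}"
    then show "X i \<omega> = Suc (b (i - 1))" using X_eq_Suc_label[OF \<omega>, of "i - 1"] by auto }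
  { fix i assume "\<forall>i\<in>{1..n}. X i \<omega> = Suc (b (i - 1))" "i < n"
    then show "label i \<omega> = b i" by (auto simp: label_def) }
qed

lemma expectation_sample_avoids:
  assumes fm[measurable]: "f \<in> borel_measurable seq_space" and f: "\<And>p. 0 \<le> f p" "\<And>p. f p \<le> B" and T: "finite T"
  shows "(\<integral>\<omega>. f (P \<omega>) * (if \<forall>i<n. label i \<omega> \<notin> T then 1 else 0) \<partial>M)
    = (\<integral>\<omega>. f (P \<omega>) * (1 - (\<Sum>j\<in>T. P \<omega> (Suc j))) ^ n \<partial>M)"
    and "(\<integral>\<omega>. f (P \<omega>) * (if \<forall>i<n. label i \<omega> \<in> T then 1 else 0) \<partial>M)
    = (\<integral>\<omega>. f (P \<omega>) * (\<Sum>j\<in>T. P \<omega> (Suc j)) ^ n \<partial>M)"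
proof -
  have fP[measurable]: "(\<lambda>\<omega>. f (P \<omega>)) \<in> borel_measurable M" by measurable
  have Pnn: "AE \<omega> in M. \<forall>j. 0 \<le> P \<omega> (Suc j)"
    using regular by eventually_elim (auto intro: less_imp_le regular_frequenciesD)
  have fdd: "(\<integral>\<^sup>+\<omega>. ennreal (f (P \<omega>)) * (if \<forall>i<n. label i \<omega> = b i then 1 else 0) \<partial>M)
    = (\<integral>\<^sup>+\<omega>. ennreal (f (P \<omega>)) * (\<Prod>i<n. ennreal (P \<omega> (Suc (b i)))) \<partial>M)" for n b
  proof -
    have "(\<integral>\<^sup>+\<omega>. ennreal (f (P \<omega>)) * (if \<forall>i<n. label i \<omega> = b i then 1 else 0) \<partial>M)
        = (\<integral>\<^sup>+\<omega>. ennreal (f (P \<omega>)) * (if \<forall>i\<in>{1..n}. X i \<omega> = Suc (b (i - 1)) then 1 else 0) \<partial>M)"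
      by (intro nn_integral_cong) (simp only: all_label_iff_all_X)
    also have "\<dots> = (\<integral>\<^sup>+\<omega>. ennreal (f (P \<omega>)) * (\<Prod>i\<in>{1..n}. ennreal (P \<omega> (Suc (b (i - 1))))) \<partial>M)"
      by (rule expectation_sample_equals[OF prob_space_axioms sample _ fm f Pnn]) auto
    also have "\<dots> = (\<integral>\<^sup>+\<omega>. ennreal (f (P \<omega>)) * (\<Prod>i<n. ennreal (P \<omega> (Suc (b i)))) \<partial>M)"
      by (simp add: prod.atLeast1_atMost_eq)
    finally show ?thesis .
  qed
  have main: "(\<integral>\<omega>. f (P \<omega>) * (if \<forall>i<n. label i \<omega> \<in> S then 1 else 0) \<partial>M) = (\<integral>\<omega>. f (P \<omega>) * (\<mu> \<omega>) ^ n \<partial>M)"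
    if [measurable]: "\<mu> \<in> borel_measurable M"
      and ae: "AE \<omega> in M. 0 \<le> \<mu> \<omega> \<and> (\<Sum>j. if j \<in> S then ennreal (P \<omega> (Suc j)) else 0) = ennreal (\<mu> \<omega>)" for S \<mu>
  proof -
    have "(\<integral>\<^sup>+\<omega>. ennreal (f (P \<omega>) * (if \<forall>i<n. label i \<omega> \<in> S then 1 else 0)) \<partial>M)
        = (\<integral>\<^sup>+\<omega>. ennreal (f (P \<omega>)) * (if \<forall>i<n. label i \<omega> \<in> S then 1 else 0) \<partial>M)"
      by (intro nn_integral_cong) auto
    also have "\<dots> = (\<integral>\<^sup>+\<omega>. ennreal (f (P \<omega>)) * (\<Sum>j. if j \<in> S then ennreal (P \<omega> (Suc j)) else 0) ^ n \<partial>M)"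
      by (rule nn_integral_all_in_set[OF _ _ _ fdd]) measurable
    also have "\<dots> = (\<integral>\<^sup>+\<omega>. ennreal (f (P \<omega>) * (\<mu> \<omega>) ^ n) \<partial>M)"
      by (rule nn_integral_cong_AE) (use ae in eventually_elim, use f in \<open>auto simp: ennreal_mult ennreal_power\<close>)
    finally have "(\<integral>\<^sup>+\<omega>. ennreal (f (P \<omega>) * (if \<forall>i<n. label i \<omega> \<in> S then 1 else 0)) \<partial>M)
        = (\<integral>\<^sup>+\<omega>. ennreal (f (P \<omega>) * (\<mu> \<omega>) ^ n) \<partial>M)" .
    moreover have "AE \<omega> in M. 0 \<le> f (P \<omega>) * (\<mu> \<omega>) ^ n"
      using ae by eventually_elim (use f in auto)
    ultimately show ?thesis
      using f by (subst (1 2) integral_eq_nn_integral) auto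
  qed
  show "(\<integral>\<omega>. f (P \<omega>) * (if \<forall>i<n. label i \<omega> \<notin> T then 1 else 0) \<partial>M)
    = (\<integral>\<omega>. f (P \<omega>) * (1 - (\<Sum>j\<in>T. P \<omega> (Suc j))) ^ n \<partial>M)"
  proof (subst main[of "\<lambda>\<omega>. 1 - (\<Sum>j\<in>T. P \<omega> (Suc j))" "- T", unfolded Compl_iff, symmetric])
    show "AE \<omega> in M. 0 \<le> 1 - (\<Sum>j\<in>T. P \<omega> (Suc j)) \<and>
        (\<Sum>j. if j \<notin> T then ennreal (P \<omega> (Suc j)) else 0) = ennreal (1 - (\<Sum>j\<in>T. P \<omega> (Suc j)))"
      using regular
    proof eventually_elim
      case (elim \<omega>)
      note * = suminf_outside_finite[OF regular_frequenciesD(1)[OF elim] less_imp_le[OF regular_frequenciesD(2)[OF elim]] T]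
      show ?case using * by simp
    qed
  qed simp_all
  show "(\<integral>\<omega>. f (P \<omega>) * (if \<forall>i<n. label i \<omega> \<in> T then 1 else 0) \<partial>M)
    = (\<integral>\<omega>. f (P \<omega>) * (\<Sum>j\<in>T. P \<omega> (Suc j)) ^ n \<partial>M)"
  proof (rule main)
    show "AE \<omega> in M. 0 \<le> (\<Sum>j\<in>T. P \<omega> (Suc j)) \<and>
        (\<Sum>j. if j \<in> T then ennreal (P \<omega> (Suc j)) else 0) = ennreal (\<Sum>j\<in>T. P \<omega> (Suc j))"
      using Pnn
    proof eventually_elim
      case (elim \<omega>)
      have "(\<Sum>j. if j \<in> T then ennreal (P \<omega> (Suc j)) else 0) = (\<Sum>j\<in>T. if j \<in> T then ennreal (P \<omega> (Suc j)) else 0)"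
        by (intro suminf_finite T) auto
      also have "\<dots> = ennreal (\<Sum>j\<in>T. P \<omega> (Suc j))" using elim by (simp add: sum_ennreal)
      finally show ?case using elim by (auto intro: sum_nonneg)
    qed
  qed simp
qed

definition hit :: "nat \<Rightarrow> nat \<Rightarrow> 'a \<Rightarrow> real" where
  "hit n j \<omega> = (if \<exists>i<n. label i \<omega> = j then 1 else 0)"

lemma measurable_hit[measurable]: "hit n j \<in> borel_measurable M"
  unfolding hit_def by measurable

lemma hit_sums: 
  assumes "\<omega> \<in> space M"
  shows "(\<lambda>j. hit n j \<omega>) sums real (num_distinct X n \<omega>)"
proof -
  have "(\<lambda>j. hit n j \<omega>) sums (\<Sum>j\<in>(\<lambda>i. label i \<omega>) ` {..<n}. hit n j \<omega>)"
    by (intro sums_finite) (auto simp: hit_def)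
  also have "(\<Sum>j\<in>(\<lambda>i. label i \<omega>) ` {..<n}. hit n j \<omega>) = (\<Sum>j\<in>(\<lambda>i. label i \<omega>) ` {..<n}. 1)"
    by (intro sum.cong) (auto simp: hit_def)
  also have "\<dots> = real (card (Suc ` (\<lambda>i. label i \<omega>) ` {..<n}))" by (simp add: card_image)
  also have "Suc ` (\<lambda>i. label i \<omega>) ` {..<n} = (\<lambda>i. X i \<omega>) ` Suc ` {..<n}"
    using X_eq_Suc_label[OF assms] by (simp add: image_image)
  also have "Suc ` {..<n} = {1..n}" by (simp add: image_Suc_lessThan)
  finally show ?thesis by (simp add: num_distinct_def)
qed

lemma measurable_num_distinct[measurable]: "(\<lambda>\<omega>. real (num_distinct X n \<omega>)) \<in> borel_measurable M"
proof -
  have "(\<lambda>\<omega>. \<Sum>j. hit n j \<omega>) \<in> borel_measurable M" by measurable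
  then show ?thesis
    by (rule measurable_cong[THEN iffD1, rotated]) (simp add: sums_unique[OF hit_sums, symmetric])
qed

text \<open>Inclusion and exclusion express the moments of the indicators through the probabilities that a finite set is
  avoided, \<open>(1 - p\<^sub>j)\<^sup>n\<close> and \<open>(1 - p\<^sub>i - p\<^sub>j)\<^sup>n\<close>. The correlations are negative because
  \<open>1 - p\<^sub>i - p\<^sub>j \<le> (1 - p\<^sub>i) (1 - p\<^sub>j)\<close>.\<close>
lemma hit_moments:
  fixes n :: nat
  assumes fm[measurable]: "f \<in> borel_measurable seq_space" and f: "\<And>p. 0 \<le> f p" "\<And>p. f p \<le> B"
  defines "q \<equiv> \<lambda>j \<omega>. 1 - (1 - P \<omega> (Suc j)) ^ n"
  shows "(\<integral>\<^sup>+\<omega>. ennreal (f (P \<omega>) * hit n j \<omega>) \<partial>M) = (\<integral>\<^sup>+\<omega>. ennreal (f (P \<omega>) * q j \<omega>) \<partial>M)"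
    and "i \<noteq> j \<Longrightarrow> (\<integral>\<^sup>+\<omega>. ennreal (f (P \<omega>) * (hit n i \<omega> * hit n j \<omega>)) \<partial>M)
      \<le> (\<integral>\<^sup>+\<omega>. ennreal (f (P \<omega>) * (q i \<omega> * q j \<omega>)) \<partial>M)"
proof -
  have [measurable]: "q j \<in> borel_measurable M" for j unfolding q_def by measurable
  have fP[measurable]: "(\<lambda>\<omega>. f (P \<omega>)) \<in> borel_measurable M" by measurable
  define av where "av T \<omega> = (if \<forall>i<n. label i \<omega> \<notin> T then 1 else 0 :: real)" for T \<omega>
  define v where "v T \<omega> = (1 - (\<Sum>j\<in>T. P \<omega> (Suc j))) ^ n" for T \<omega>
  have [measurable]: "av T \<in> borel_measurable M" "v T \<in> borel_measurable M" for T
    unfolding av_def v_def by measurable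
  have int: "integrable M (\<lambda>\<omega>. f (P \<omega>) * g \<omega>)" if "g \<in> borel_measurable M" "AE \<omega> in M. \<bar>g \<omega>\<bar> \<le> 1" for g
  proof (rule integrable_const_bound[where B = B])
    show "AE \<omega> in M. norm (f (P \<omega>) * g \<omega>) \<le> B"
      using that(2)
    proof eventually_elim
      case (elim \<omega>)
      have "\<bar>f (P \<omega>)\<bar> * \<bar>g \<omega>\<bar> \<le> B * 1" using elim f order_trans[OF f] by (intro mult_mono) auto
      then show ?case by (simp add: abs_mult)
    qed
  qed (use that in measurable)
  have sum1: "AE \<omega> in M. \<forall>T. finite T \<longrightarrow> 0 \<le> (\<Sum>j\<in>T. P \<omega> (Suc j)) \<and> (\<Sum>j\<in>T. P \<omega> (Suc j)) \<le> 1"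
    using regular
  proof eventually_elim
    case (elim \<omega>)
    note pos = less_imp_le[OF regular_frequenciesD(2)[OF elim]]
    show ?case using suminf_outside_finite(2)[OF regular_frequenciesD(1)[OF elim] pos] pos
      by (auto intro!: sum_nonneg)
  qed
  have v01: "AE \<omega> in M. \<forall>T. finite T \<longrightarrow> \<bar>v T \<omega>\<bar> \<le> 1"
    using sum1
  proof eventually_elim
    case (elim \<omega>)
    show ?case
    proof (intro allI impI)
      fix T :: "nat set" assume "finite T"
      then have "\<bar>1 - (\<Sum>j\<in>T. P \<omega> (Suc j))\<bar> \<le> 1" using elim[rule_format, of T] by linarith
      then show "\<bar>v T \<omega>\<bar> \<le> 1" unfolding v_def power_abs by (intro power_le_one) auto
    qed
  qed
  have q01: "AE \<omega> in M. \<forall>j. 0 \<le> q j \<omega> \<and> q j \<omega> \<le> 1"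
    using regular
  proof eventually_elim
    case (elim \<omega>)
    show ?case unfolding q_def
      using occupancy_bounds(1,2)[OF less_imp_le[OF regular_frequenciesD(2)[OF elim]] regular_frequenciesD(3)[OF elim]]
      by blast
  qed
  have iav: "integrable M (\<lambda>\<omega>. f (P \<omega>) * av T \<omega>)" for T by (rule int) (auto simp: av_def)
  have iv: "integrable M (\<lambda>\<omega>. f (P \<omega>) * v T \<omega>)" if "finite T" for T
    by (rule int) (measurable, use v01 in eventually_elim, use that in auto)
  have if1: "integrable M (\<lambda>\<omega>. f (P \<omega>))" using int[of "\<lambda>_. 1"] by simp
  have avoid: "(\<integral>\<omega>. f (P \<omega>) * av T \<omega> \<partial>M) = (\<integral>\<omega>. f (P \<omega>) * v T \<omega> \<partial>M)" if "finite T" for T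
    unfolding av_def v_def using that by (intro expectation_sample_avoids(1)[OF fm f])
  have hit_av: "hit n j \<omega> = 1 - av {j} \<omega>" for j \<omega> by (auto simp: hit_def av_def)
  have q_v: "q j \<omega> = 1 - v {j} \<omega>" for j \<omega> by (simp add: q_def v_def)
  have e1: "(\<integral>\<omega>. f (P \<omega>) * hit n j \<omega> \<partial>M) = (\<integral>\<omega>. f (P \<omega>) * q j \<omega> \<partial>M)"
    unfolding hit_av q_v right_diff_distrib using iav iv if1 by (simp add: avoid)
  show "(\<integral>\<^sup>+\<omega>. ennreal (f (P \<omega>) * hit n j \<omega>) \<partial>M) = (\<integral>\<^sup>+\<omega>. ennreal (f (P \<omega>) * q j \<omega>) \<partial>M)"
  proof (subst nn_integral_eq_integral)
    show "integrable M (\<lambda>\<omega>. f (P \<omega>) * hit n j \<omega>)" by (rule int) (auto simp: hit_def)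
    show "AE \<omega> in M. 0 \<le> f (P \<omega>) * hit n j \<omega>" using f by (auto simp: hit_def)
    show "ennreal (\<integral>\<omega>. f (P \<omega>) * hit n j \<omega> \<partial>M) = (\<integral>\<^sup>+\<omega>. ennreal (f (P \<omega>) * q j \<omega>) \<partial>M)"
      unfolding e1
    proof (rule nn_integral_eq_integral[symmetric])
      show "integrable M (\<lambda>\<omega>. f (P \<omega>) * q j \<omega>)"
        by (rule int) (simp, use q01 in eventually_elim, auto simp: abs_le_iff intro: order_trans[of _ 0])
      show "AE \<omega> in M. 0 \<le> f (P \<omega>) * q j \<omega>" using q01 by eventually_elim (use f in auto)
    qed
  qed
  assume ij: "i \<noteq> j"
  have hh: "hit n i \<omega> * hit n j \<omega> = 1 - av {i} \<omega> - av {j} \<omega> + av {i, j} \<omega>" for \<omega>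
    by (auto simp: hit_def av_def)
  have "(\<integral>\<omega>. f (P \<omega>) * (hit n i \<omega> * hit n j \<omega>) \<partial>M)
      = (\<integral>\<omega>. f (P \<omega>) * (1 - v {i} \<omega> - v {j} \<omega> + v {i, j} \<omega>) \<partial>M)"
    unfolding hh distrib_left right_diff_distrib using iav iv if1 by (simp add: avoid)
  also have "\<dots> \<le> (\<integral>\<omega>. f (P \<omega>) * (q i \<omega> * q j \<omega>) \<partial>M)"
  proof (rule integral_mono_AE)
    show "integrable M (\<lambda>\<omega>. f (P \<omega>) * (1 - v {i} \<omega> - v {j} \<omega> + v {i, j} \<omega>))"
      unfolding distrib_left right_diff_distrib using iv if1 by simp
    show "integrable M (\<lambda>\<omega>. f (P \<omega>) * (q i \<omega> * q j \<omega>))"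
      by (rule int) (simp, use q01 in eventually_elim, auto simp: abs_mult intro!: mult_le_one)
    show "AE \<omega> in M. f (P \<omega>) * (1 - v {i} \<omega> - v {j} \<omega> + v {i, j} \<omega>) \<le> f (P \<omega>) * (q i \<omega> * q j \<omega>)"
      using sum1 regular
    proof eventually_elim
      case (elim \<omega>)
      let ?a = "P \<omega> (Suc i)" and ?b = "P \<omega> (Suc j)"
      have pos: "0 < ?a" "0 < ?b" using regular_frequenciesD(2)[OF elim(2)] by auto
      have "?a + ?b \<le> 1" using elim(1)[rule_format, of "{i, j}"] ij by simp
      then have "(1 - (?a + ?b)) ^ n \<le> ((1 - ?a) * (1 - ?b)) ^ n"
        using pos by (intro power_mono) (auto simp: algebra_simps)
      then have "v {i, j} \<omega> \<le> v {i} \<omega> * v {j} \<omega>"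
        using ij by (simp add: v_def power_mult_distrib)
      then show ?case using f by (intro mult_left_mono) (auto simp: q_v algebra_simps)
    qed
  qed
  finally have e2: "(\<integral>\<omega>. f (P \<omega>) * (hit n i \<omega> * hit n j \<omega>) \<partial>M) \<le> (\<integral>\<omega>. f (P \<omega>) * (q i \<omega> * q j \<omega>) \<partial>M)" .
  show "(\<integral>\<^sup>+\<omega>. ennreal (f (P \<omega>) * (hit n i \<omega> * hit n j \<omega>)) \<partial>M)
      \<le> (\<integral>\<^sup>+\<omega>. ennreal (f (P \<omega>) * (q i \<omega> * q j \<omega>)) \<partial>M)"
  proof (subst (1 2) nn_integral_eq_integral)
    show "integrable M (\<lambda>\<omega>. f (P \<omega>) * (hit n i \<omega> * hit n j \<omega>))" by (rule int) (auto simp: hit_def)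
    show "AE \<omega> in M. 0 \<le> f (P \<omega>) * (hit n i \<omega> * hit n j \<omega>)" using f by (auto simp: hit_def)
    show "integrable M (\<lambda>\<omega>. f (P \<omega>) * (q i \<omega> * q j \<omega>))"
      by (rule int) (simp, use q01 in eventually_elim, auto simp: abs_mult intro!: mult_le_one)
    show "AE \<omega> in M. 0 \<le> f (P \<omega>) * (q i \<omega> * q j \<omega>)" using q01 by eventually_elim (use f in auto)
  qed (rule ennreal_leI[OF e2])
qed

text \<open>The strong law applies with the random centring \<open>expected_count (P \<omega>) n\<close>, the conditional
  expectation of the number of distinct values.\<close>
lemma AE_num_distinct_asymp:
  "AE \<omega> in M. (\<lambda>n. real (num_distinct X n \<omega>) / real n powr \<alpha>) \<longlonglongrightarrow> (tail_constant \<alpha> (P \<omega>) / \<alpha>) powr \<alpha>"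
proof (rule LLN_along_powers[where Q = "\<lambda>n \<omega>. expected_count (P \<omega>) n"])
  show "AE \<omega> in M. \<forall>n\<ge>1. 0 < expected_count (P \<omega>) n"
    using regular by eventually_elim (auto intro: less_le_trans[OF zero_less_one regular_frequenciesD(5)])
  show "AE \<omega> in M. (\<lambda>n. expected_count (P \<omega>) n / real n powr \<alpha>) \<longlonglongrightarrow> (tail_constant \<alpha> (P \<omega>) / \<alpha>) powr \<alpha>"
    using regular by eventually_elim (auto simp: regular_frequencies_def)
  show "AE \<omega> in M. mono (\<lambda>n. real (num_distinct X n \<omega>)) \<and> (\<forall>n. 0 \<le> real (num_distinct X n \<omega>))"
    by (intro AE_I2 conjI monoI) (auto simp: num_distinct_def intro!: card_mono image_mono)
  fix n :: nat assume n: "1 \<le> n"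
  \<comment> \<open>the weight \<open>1 / Q\<close>, truncated so as to be bounded for all frequencies; for regular ones \<open>Q \<ge> 1\<close>\<close>
  define f where "f p = 1 / max 1 (expected_count p n)" for p
  have fm: "f \<in> borel_measurable seq_space" unfolding f_def by measurable
  have f01: "0 \<le> f p" "f p \<le> 1" for p by (auto simp: f_def)
  have fP: "AE \<omega> in M. f (P \<omega>) = 1 / expected_count (P \<omega>) n"
    using regular by eventually_elim (use regular_frequenciesD(5) n in \<open>auto simp: f_def max_def\<close>)
  let ?q = "\<lambda>j \<omega>. 1 - (1 - P \<omega> (Suc j)) ^ n"
  have weight: "(\<integral>\<^sup>+\<omega>. ennreal (g \<omega> / expected_count (P \<omega>) n) \<partial>M) = (\<integral>\<^sup>+\<omega>. ennreal (f (P \<omega>) * g \<omega>) \<partial>M)" for g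
    by (rule nn_integral_cong_AE) (use fP in eventually_elim, simp)
  have "(\<integral>\<^sup>+\<omega>. ennreal (((\<Sum>j. hit n j \<omega>) - (\<Sum>j. ?q j \<omega>))\<^sup>2 / (\<Sum>j. ?q j \<omega>)) \<partial>M) \<le> 1"
  proof (rule chi_square_count_bound[OF prob_space_axioms], fold expected_count_def)
    show "AE \<omega> in M. 0 \<le> hit n j \<omega> \<and> hit n j \<omega> \<le> 1" for j by (auto simp: hit_def)
    show "AE \<omega> in M. 0 \<le> ?q j \<omega>" for j
      using regular by eventually_elim (intro occupancy_bounds(1) less_imp_le regular_frequenciesD)
    show "AE \<omega> in M. summable (\<lambda>j. hit n j \<omega>)" by (intro AE_I2 sums_summable[OF hit_sums])
    show "AE \<omega> in M. summable (\<lambda>j. ?q j \<omega>) \<and> 0 < expected_count (P \<omega>) n"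
      using regular by eventually_elim
        (use n in \<open>auto intro: regular_frequenciesD(4) less_le_trans[OF zero_less_one regular_frequenciesD(5)]\<close>)
    show "(\<integral>\<^sup>+\<omega>. ennreal (hit n j \<omega>) \<partial>M) = (\<integral>\<^sup>+\<omega>. ennreal (?q j \<omega>) \<partial>M)" for j
      using hit_moments(1)[of "\<lambda>_. 1" 1 n j] by simp
    show "(\<integral>\<^sup>+\<omega>. ennreal (hit n j \<omega> / expected_count (P \<omega>) n) \<partial>M) = (\<integral>\<^sup>+\<omega>. ennreal (?q j \<omega> / expected_count (P \<omega>) n) \<partial>M)" for j
      unfolding weight by (rule hit_moments(1)[OF fm f01])
    show "(\<integral>\<^sup>+\<omega>. ennreal (hit n i \<omega> * hit n j \<omega> / expected_count (P \<omega>) n) \<partial>M)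
        \<le> (\<integral>\<^sup>+\<omega>. ennreal (?q i \<omega> * ?q j \<omega> / expected_count (P \<omega>) n) \<partial>M)" if "i \<noteq> j" for i j
      unfolding weight by (rule hit_moments(2)[OF fm f01 that])
    have "(\<integral>\<^sup>+\<omega>. ennreal (expected_count (P \<omega>) n) \<partial>M) \<le> (\<integral>\<^sup>+\<omega>. ennreal (real n) \<partial>M)"
      by (rule nn_integral_mono_AE) (use regular in eventually_elim, intro ennreal_leI regular_frequenciesD(6))
    then show "(\<integral>\<^sup>+\<omega>. ennreal (expected_count (P \<omega>) n) \<partial>M) \<noteq> \<infinity>"
      by (auto simp: emeasure_space_1 top_unique)
  qed measurable
  also have "(\<integral>\<^sup>+\<omega>. ennreal (((\<Sum>j. hit n j \<omega>) - (\<Sum>j. ?q j \<omega>))\<^sup>2 / (\<Sum>j. ?q j \<omega>)) \<partial>M)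
      = (\<integral>\<^sup>+\<omega>. ennreal ((real (num_distinct X n \<omega>) - expected_count (P \<omega>) n)\<^sup>2 / expected_count (P \<omega>) n) \<partial>M)"
    unfolding expected_count_def by (intro nn_integral_cong) (simp add: sums_unique[OF hit_sums, symmetric])
  finally show "(\<integral>\<^sup>+\<omega>. ennreal ((real (num_distinct X n \<omega>) - expected_count (P \<omega>) n)\<^sup>2 / expected_count (P \<omega>) n) \<partial>M) \<le> 1" .
qed (use \<alpha> in measurable)

lemma AE_alpha_diversity:
  "AE \<omega> in M. \<alpha> * alpha_diversity \<alpha> X \<omega> powr (1 / \<alpha>) = tail_constant \<alpha> (P \<omega>)"
  using AE_num_distinct_asymp regular
proof eventually_elim
  case (elim \<omega>)
  have "0 < tail_constant \<alpha> (P \<omega>)" using elim(2) by (simp add: regular_frequencies_def)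
  moreover have "alpha_diversity \<alpha> X \<omega> = (tail_constant \<alpha> (P \<omega>) / \<alpha>) powr \<alpha>"
    unfolding alpha_diversity_def by (rule limI) (rule elim(1))
  ultimately show ?case using \<alpha> by (simp add: powr_powr)
qed

lemma prob_sample_max_le:
  assumes n: "1 \<le> n" and y: "0 \<le> y"
  shows "measure M {\<omega> \<in> space M. real (sample_max X n \<omega>) \<le> y} = (\<integral>\<omega>. (1 - tail_mass (P \<omega>) (nat \<lfloor>y\<rfloor>)) ^ n \<partial>M)"
proof -
  let ?k = "nat \<lfloor>y\<rfloor>"
  have iff: "real (sample_max X n \<omega>) \<le> y \<longleftrightarrow> (\<forall>i<n. label i \<omega> \<in> {..<?k})" if \<omega>: "\<omega> \<in> space M" for \<omega>
  proof -
    have "real (sample_max X n \<omega>) \<le> y \<longleftrightarrow> sample_max X n \<omega> \<le> ?k"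
      using y by (simp add: le_nat_iff le_floor_iff)
    also have "\<dots> \<longleftrightarrow> (\<forall>i\<in>{1..n}. X i \<omega> \<le> ?k)"
      unfolding sample_max_def using n by (subst Max_le_iff) auto
    also have "{1..n} = Suc ` {..<n}" by (simp add: image_Suc_lessThan)
    finally show ?thesis using X_eq_Suc_label[OF \<omega>] by (auto simp: Suc_le_eq)
  qed
  have "measure M {\<omega> \<in> space M. real (sample_max X n \<omega>) \<le> y} = measure M {\<omega> \<in> space M. \<forall>i<n. label i \<omega> \<in> {..<?k}}"
    using iff by (intro arg_cong[where f = "measure M"]) auto
  also have "\<dots> = (\<integral>\<omega>. indicator {\<omega> \<in> space M. \<forall>i<n. label i \<omega> \<in> {..<?k}} \<omega> \<partial>M)" by simp
  also have "\<dots> = (\<integral>\<omega>. 1 * (if \<forall>i<n. label i \<omega> \<in> {..<?k} then 1 else 0) \<partial>M)"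
    by (intro Bochner_Integration.integral_cong) (auto simp: indicator_def)
  also have "\<dots> = (\<integral>\<omega>. 1 * (\<Sum>j\<in>{..<?k}. P \<omega> (Suc j)) ^ n \<partial>M)"
    by (intro expectation_sample_avoids(2)[of "\<lambda>_. 1" 1]) auto
  finally show ?thesis by (simp add: tail_mass_def)
qed

end

section \<open>The maximum of a sample\<close>

text \<open>The exponent \<open>\<alpha> / (1 - \<alpha>)\<close> of the normalisation is the reciprocal of \<open>\<gamma> = (1 - \<alpha>) / \<alpha>\<close>: at
  \<open>k = x n powr (1 / \<gamma>)\<close> the power \<open>k powr (- \<gamma>)\<close> equals \<open>x powr (- \<gamma>) / n\<close>, and rounding
  down does not change the asymptotics.\<close>
lemma scaled_tail_mass_tendsto:
  assumes \<alpha>: "0 < \<alpha>" "\<alpha> < 1" and p: "regular_frequencies \<alpha> p" and x: "0 < x"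
  shows "(\<lambda>n. real n * tail_mass p (nat \<lfloor>x * real n powr (\<alpha> / (1 - \<alpha>))\<rfloor>)) \<longlonglongrightarrow> tail_constant \<alpha> p * x powr - ((1 - \<alpha>) / \<alpha>)"
proof -
  define \<gamma> where "\<gamma> = (1 - \<alpha>) / \<alpha>"
  define y where "y n = x * real n powr (\<alpha> / (1 - \<alpha>))" for n :: nat
  have y_top: "filterlim y at_top sequentially"
    unfolding y_def using \<alpha> x
    by (intro filterlim_tendsto_pos_mult_at_top[OF tendsto_const] filterlim_compose[OF real_powr_at_top filterlim_real_sequentially]) auto
  then have k_top: "filterlim (\<lambda>n. nat \<lfloor>y n\<rfloor>) at_top sequentially"
    by (intro filterlim_compose[OF filterlim_nat_sequentially] filterlim_compose[OF filterlim_floor_sequentially])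
  have "(\<lambda>k. tail_mass p k * real k powr \<gamma>) \<longlonglongrightarrow> tail_constant \<alpha> p"
    using p by (simp add: regular_frequencies_def \<gamma>_def)
  from filterlim_compose[OF this k_top]
  have "(\<lambda>n. tail_mass p (nat \<lfloor>y n\<rfloor>) * real (nat \<lfloor>y n\<rfloor>) powr \<gamma> / (real (nat \<lfloor>y n\<rfloor>) / y n) powr \<gamma> / x powr \<gamma>)
      \<longlonglongrightarrow> tail_constant \<alpha> p / 1 powr \<gamma> / x powr \<gamma>"
    using x by (intro tendsto_intros nat_floor_ratio_tendsto_1 y_top) auto
  moreover have "\<forall>\<^sub>F n in sequentially. tail_mass p (nat \<lfloor>y n\<rfloor>) * real (nat \<lfloor>y n\<rfloor>) powr \<gamma> / (real (nat \<lfloor>y n\<rfloor>) / y n) powr \<gamma> / x powr \<gamma>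
      = real n * tail_mass p (nat \<lfloor>y n\<rfloor>)"
    using filterlim_at_top[THEN iffD1, OF k_top, rule_format, of 1] eventually_gt_at_top[of 0]
  proof eventually_elim
    case (elim n)
    have "y n powr \<gamma> = x powr \<gamma> * (real n powr (\<alpha> / (1 - \<alpha>))) powr \<gamma>"
      using x by (simp add: y_def powr_mult)
    also have "(real n powr (\<alpha> / (1 - \<alpha>))) powr \<gamma> = real n"
      using \<alpha> by (simp add: powr_powr \<gamma>_def)
    finally have yn: "y n powr \<gamma> = x powr \<gamma> * real n" .
    have "0 < y n" using x elim by (simp add: y_def)
    then have "(real (nat \<lfloor>y n\<rfloor>) / y n) powr \<gamma> = real (nat \<lfloor>y n\<rfloor>) powr \<gamma> / (x powr \<gamma> * real n)"
      by (simp add: powr_divide yn)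
    moreover have "t * k / (k / (z * m)) / z = m * t" if "0 < k" "0 < z" "0 < m" for t k z m :: real
      using that by simp
    moreover have "0 < real (nat \<lfloor>y n\<rfloor>) powr \<gamma>" "0 < x powr \<gamma>" "0 < real n" using elim x by auto
    ultimately show ?case by metis
  qed
  ultimately have "(\<lambda>n. real n * tail_mass p (nat \<lfloor>y n\<rfloor>)) \<longlonglongrightarrow> tail_constant \<alpha> p / 1 powr \<gamma> / x powr \<gamma>"
    by (rule Lim_transform_eventually)
  then show ?thesis by (simp add: y_def \<gamma>_def powr_minus divide_inverse)
qed

theorem theorem6p1:
  fixes M :: "'a measure" and P :: "'a \<Rightarrow> nat \<Rightarrow> real" and X :: "nat \<Rightarrow> 'a \<Rightarrow> nat"
    and \<alpha> \<theta> x :: real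
  assumes "prob_space M"
    and "0 < \<alpha>" and "\<alpha> < 1" and "\<theta> > - \<alpha>"
    and "sample_from M P X"
    and "distr M seq_space P = GEM \<alpha> \<theta>"
    and "x > 0"
  shows "(\<lambda>n. measure M {\<omega> \<in> space M.
              real (sample_max X n \<omega>) \<le> x * real n powr (\<alpha> / (1 - \<alpha>))})
         \<longlonglongrightarrow> integral\<^sup>L M (\<lambda>\<omega>.
              exp (- \<alpha> * alpha_diversity \<alpha> X \<omega> powr (1 / \<alpha>) * x powr (- ((1 - \<alpha>) / \<alpha>))))"
proof -
  have P: "P \<in> measurable M seq_space" using assms(5) by (simp add: sample_from_def)
  have "AE \<omega> in M. regular_frequencies \<alpha> (P \<omega>)"
    by (rule AE_distrD[OF P]) (simp only: assms(6) AE_GEM_regular[OF assms(2-4)])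
  with assms interpret regular_sample M P X \<alpha> by (simp add: regular_sample_def regular_sample_axioms_def)
  let ?k = "\<lambda>n. nat \<lfloor>x * real n powr (\<alpha> / (1 - \<alpha>))\<rfloor>"
  let ?lim = "\<lambda>\<omega>. exp (- (tail_constant \<alpha> (P \<omega>) * x powr - ((1 - \<alpha>) / \<alpha>)))"
  have "(\<lambda>n. \<integral>\<omega>. (1 - tail_mass (P \<omega>) (?k n)) ^ n \<partial>M) \<longlonglongrightarrow> (\<integral>\<omega>. ?lim \<omega> \<partial>M)"
  proof (rule integral_dominated_convergence[where w = "\<lambda>_. 1"])
    show "AE \<omega> in M. (\<lambda>n. (1 - tail_mass (P \<omega>) (?k n)) ^ n) \<longlonglongrightarrow> ?lim \<omega>"
      using regular
      by eventually_elim (intro power_one_minus_tendsto_exp scaled_tail_mass_tendsto[OF \<alpha>] assms(7))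
    show "AE \<omega> in M. norm ((1 - tail_mass (P \<omega>) (?k n)) ^ n) \<le> 1" for n
      using regular
    proof eventually_elim
      case (elim \<omega>)
      then show ?case using tail_mass_bounds[OF elim(1), of "?k n"] by (simp add: power_abs power_le_one)
    qed
  qed simp_all
  also have "(\<integral>\<omega>. ?lim \<omega> \<partial>M) = (\<integral>\<omega>. exp (- \<alpha> * alpha_diversity \<alpha> X \<omega> powr (1 / \<alpha>) * x powr (- ((1 - \<alpha>) / \<alpha>))) \<partial>M)"
  proof (rule integral_cong_AE)
    show "(\<lambda>\<omega>. exp (- \<alpha> * alpha_diversity \<alpha> X \<omega> powr (1 / \<alpha>) * x powr (- ((1 - \<alpha>) / \<alpha>)))) \<in> borel_measurable M"
      unfolding alpha_diversity_def by measurable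
    show "AE \<omega> in M. ?lim \<omega> = exp (- \<alpha> * alpha_diversity \<alpha> X \<omega> powr (1 / \<alpha>) * x powr (- ((1 - \<alpha>) / \<alpha>)))"
      using AE_alpha_diversity by eventually_elim simp
  qed measurable
  finally show ?thesis
  proof (rule Lim_transform_eventually, use eventually_ge_at_top[of 1] in eventually_elim)
    case (elim n)
    then show ?case using assms(7) by (subst prob_sample_max_le) auto
  qed
qed

end
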